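(* Let $2\le p<\gamma\le 3$, let $T>0$, and let $x:[0,T]\to\mathbb{R}^d$ be a continuous path of finite $p$-variation, together with given quantities $A^{rj}(s,t)$ satisfying the consistency condition and bound stated in the context. Let $f=(f^i_j)\in C^{\gamma}$ and $y_0\in\mathbb{R}^n$. Let $0<\tau\le T$ and let $y$ be a solution (in the sense defined in the context) for $0\le t<\tau$ of $$dy^i=\sum_{j=1}^d f^i_j(y)\,dx^j,\qquad y^i(0)=y^i_0,\quad i=1,\dots,n,$$ such that either $\tau=T$ or $|y(t)|\to\infty$ as $t\to\tau$ (such $\tau$ and $y$ exist). Then $y$ is unique in the sense that if $t<\tau$ and $\tilde y$ is another solution of the equation on $[0,t]$ (with the same initial value $y_0$), then $\tilde y=y$ on $[0,t]$. Moreover, if $t<\tau$ and $\epsilon>0$, there is $\delta>0$ such that whenever $0=t_0<t_1<\dots<t_K=t$ with $t_k-t_{k-1}<\delta$ for each $k$, we have $|y_k-y(t_k)|<\epsilon$ for each $k=0,\dots,K$, where $y_k$ is defined, starting from the given $y_0$, by $$y^i_{k+1}=y^i_k+\sum_j f^i_j(y_k)\,(x^j(t_{k+1})-x^j(t_k))+\sum_{h,r,j}f^h_r(y_k)\,\partial_hf^i_j(y_k)\,A^{rj}(t_k,t_{k+1}).$$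
   Context: $n,d$ are positive integers. For $\rho=N+\alpha$ with $N$ a positive integer and $0<\alpha\le 1$, $C^\rho$ is the set of $f=(f^i_j)_{1\le i\le n,\,1\le j\le d}$ such that each $f^i_j:\mathbb{R}^n\to\mathbb{R}$ has derivatives up to order $N$, all of which satisfy locally a Hölder condition of exponent $\alpha$ (so for integer $\rho$ the derivatives of order $\rho-1$ are locally Lipschitz). Driving data: there is a continuous increasing function $\omega$ on $[0,T]$ with $|x(t)-x(s)|^p\le\omega(t)-\omega(s)$ for $0\le s\le t\le T$. Real numbers $A^{rj}(s,t)$ are given for $1\le r,j\le d$ and $0\le s\le t\le T$ such that for $s\le t\le u$ $$A^{rj}(s,u)=A^{rj}(s,t)+A^{rj}(t,u)+(x^r(t)-x^r(s))(x^j(u)-x^j(t)),$$ and $|A^{rj}(s,t)|^{p/2}\le\omega(t)-\omega(s)$. Solution: $y:[0,t_1]\to\mathbb{R}^n$ is a solution on $[0,t_1]$ if $y(0)=y_0$ and there exist a continuous increasing function $\tilde\omega$ on $[0,t_1]$ and a non-negative function $\theta$ on $[0,\infty)$ with $\theta(\delta)=o(\delta)$ as $\delta\to0$ such that for all $i$ and all $0\le s<t\le t_1$ $$\Big|y^i(t)-y^i(s)-\sum_j f^i_j(y(s))(x^j(t)-x^j(s))-\sum_{h,r,j}f^h_r(y(s))\,\partial_hf^i_j(y(s))\,A^{rj}(s,t)\Big|\le\theta(\tilde\omega(t)-\tilde\omega(s)),$$ where $h$ runs over $1,\dots,n$, $r,j$ over $1,\dots,d$ and $\partial_h=\partial/\partial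 y^h$. A solution for $0\le t<\tau$ is a function on $[0,\tau)$ whose restriction to $[0,t_1]$ is a solution on $[0,t_1]$ for every $t_1<\tau$. *)

theory Defs
  imports "HOL-Analysis.Analysis" "HOL-Library.Landau_Symbols"
begin

text \<open>
  Throughout, \<open>'n\<close> and \<open>'d\<close> are finite index types with \<open>n\<close> and \<open>d\<close> elements, and
  \<open>f i j\<close> is the real function written \<open>f^i_j\<close>.
\<close>

definition locally_holder :: "real \<Rightarrow> ('a::metric_space \<Rightarrow> real) \<Rightarrow> bool" where
  "locally_holder \<alpha> g \<longleftrightarrow>
     (\<forall>z. \<exists>e>0. \<exists>C. \<forall>u\<in>ball z e. \<forall>v\<in>ball z e. \<bar>g u - g v\<bar> \<le> C * dist u v powr \<alpha>)"

definition partial_deriv :: "'n::finite \<Rightarrow> (real^'n \<Rightarrow> real) \<Rightarrow> real^'n \<Rightarrow> real" where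
  "partial_deriv h g z = frechet_derivative g (at z) (axis h 1)"

text \<open>
  \<open>holder_smooth N \<alpha> g\<close>: \<open>g\<close> has derivatives up to order \<open>N\<close>, and all of them (including \<open>g\<close>
  itself, as the derivative of order 0) are locally Hoelder with exponent \<open>\<alpha>\<close>.
\<close>

primrec holder_smooth :: "nat \<Rightarrow> real \<Rightarrow> (real^'n::finite \<Rightarrow> real) \<Rightarrow> bool" where
  "holder_smooth 0 \<alpha> g \<longleftrightarrow> locally_holder \<alpha> g"
| "holder_smooth (Suc N) \<alpha> g \<longleftrightarrow>
     locally_holder \<alpha> g \<and> (\<forall>z. g differentiable (at z)) \<and>
     (\<forall>h. holder_smooth N \<alpha> (partial_deriv h g))"

text \<open>The decomposition \<open>\<rho> = N + \<alpha>\<close> with \<open>0 < \<alpha> \<le> 1\<close> is unique; for integer \<open>\<rho>\<close> it is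
  \<open>N = \<rho> - 1\<close>, \<open>\<alpha> = 1\<close>.\<close>

definition C_class :: "real \<Rightarrow> ('n::finite \<Rightarrow> 'd::finite \<Rightarrow> real^'n \<Rightarrow> real) \<Rightarrow> bool" where
  "C_class \<rho> f \<longleftrightarrow>
     (\<exists>N::nat. \<exists>\<alpha>. 1 \<le> N \<and> 0 < \<alpha> \<and> \<alpha> \<le> 1 \<and> \<rho> = real N + \<alpha> \<and>
        (\<forall>i j. holder_smooth N \<alpha> (f i j)))"

text \<open>Finite \<open>p\<close>-variation is expressed by a control function \<open>\<omega>\<close>.
  "Increasing" is read in the non-strict sense.\<close>

definition finite_p_variation_by ::
    "(real \<Rightarrow> real) \<Rightarrow> real \<Rightarrow> real \<Rightarrow> (real \<Rightarrow> real^'d::finite) \<Rightarrow> bool" where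
  "finite_p_variation_by \<omega> p T x \<longleftrightarrow>
     continuous_on {0..T} \<omega> \<and> mono_on {0..T} \<omega> \<and>
     (\<forall>s t. 0 \<le> s \<and> s \<le> t \<and> t \<le> T \<longrightarrow> norm (x t - x s) powr p \<le> \<omega> t - \<omega> s)"

text \<open>The superscripts and arguments of \<open>A^{rj}(s,t)\<close> are written \<open>A r j s t\<close>.\<close>

definition area_data ::
    "(real \<Rightarrow> real) \<Rightarrow> real \<Rightarrow> real \<Rightarrow> (real \<Rightarrow> real^'d::finite) \<Rightarrow>
     ('d \<Rightarrow> 'd \<Rightarrow> real \<Rightarrow> real \<Rightarrow> real) \<Rightarrow> bool" where
  "area_data \<omega> p T x A \<longleftrightarrow>
     (\<forall>r j s t u. 0 \<le> s \<and> s \<le> t \<and> t \<le> u \<and> u \<le> T \<longrightarrow>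
        A r j s u = A r j s t + A r j t u + (x t $ r - x s $ r) * (x u $ j - x t $ j)) \<and>
     (\<forall>r j s t. 0 \<le> s \<and> s \<le> t \<and> t \<le> T \<longrightarrow> \<bar>A r j s t\<bar> powr (p / 2) \<le> \<omega> t - \<omega> s)"

text \<open>Component \<open>i\<close> of the second-order increment over \<open>[s,t]\<close> started at the point \<open>v\<close>.\<close>

definition increment ::
    "('n::finite \<Rightarrow> 'd::finite \<Rightarrow> real^'n \<Rightarrow> real) \<Rightarrow> (real \<Rightarrow> real^'d) \<Rightarrow>
     ('d \<Rightarrow> 'd \<Rightarrow> real \<Rightarrow> real \<Rightarrow> real) \<Rightarrow> real \<Rightarrow> real \<Rightarrow> real^'n \<Rightarrow> 'n \<Rightarrow> real" where
  "increment f x A s t v i =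
     (\<Sum>j\<in>UNIV. f i j v * (x t $ j - x s $ j)) +
     (\<Sum>h\<in>UNIV. \<Sum>r\<in>UNIV. \<Sum>j\<in>UNIV. f h r v * partial_deriv h (f i j) v * A r j s t)"

text \<open>
  Since \<open>\<omega>'\<close> may be constant on an interval, the value \<open>\<theta> 0\<close> matters. The condition
  \<open>\<theta>(\<delta>) = o(\<delta>)\<close> on \<open>[0,\<infinity>)\<close> is taken to include \<open>\<delta> = 0\<close>, which forces \<open>\<theta> 0 = 0\<close>;
  this has to be stated separately because \<open>at_right 0\<close> does not see the point 0.
  With this, requiring \<open>\<omega>'\<close> to be strictly increasing would define the same solutions.
\<close>

definition solution_on ::
    "('n::finite \<Rightarrow> 'd::finite \<Rightarrow> real^'n \<Rightarrow> real) \<Rightarrow> (real \<Rightarrow> real^'d) \<Rightarrow>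
     ('d \<Rightarrow> 'd \<Rightarrow> real \<Rightarrow> real \<Rightarrow> real) \<Rightarrow> real^'n \<Rightarrow> real \<Rightarrow> (real \<Rightarrow> real^'n) \<Rightarrow> bool" where
  "solution_on f x A y0 t1 y \<longleftrightarrow>
     y 0 = y0 \<and>
     (\<exists>\<omega>' \<theta>. continuous_on {0..t1} \<omega>' \<and> mono_on {0..t1} \<omega>' \<and>
        (\<forall>\<delta>\<ge>0. 0 \<le> \<theta> \<delta>) \<and> \<theta> 0 = 0 \<and> \<theta> \<in> o[at_right 0](\<lambda>\<delta>. \<delta>) \<and>
        (\<forall>i s t. 0 \<le> s \<and> s < t \<and> t \<le> t1 \<longrightarrow>
           \<bar>y t $ i - y s $ i - increment f x A s t (y s) i\<bar> \<le> \<theta> (\<omega>' t - \<omega>' s)))"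

definition solution_before ::
    "('n::finite \<Rightarrow> 'd::finite \<Rightarrow> real^'n \<Rightarrow> real) \<Rightarrow> (real \<Rightarrow> real^'d) \<Rightarrow>
     ('d \<Rightarrow> 'd \<Rightarrow> real \<Rightarrow> real \<Rightarrow> real) \<Rightarrow> real^'n \<Rightarrow> real \<Rightarrow> (real \<Rightarrow> real^'n) \<Rightarrow> bool" where
  "solution_before f x A y0 \<tau> y \<longleftrightarrow>
     (\<forall>t1. 0 \<le> t1 \<and> t1 < \<tau> \<longrightarrow> solution_on f x A y0 t1 y)"

definition maximal_solution ::
    "('n::finite \<Rightarrow> 'd::finite \<Rightarrow> real^'n \<Rightarrow> real) \<Rightarrow> (real \<Rightarrow> real^'d) \<Rightarrow>
     ('d \<Rightarrow> 'd \<Rightarrow> real \<Rightarrow> real \<Rightarrow> real) \<Rightarrow> real^'n \<Rightarrow> real \<Rightarrow> real \<Rightarrow> (real \<Rightarrow> real^'n) \<Rightarrow> bool" where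
  "maximal_solution f x A y0 T \<tau> y \<longleftrightarrow>
     0 < \<tau> \<and> \<tau> \<le> T \<and> solution_before f x A y0 \<tau> y \<and>
     (\<tau> = T \<or> filterlim (\<lambda>t. norm (y t)) at_top (at_left \<tau>))"

primrec discrete_approx ::
    "('n::finite \<Rightarrow> 'd::finite \<Rightarrow> real^'n \<Rightarrow> real) \<Rightarrow> (real \<Rightarrow> real^'d) \<Rightarrow>
     ('d \<Rightarrow> 'd \<Rightarrow> real \<Rightarrow> real \<Rightarrow> real) \<Rightarrow> real^'n \<Rightarrow> (nat \<Rightarrow> real) \<Rightarrow> nat \<Rightarrow> real^'n" where
  "discrete_approx f x A y0 ts 0 = y0"
| "discrete_approx f x A y0 ts (Suc k) =
     discrete_approx f x A y0 ts k +
     (\<chi> i. increment f x A (ts k) (ts (Suc k)) (discrete_approx f x A y0 ts k) i)"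

end

theory Submission
  imports Defs
begin

text \<open>
  The step map \<open>v \<mapsto> v + H s t v\<close>, with \<open>H\<close> the second-order increment, is a flow up to an error of order
  \<open>\<gamma>/p > 1\<close> in the control, and so is the difference of two of its orbits, relative to the distance of
  the orbits; the second fact is where \<open>f \<in> C^\<gamma>\<close> with \<open>\<gamma> > p\<close> is needed. Bisecting the grid
  (\<open>sewing_induction\<close>) turns these local bounds into bounds for discrete orbits that do not depend on the
  grid, in particular into a uniform Lipschitz bound in the initial point. Comparing the
  discrete orbits restarted at the points of a given solution, the distance between the solution and
  the scheme is then at most a constant times the sum of the local errors of the solution, which tends
  to 0 with the mesh. This gives convergence and, since the limit of the scheme is unique,
  uniqueness. Existence follows from the grid-independent bounds by compactness.
\<close>

section \<open>Discrete orbits of an almost flow\<close>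

text \<open>The obstacle is that \<alpha> may be below 1. The coefficients of the area term,
  products of \<open>f\<close> and its first derivatives, have only an \<alpha>-Hoelder gradient, so
  comparing the steps of two orbits with the steps of their one-step predictions costs
  \<rho>^\<alpha> instead of \<rho>, where \<rho> is the distance between orbit and prediction. Two
  facts pay for this: the area carries the factor w^(2/p), with w the control of the interval, and
  \<rho> is already of order w^(\<gamma>/p), so the product has exponent (2 + \<alpha> (2 +
  \<alpha>))/p, at least \<gamma>/p. This is why the defect of one orbit is bounded before that of a
  difference. A given solution comes with an unknown control and an error that is merely
  o(\<delta>), so stability is drawn from the scheme and not from the solution. \<open>f\<close> is
  not assumed bounded or globally Lipschitz, so every constant lives on a ball, every bound has to
  be accompanied by a proof that the orbits stay in the ball, and smallness is available only on
  pieces of small control, which are then chained.\<close>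

lemma norm_add3: "norm (a + b + c) \<le> norm a + norm b + norm c" for a b c :: "'a::real_normed_vector"
  using norm_triangle_ineq[of "a + b" c] norm_triangle_ineq[of a b] by linarith

text \<open>A discrete sewing argument. \<open>W\<close> may jump, so no index need halve the
  control; cutting at two neighbouring indices leaves two outer pieces of at most half the control
  each, while the single step between them has defect 0. Each halving gains 2^-q, which by
  hypothesis beats the total weight 2 + \<epsilon> of the two pieces.\<close>

lemma sewing_induction:
  fixes W :: "nat \<Rightarrow> real" and J :: "nat \<Rightarrow> nat \<Rightarrow> real"
  assumes q: "0 < q" and \<epsilon>: "0 \<le> \<epsilon>" "(2 + \<epsilon>) * 2 powr - q < 1" and c: "0 \<le> c"
    and mono: "\<And>k l. a \<le> k \<Longrightarrow> k \<le> l \<Longrightarrow> l \<le> b \<Longrightarrow> W k \<le> W l"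
    and J0: "\<And>k. a \<le> k \<Longrightarrow> k \<le> b \<Longrightarrow> J k k = 0"
    and J1: "\<And>k. a \<le> k \<Longrightarrow> Suc k \<le> b \<Longrightarrow> J k (Suc k) = 0"
    and step: "\<And>k m l. a \<le> k \<Longrightarrow> k \<le> m \<Longrightarrow> m \<le> l \<Longrightarrow> l \<le> b \<Longrightarrow>
       J k l \<le> (1 + \<epsilon>) * J k m + J m l + c * (W l - W k) powr q"
    and kl: "a \<le> k" "k \<le> l" "l \<le> b"
  shows "J k l \<le> 2 * c / (1 - (2 + \<epsilon>) * 2 powr - q) * (W l - W k) powr q"
proof -
  define \<eta> where "\<eta> = (2 + \<epsilon>) * 2 powr - q"
  \<comment> \<open>\<open>C\<close> solves C = C \<eta> + 2 c: the bisection applies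
    \<open>step\<close> twice, at \<open>m\<close> and at \<open>Suc m\<close>, and each use costs
    one term c w^q.\<close>
  define C where "C = 2 * c / (1 - \<eta>)"
  have \<eta>: "\<eta> < 1" using \<epsilon> by (simp add: \<eta>_def)
  have C0: "0 \<le> C" using c \<eta> by (simp add: C_def)
  have C1: "C * \<eta> + 2 * c = C" using \<eta> by (simp add: C_def field_simps)
  have "J k l \<le> C * (W l - W k) powr q"
    using kl
  proof (induction "l - k" arbitrary: k l rule: less_induct)
    case less
    let ?w = "W l - W k"
    have w0: "0 \<le> ?w" using mono less.prems by simp
    show ?case
    proof (cases "l = k")
      case True then show ?thesis using J0 less.prems C0 by simp
    next
      case False
      define P where "P m \<longleftrightarrow> k \<le> m \<and> m < l \<and> W m - W k \<le> ?w / 2" for m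
      have Pk: "P k" using False less.prems w0 by (simp add: P_def)
      have bnd: "\<And>m. P m \<Longrightarrow> m \<le> l" by (simp add: P_def)
      \<comment> \<open>The last index at which at most half of the control is spent.
        \<open>Suc m\<close> overshoots the half or equals \<open>l\<close>, so the right piece,
        too, has at most half.\<close>
      define m where "m = (GREATEST m. P m)"
      have Pm: "P m" unfolding m_def by (rule GreatestI_nat[of P, OF Pk bnd])
      have great: "j \<le> m" if "P j" for j unfolding m_def using Greatest_le_nat[of P j l, OF that] bnd by blast
      have km: "k \<le> m" "m < l" "W m - W k \<le> ?w / 2" using Pm by (auto simp: P_def)
      have half: "W l - W (Suc m) \<le> ?w / 2"
      proof (cases "Suc m = l")
        case True then show ?thesis using w0 by simp
      next
        case False
        then have "\<not> P (Suc m)" using great[of "Suc m"] by auto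
        then show ?thesis using False km by (auto simp: P_def field_simps)
      qed
      have pw: "(?w / 2) powr q = 2 powr - q * ?w powr q"
        using w0 by (simp add: powr_divide powr_minus field_simps)
      have a1: "J k m \<le> C * (2 powr - q * ?w powr q)"
      proof -
        have "J k m \<le> C * (W m - W k) powr q" using less.hyps[of m k] km less.prems by simp
        also have "\<dots> \<le> C * (?w / 2) powr q" using km mono[of k m] less.prems C0 q
          by (intro mult_left_mono powr_mono2) auto
        finally show ?thesis using pw by simp
      qed
      have a2: "J (Suc m) l \<le> C * (2 powr - q * ?w powr q)"
      proof -
        have "J (Suc m) l \<le> C * (W l - W (Suc m)) powr q" using less.hyps[of l "Suc m"] km less.prems by simp
        also have "\<dots> \<le> C * (?w / 2) powr q" using km half mono[of "Suc m" l] less.prems C0 q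
          by (intro mult_left_mono powr_mono2) auto
        finally show ?thesis using pw by simp
      qed
      have a3: "J k l \<le> (1 + \<epsilon>) * J k m + J m l + c * ?w powr q" using step km less.prems by simp
      have a4: "J m l \<le> J (Suc m) l + c * ?w powr q"
      proof -
        have "J m l \<le> (1 + \<epsilon>) * J m (Suc m) + J (Suc m) l + c * (W l - W m) powr q"
          using step[of m "Suc m" l] km less.prems by simp
        moreover have "J m (Suc m) = 0" using J1 km less.prems by simp
        moreover have "c * (W l - W m) powr q \<le> c * ?w powr q"
          using km mono[of k m] mono[of m l] less.prems c q by (intro mult_left_mono powr_mono2) auto
        ultimately show ?thesis by simp
      qed
      have "(1 + \<epsilon>) * J k m \<le> (1 + \<epsilon>) * (C * (2 powr - q * ?w powr q))"
        using a1 \<epsilon> by (intro mult_left_mono) auto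
      then have "J k l \<le> (1 + \<epsilon>) * (C * (2 powr - q * ?w powr q)) + C * (2 powr - q * ?w powr q) + 2 * (c * ?w powr q)"
        using a2 a3 a4 by linarith
      also have "\<dots> = (C * \<eta> + 2 * c) * ?w powr q" by (simp add: \<eta>_def algebra_simps)
      finally show ?thesis using C1 by simp
    qed
  qed
  then show ?thesis by (simp add: C_def \<eta>_def)
qed

text \<open>\<open>v + H s t v\<close> is one step of the scheme over \<open>[s,t]\<close>, and \<open>2 + \<alpha>\<close> is the regularity \<open>\<gamma>\<close>. The
  last two bounds say that the steps form a flow up to an error of order \<open>\<gamma>/p\<close> in the control.\<close>

definition scheme_bounds ::
  "(real \<Rightarrow> real \<Rightarrow> 'a::real_normed_vector \<Rightarrow> 'a) \<Rightarrow> (real \<Rightarrow> real) \<Rightarrow> real \<Rightarrow> real \<Rightarrow> real \<Rightarrow> real \<Rightarrow> real \<Rightarrow> bool" where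
  "scheme_bounds H \<omega> T p \<alpha> R c \<longleftrightarrow> 0 \<le> c \<and>
    (\<forall>s t. 0 \<le> s \<and> s \<le> t \<and> t \<le> T \<longrightarrow>
       (\<forall>v. norm v \<le> R \<longrightarrow> norm (H s t v) \<le> c * (\<omega> t - \<omega> s) powr (1/p)) \<and>
       (\<forall>u v. norm u \<le> R \<and> norm v \<le> R \<longrightarrow>
          norm (H s t u - H s t v) \<le> c * (\<omega> t - \<omega> s) powr (1/p) * norm (u - v)) \<and>
       (\<forall>u v u' v' \<rho>. norm u \<le> R \<and> norm v \<le> R \<and> norm u' \<le> R \<and> norm v' \<le> R \<and>
            norm (u - u') \<le> \<rho> \<and> norm (v - v') \<le> \<rho> \<longrightarrow>
          norm ((H s t u - H s t v) - (H s t u' - H s t v')) \<le>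
            c * (\<omega> t - \<omega> s) powr (1/p) * norm ((u - v) - (u' - v')) +
            c * ((\<omega> t - \<omega> s) powr (1/p) * \<rho> + (\<omega> t - \<omega> s) powr (2/p) * \<rho> powr \<alpha>) * norm (u' - v'))) \<and>
    (\<forall>s t u. 0 \<le> s \<and> s \<le> t \<and> t \<le> u \<and> u \<le> T \<longrightarrow>
       (\<forall>v. norm v \<le> R \<longrightarrow>
          norm (H t u (v + H s t v) + H s t v - H s u v) \<le> c * (\<omega> u - \<omega> s) powr ((2 + \<alpha>)/p)) \<and>
       (\<forall>v v'. norm v \<le> R \<and> norm v' \<le> R \<longrightarrow>
          norm ((H t u (v + H s t v) + H s t v - H s u v) - (H t u (v' + H s t v') + H s t v' - H s u v'))
            \<le> c * (\<omega> u - \<omega> s) powr ((2 + \<alpha>)/p) * norm (v - v')))"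

locale rough_scheme =
  fixes H :: "real \<Rightarrow> real \<Rightarrow> 'a::euclidean_space \<Rightarrow> 'a"
    and \<omega> :: "real \<Rightarrow> real" and T p \<alpha> :: real
  assumes p: "2 \<le> p" "p < 2 + \<alpha>" and \<alpha>: "0 < \<alpha>" "\<alpha> \<le> 1" and T: "0 < T"
    and \<omega>_mono: "mono_on {0..T} \<omega>" and \<omega>_cont: "continuous_on {0..T} \<omega>"
    and bounds: "\<And>R. \<exists>c. scheme_bounds H \<omega> T p \<alpha> R c"
begin

abbreviation "q \<equiv> (2 + \<alpha>) / p"

lemma q: "1 < q" using p by simp

lemma \<omega>_le: "0 \<le> s \<Longrightarrow> s \<le> t \<Longrightarrow> t \<le> T \<Longrightarrow> \<omega> s \<le> \<omega> t"
  using \<omega>_mono by (auto simp: mono_on_def)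

lemma boundsD:
  assumes "scheme_bounds H \<omega> T p \<alpha> R c"
  shows "0 \<le> c"
    and "\<And>s t v. 0 \<le> s \<Longrightarrow> s \<le> t \<Longrightarrow> t \<le> T \<Longrightarrow> norm v \<le> R \<Longrightarrow>
       norm (H s t v) \<le> c * (\<omega> t - \<omega> s) powr (1/p)"
    and "\<And>s t u v. 0 \<le> s \<Longrightarrow> s \<le> t \<Longrightarrow> t \<le> T \<Longrightarrow> norm u \<le> R \<Longrightarrow> norm v \<le> R \<Longrightarrow>
       norm (H s t u - H s t v) \<le> c * (\<omega> t - \<omega> s) powr (1/p) * norm (u - v)"
    and "\<And>s t u v u' v' \<rho>. 0 \<le> s \<Longrightarrow> s \<le> t \<Longrightarrow> t \<le> T \<Longrightarrow> norm u \<le> R \<Longrightarrow> norm v \<le> R \<Longrightarrow>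
       norm u' \<le> R \<Longrightarrow> norm v' \<le> R \<Longrightarrow> norm (u - u') \<le> \<rho> \<Longrightarrow> norm (v - v') \<le> \<rho> \<Longrightarrow>
       norm ((H s t u - H s t v) - (H s t u' - H s t v')) \<le>
            c * (\<omega> t - \<omega> s) powr (1/p) * norm ((u - v) - (u' - v')) +
            c * ((\<omega> t - \<omega> s) powr (1/p) * \<rho> + (\<omega> t - \<omega> s) powr (2/p) * \<rho> powr \<alpha>) * norm (u' - v')"
    and "\<And>s t u v. 0 \<le> s \<Longrightarrow> s \<le> t \<Longrightarrow> t \<le> u \<Longrightarrow> u \<le> T \<Longrightarrow> norm v \<le> R \<Longrightarrow>
       norm (H t u (v + H s t v) + H s t v - H s u v) \<le> c * (\<omega> u - \<omega> s) powr q"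
    and "\<And>s t u v v'. 0 \<le> s \<Longrightarrow> s \<le> t \<Longrightarrow> t \<le> u \<Longrightarrow> u \<le> T \<Longrightarrow> norm v \<le> R \<Longrightarrow> norm v' \<le> R \<Longrightarrow>
       norm ((H t u (v + H s t v) + H s t v - H s u v) - (H t u (v' + H s t v') + H s t v' - H s u v'))
            \<le> c * (\<omega> u - \<omega> s) powr q * norm (v - v')"
  using assms unfolding scheme_bounds_def by simp_all

lemma H_diag: assumes "0 \<le> s" "s \<le> T" shows "H s s v = 0"
proof -
  obtain c where c: "scheme_bounds H \<omega> T p \<alpha> (norm v) c" using bounds by blast
  then show ?thesis using boundsD(2)[OF c, of s s v] assms by simp
qed

text \<open>As long as a step map has Lipschitz constant at most \<open>1 + \<epsilon>0\<close>, the factor of the bisection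
  argument stays below 1; \<open>K0\<close> is the resulting geometric series.\<close>

definition \<epsilon>0 :: real where "\<epsilon>0 = min 1 (2 powr (q - 1) - 1)"

text \<open>The value 2^(q-1) - 1 makes (2 + \<epsilon>0) 2^-q at most 2^-q + 1/2, which is below 1
  because q > 1; the cap at 1 keeps the step factor 1 + \<epsilon>0 at most 2.\<close>

lemma \<epsilon>0: "0 < \<epsilon>0" "\<epsilon>0 \<le> 1" "(2 + \<epsilon>0) * 2 powr - q < 1"
proof -
  have 1: "(1::real) < 2 powr (q - 1)" using q by (intro gr_one_powr) auto
  then show "0 < \<epsilon>0" "\<epsilon>0 \<le> 1" by (auto simp: \<epsilon>0_def)
  have "(2 + \<epsilon>0) * 2 powr - q \<le> (1 + 2 powr (q - 1)) * 2 powr - q"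
    by (intro mult_right_mono) (auto simp: \<epsilon>0_def)
  also have "\<dots> = 2 powr - q + 2 powr (-1)" by (simp add: distrib_right flip: powr_add)
  also have "2 powr - q < (2::real) powr (-1)" using q by (intro powr_less_mono) auto
  finally show "(2 + \<epsilon>0) * 2 powr - q < 1" by (simp add: powr_minus)
qed

definition K0 :: real where "K0 = 2 / (1 - (2 + \<epsilon>0) * 2 powr - q)"

lemma K0: "0 \<le> K0" using \<epsilon>0 by (simp add: K0_def)

section \<open>Orbits of the scheme along grids: defect and boundedness\<close>

definition traj :: "(nat \<Rightarrow> real) \<Rightarrow> nat \<Rightarrow> nat \<Rightarrow> (nat \<Rightarrow> 'a) \<Rightarrow> bool" where
  "traj ts a b Y \<longleftrightarrow> (\<forall>k. a \<le> k \<and> k < b \<longrightarrow> Y (Suc k) = Y k + H (ts k) (ts (Suc k)) (Y k))"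

text \<open>Points may repeat; a step of length 0 is trivial by \<open>H_diag\<close>.\<close>

definition grid :: "(nat \<Rightarrow> real) \<Rightarrow> nat \<Rightarrow> nat \<Rightarrow> bool" where
  "grid ts a b \<longleftrightarrow> (\<forall>k. a \<le> k \<and> k \<le> b \<longrightarrow> 0 \<le> ts k \<and> ts k \<le> T) \<and>
     (\<forall>k l. a \<le> k \<and> k \<le> l \<and> l \<le> b \<longrightarrow> ts k \<le> ts l)"

lemma gridD:
  assumes "grid ts a b"
  shows "\<And>k. a \<le> k \<Longrightarrow> k \<le> b \<Longrightarrow> 0 \<le> ts k" "\<And>k. a \<le> k \<Longrightarrow> k \<le> b \<Longrightarrow> ts k \<le> T"
    "\<And>k l. a \<le> k \<Longrightarrow> k \<le> l \<Longrightarrow> l \<le> b \<Longrightarrow> ts k \<le> ts l"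
    "\<And>k l. a \<le> k \<Longrightarrow> k \<le> l \<Longrightarrow> l \<le> b \<Longrightarrow> \<omega> (ts k) \<le> \<omega> (ts l)"
  using assms \<omega>_le unfolding grid_def by auto

lemma W_powr_mono:
  assumes "grid ts a b" "a \<le> k" "k \<le> k'" "k' \<le> l'" "l' \<le> l" "l \<le> b" "0 \<le> e"
  shows "(\<omega> (ts l') - \<omega> (ts k')) powr e \<le> (\<omega> (ts l) - \<omega> (ts k)) powr e"
  using gridD(4)[OF assms(1), of k k'] gridD(4)[OF assms(1), of k' l'] gridD(4)[OF assms(1), of l' l] assms
  by (intro powr_mono2) auto

text \<open>The bound \<delta> \<le> 1 makes higher powers of the control smaller. The last
  condition makes a step over control at most \<delta> a perturbation of the identity with Lipschitz
  constant \<epsilon>0 and of length at most 1.\<close>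

definition small :: "real \<Rightarrow> real \<Rightarrow> bool" where
  "small c \<delta> \<longleftrightarrow> 0 < \<delta> \<and> \<delta> \<le> 1 \<and> c * \<delta> powr (1/p) \<le> \<epsilon>0"

lemma small_step:
  assumes "scheme_bounds H \<omega> T p \<alpha> R c" "small c \<delta>" "0 \<le> s" "s \<le> t" "t \<le> T" "\<omega> t - \<omega> s \<le> \<delta>"
  shows "c * (\<omega> t - \<omega> s) powr (1/p) \<le> \<epsilon>0"
    "norm v \<le> R \<Longrightarrow> norm (H s t v) \<le> 1"
    "norm u \<le> R \<Longrightarrow> norm v \<le> R \<Longrightarrow> norm (H s t u - H s t v) \<le> \<epsilon>0 * norm (u - v)"
    "norm u \<le> R \<Longrightarrow> norm v \<le> R \<Longrightarrow> norm ((u + H s t u) - (v + H s t v)) \<le> (1 + \<epsilon>0) * norm (u - v)"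
proof -
  have "c * (\<omega> t - \<omega> s) powr (1/p) \<le> c * \<delta> powr (1/p)"
    using assms \<omega>_le p boundsD(1)[OF assms(1)] by (intro mult_left_mono powr_mono2) auto
  then show 1: "c * (\<omega> t - \<omega> s) powr (1/p) \<le> \<epsilon>0" using assms by (simp add: small_def)
  show "norm (H s t v) \<le> 1" if "norm v \<le> R"
    using boundsD(2)[OF assms(1,3,4,5) that] 1 \<epsilon>0 by linarith
  show 2: "norm (H s t u - H s t v) \<le> \<epsilon>0 * norm (u - v)" if "norm u \<le> R" "norm v \<le> R"
    using boundsD(3)[OF assms(1,3,4,5) that] 1 mult_right_mono[OF 1, of "norm (u - v)"] by simp
  have e: "(u + H s t u) - (v + H s t v) = (u - v) + (H s t u - H s t v)" by simp
  show "norm ((u + H s t u) - (v + H s t v)) \<le> (1 + \<epsilon>0) * norm (u - v)" if "norm u \<le> R" "norm v \<le> R"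
    using norm_triangle_ineq[of "u - v" "H s t u - H s t v"] 2[OF that]
    unfolding e distrib_right mult_1 by linarith
qed

text \<open>Let \<open>?z\<close> be the one-step prediction from \<open>k\<close> to
  \<open>m\<close>. Over [m, l] the step map expands the left defect norm (Y m - ?z) by at most 1 +
  \<epsilon>0, and what remains is the flow error started at \<open>Y k\<close>; this is the
  recursion of \<open>sewing_induction\<close>. The constants are taken on radius R + 1 since
  \<open>?z\<close> is not an orbit point and may leave the ball of radius R by the length of one
  step.\<close>

lemma trajectory_defect:
  assumes c: "scheme_bounds H \<omega> T p \<alpha> (R + 1) c" and \<delta>: "small c \<delta>"
    and g: "grid ts a b" and Y: "traj ts a b Y" and Yb: "\<And>k. a \<le> k \<Longrightarrow> k \<le> b \<Longrightarrow> norm (Y k) \<le> R"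
    and W: "\<omega> (ts b) - \<omega> (ts a) \<le> \<delta>" and kl: "a \<le> k" "k \<le> l" "l \<le> b"
  shows "norm (Y l - Y k - H (ts k) (ts l) (Y k)) \<le> K0 * c * (\<omega> (ts l) - \<omega> (ts k)) powr q"
proof -
  define J where "J k l = norm (Y l - Y k - H (ts k) (ts l) (Y k))" for k l
  have "J k l \<le> 2 * c / (1 - (2 + \<epsilon>0) * 2 powr - q) * (\<omega> (ts l) - \<omega> (ts k)) powr q"
  proof (rule sewing_induction[where a = a and b = b and W = "\<lambda>k. \<omega> (ts k)"])
    show "0 < q" "0 \<le> \<epsilon>0" "(2 + \<epsilon>0) * 2 powr - q < 1" "0 \<le> c"
      using q \<epsilon>0 boundsD(1)[OF c] by auto
    show "\<omega> (ts k) \<le> \<omega> (ts l)" if "a \<le> k" "k \<le> l" "l \<le> b" for k l using gridD(4)[OF g] that by simp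
    show "J k k = 0" if "a \<le> k" "k \<le> b" for k
      using H_diag gridD[OF g] that by (simp add: J_def)
    show "J k (Suc k) = 0" if "a \<le> k" "Suc k \<le> b" for k
      using Y that by (simp add: J_def traj_def)
    show "J k l \<le> (1 + \<epsilon>0) * J k m + J m l + c * (\<omega> (ts l) - \<omega> (ts k)) powr q"
      if *: "a \<le> k" "k \<le> m" "m \<le> l" "l \<le> b" for k m l
    proof -
      have t: "0 \<le> ts k" "ts k \<le> ts m" "ts m \<le> ts l" "ts l \<le> T" "ts m \<le> T" "0 \<le> ts m"
        using gridD[OF g] * by auto
      have w: "\<omega> (ts m) - \<omega> (ts k) \<le> \<delta>" "\<omega> (ts l) - \<omega> (ts m) \<le> \<delta>"
        using gridD(4)[OF g, of a k] gridD(4)[OF g, of k m] gridD(4)[OF g, of m l] gridD(4)[OF g, of l b] * W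
        by auto
      let ?z = "Y k + H (ts k) (ts m) (Y k)"
      have b: "norm (Y k) \<le> R + 1" "norm (Y m) \<le> R + 1" using Yb[of k] Yb[of m] * by auto
      have z: "norm ?z \<le> R + 1"
        using small_step(2)[OF c \<delta> t(1,2,5) w(1) b(1)] Yb[of k] * norm_triangle_ineq[of "Y k" "H (ts k) (ts m) (Y k)"]
        by auto
      have e: "Y l - Y k - H (ts k) (ts l) (Y k) =
         (Y l - Y m - H (ts m) (ts l) (Y m)) + ((Y m + H (ts m) (ts l) (Y m)) - (?z + H (ts m) (ts l) ?z)) +
         (H (ts m) (ts l) ?z + H (ts k) (ts m) (Y k) - H (ts k) (ts l) (Y k))" by (simp add: algebra_simps)
      have "J k l \<le> J m l + norm ((Y m + H (ts m) (ts l) (Y m)) - (?z + H (ts m) (ts l) ?z)) +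
         norm (H (ts m) (ts l) ?z + H (ts k) (ts m) (Y k) - H (ts k) (ts l) (Y k))"
        unfolding J_def e by (rule norm_add3)
      moreover have "norm ((Y m + H (ts m) (ts l) (Y m)) - (?z + H (ts m) (ts l) ?z)) \<le> (1 + \<epsilon>0) * J k m"
        using small_step(4)[OF c \<delta> t(6,3,4) w(2) b(2) z] by (simp add: J_def algebra_simps)
      moreover have "norm (H (ts m) (ts l) ?z + H (ts k) (ts m) (Y k) - H (ts k) (ts l) (Y k))
          \<le> c * (\<omega> (ts l) - \<omega> (ts k)) powr q"
        using boundsD(5)[OF c t(1-4) b(1)] .
      ultimately show ?thesis by linarith
    qed
  qed (use kl in auto)
  then show ?thesis by (simp add: J_def K0_def)
qed

text \<open>A bootstrap. \<open>trajectory_defect\<close> presupposes a bound on the orbit, known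
  only up to the previous index; the new point adds one step, of length at most 1, hence R + 2 for
  the orbit and R + 3 for its predictions. The defect and the increment from \<open>a\<close> are
  then at most 1/2 each, which restores R + 1.\<close>

lemma trajectory_bounded:
  assumes c: "scheme_bounds H \<omega> T p \<alpha> (R + 3) c" and \<delta>: "small c \<delta>" and \<delta>2: "2 * c * \<delta> powr (1/p) \<le> 1" "2 * K0 * c * \<delta> powr q \<le> 1"
    and g: "grid ts a b" and Y: "traj ts a b Y" and Ya: "norm (Y a) \<le> R"
    and W: "\<omega> (ts b) - \<omega> (ts a) \<le> \<delta>" and kl: "a \<le> k" "k \<le> b"
  shows "norm (Y k) \<le> R + 1"
  using kl
proof (induction k rule: less_induct)
  case (less k)
  show ?case
  proof (cases "k = a")
    case True then show ?thesis using Ya by simp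
  next
    case False
    have t: "0 \<le> ts a" "ts a \<le> ts k" "ts k \<le> T" "\<omega> (ts a) \<le> \<omega> (ts k)"
      using gridD[OF g] less.prems by auto
    have w: "\<omega> (ts k) - \<omega> (ts a) \<le> \<delta>"
      using gridD(4)[OF g, of k b] less.prems W by auto
    have c0: "0 \<le> c" using boundsD(1)[OF c] .
    obtain j where j: "k = Suc j" "a \<le> j" using False less.prems by (cases k) auto
    have g': "grid ts a k" and Y': "traj ts a k Y" using g Y less.prems by (auto simp: grid_def traj_def)
    have prev: "norm (Y i) \<le> R + 2" if "a \<le> i" "i \<le> k" for i
    proof (cases "i = k")
      case False then show ?thesis using less.IH[of i] less.prems that by auto
    next
      case True
      have tj: "0 \<le> ts j" "ts j \<le> ts k" "\<omega> (ts a) \<le> \<omega> (ts j)" using gridD[OF g] less.prems j by auto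
      have "norm (H (ts j) (ts k) (Y j)) \<le> 1"
        using small_step(2)[OF c \<delta> tj(1,2) t(3)] less.IH[of j] less.prems j w tj by auto
      then show ?thesis using Y' less.IH[of j] less.prems j True norm_triangle_ineq[of "Y j" "H (ts j) (ts k) (Y j)"]
        by (auto simp: traj_def)
    qed
    have "norm (Y k - Y a - H (ts a) (ts k) (Y a)) \<le> K0 * c * (\<omega> (ts k) - \<omega> (ts a)) powr q"
      by (rule trajectory_defect[where R = "R + 2", OF _ \<delta> g' Y' prev w]) (use c less.prems in \<open>auto simp: add.assoc\<close>)
    also have "\<dots> \<le> K0 * c * \<delta> powr q" using t w q K0 c0 by (intro mult_left_mono powr_mono2) auto
    also have "\<dots> \<le> 1/2" using \<delta>2 by simp
    finally have 1: "norm (Y k - Y a - H (ts a) (ts k) (Y a)) \<le> 1/2" .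
    have "norm (H (ts a) (ts k) (Y a)) \<le> c * (\<omega> (ts k) - \<omega> (ts a)) powr (1/p)"
      using boundsD(2)[OF c t(1-3)] Ya by simp
    also have "\<dots> \<le> c * \<delta> powr (1/p)" using t w p c0 by (intro mult_left_mono powr_mono2) auto
    also have "\<dots> \<le> 1/2" using \<delta>2 by simp
    finally have 2: "norm (H (ts a) (ts k) (Y a)) \<le> 1/2" .
    have "norm (Y k) \<le> norm (Y a) + norm (H (ts a) (ts k) (Y a)) + norm (Y k - Y a - H (ts a) (ts k) (Y a))"
      using norm_add3[of "Y a" "H (ts a) (ts k) (Y a)" "Y k - Y a - H (ts a) (ts k) (Y a)"] by simp
    then show ?thesis using 1 2 Ya by linarith
  qed
qed

end

lemma eventually_mult_powr_le:
  fixes C e \<eta> :: real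
  assumes "0 < e" "0 < \<eta>"
  shows "\<forall>\<^sub>F \<delta> in at_right 0. C * \<delta> powr e \<le> \<eta>"
proof -
  have "((\<lambda>\<delta>::real. \<delta> powr e) \<longlongrightarrow> 0) (at_right 0)"
    using assms tendsto_zero_powrI[of "\<lambda>x::real. x" "at_right 0" "\<lambda>_. e" e]
    by (auto simp: eventually_at_filter intro!: tendsto_eq_intros)
  then have "((\<lambda>\<delta>. C * \<delta> powr e) \<longlongrightarrow> C * 0) (at_right 0)" by (intro tendsto_intros)
  then have "\<forall>\<^sub>F \<delta> in at_right 0. C * \<delta> powr e < \<eta>" using assms by (intro order_tendstoD) auto
  then show ?thesis by eventually_elim simp
qed

section \<open>Lipschitz dependence of discrete orbits on the starting point\<close>

context rough_scheme begin

text \<open>The defects are bounded in terms of the maximal distance \<open>M\<close> of the two orbits instead of their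
  distance at the left end, which makes the recursion linear; \<open>M\<close> itself is absorbed at the end.\<close>

lemma trajectories_lipschitz_local:
  assumes c: "scheme_bounds H \<omega> T p \<alpha> (R + 1) c" and \<delta>: "small c \<delta>"
    and \<delta>2: "2 * K0 * (c + 2 * c * (K0 * c + (K0 * c) powr \<alpha>)) * \<delta> powr q \<le> 1"
    and g: "grid ts a b" and Y: "traj ts a b Y" and Z: "traj ts a b Z"
    and Yb: "\<And>k. a \<le> k \<Longrightarrow> k \<le> b \<Longrightarrow> norm (Y k) \<le> R"
    and Zb: "\<And>k. a \<le> k \<Longrightarrow> k \<le> b \<Longrightarrow> norm (Z k) \<le> R"
    and W: "\<omega> (ts b) - \<omega> (ts a) \<le> \<delta>" and l: "a \<le> l" "l \<le> b"
  shows "norm (Y l - Z l) \<le> 4 * norm (Y a - Z a)"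
proof -
  define M where "M = Max ((\<lambda>k. norm (Y k - Z k)) ` {a..b})"
  define C where "C = K0 * c"
  \<comment> \<open>The first \<open>c\<close> bounds the difference of the flow errors relative to
    \<open>M\<close>. The other summand is the four-point term: \<open>C\<close> comes from \<rho>,
    \<open>C powr \<alpha>\<close> from \<rho>^\<alpha>, and the 2 from the bound 2 M on the
    distance of the predictions.\<close>
  define c' where "c' = c + 2 * c * (C + C powr \<alpha>)"
  have c0: "0 \<le> c" using boundsD(1)[OF c] .
  have C0: "0 \<le> C" using c0 K0 by (simp add: C_def)
  have c'0: "0 \<le> c'" using c0 C0 by (simp add: c'_def)
  have M: "norm (Y k - Z k) \<le> M" if "a \<le> k" "k \<le> b" for k
    unfolding M_def using that by (intro Max_ge) auto
  have M0: "0 \<le> M" using order_trans[OF norm_ge_zero M[of a]] l by auto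
  define E where "E k l = (Y l - Y k - H (ts k) (ts l) (Y k)) - (Z l - Z k - H (ts k) (ts l) (Z k))" for k l
  have J: "norm (E k l) \<le> 2 * (c' * M) / (1 - (2 + \<epsilon>0) * 2 powr - q) * (\<omega> (ts l) - \<omega> (ts k)) powr q"
    if "a \<le> k" "k \<le> l" "l \<le> b" for k l
  proof (rule sewing_induction[where a = a and b = b and W = "\<lambda>k. \<omega> (ts k)" and J = "\<lambda>k l. norm (E k l)"])
    show "0 < q" "0 \<le> \<epsilon>0" "(2 + \<epsilon>0) * 2 powr - q < 1" "0 \<le> c' * M"
      using q \<epsilon>0 c'0 M0 by auto
    show "\<omega> (ts k) \<le> \<omega> (ts l)" if "a \<le> k" "k \<le> l" "l \<le> b" for k l using gridD(4)[OF g] that by simp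
    show "norm (E k k) = 0" if "a \<le> k" "k \<le> b" for k
      using H_diag gridD[OF g] that by (simp add: E_def)
    show "norm (E k (Suc k)) = 0" if "a \<le> k" "Suc k \<le> b" for k
      using Y Z that by (simp add: E_def traj_def)
    show "norm (E k l) \<le> (1 + \<epsilon>0) * norm (E k m) + norm (E m l) + c' * M * (\<omega> (ts l) - \<omega> (ts k)) powr q"
      if *: "a \<le> k" "k \<le> m" "m \<le> l" "l \<le> b" for k m l
    proof -
      let ?w = "\<omega> (ts l) - \<omega> (ts k)"
      have t: "0 \<le> ts k" "ts k \<le> ts m" "ts m \<le> ts l" "ts l \<le> T" "ts m \<le> T" "0 \<le> ts m"
        using gridD[OF g] * by auto
      have w: "\<omega> (ts m) - \<omega> (ts k) \<le> \<delta>" "\<omega> (ts l) - \<omega> (ts m) \<le> \<delta>" "?w \<le> \<delta>" "0 \<le> ?w"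
        "0 \<le> \<omega> (ts m) - \<omega> (ts k)" "0 \<le> \<omega> (ts l) - \<omega> (ts m)"
        using gridD(4)[OF g, of a k] gridD(4)[OF g, of k m] gridD(4)[OF g, of m l] gridD(4)[OF g, of l b] * W
        by auto
      have w1: "?w \<le> 1" using w \<delta> by (simp add: small_def)
      define y where "y = Y k + H (ts k) (ts m) (Y k)"
      define z where "z = Z k + H (ts k) (ts m) (Z k)"
      have b: "norm (Y k) \<le> R + 1" "norm (Y m) \<le> R + 1" "norm (Z k) \<le> R + 1" "norm (Z m) \<le> R + 1"
        using Yb[of k] Yb[of m] Zb[of k] Zb[of m] * by auto
      have y: "norm y \<le> R + 1"
        using small_step(2)[OF c \<delta> t(1,2,5) w(1) b(1)] Yb[of k] * norm_triangle_ineq[of "Y k" "H (ts k) (ts m) (Y k)"]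
        by (auto simp: y_def)
      have z: "norm z \<le> R + 1"
        using small_step(2)[OF c \<delta> t(1,2,5) w(1) b(3)] Zb[of k] * norm_triangle_ineq[of "Z k" "H (ts k) (ts m) (Z k)"]
        by (auto simp: z_def)
      \<comment> \<open>\<rho> dominates the distance of each orbit at \<open>m\<close> from its own
        prediction, by \<open>trajectory_defect\<close>.\<close>
      define \<rho> where "\<rho> = C * ?w powr q"
      have \<rho>0: "0 \<le> \<rho>" using C0 by (simp add: \<rho>_def)
      have Wm: "(\<omega> (ts m) - \<omega> (ts k)) powr q \<le> ?w powr q"
        using W_powr_mono[OF g, of k k m l q] * q by simp
      have dY: "norm (Y m - y) \<le> \<rho>"
      proof -
        have "norm (Y m - Y k - H (ts k) (ts m) (Y k)) \<le> K0 * c * (\<omega> (ts m) - \<omega> (ts k)) powr q"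
          by (rule trajectory_defect[OF c \<delta> g Y Yb W]) (use * in auto)
        also have "\<dots> \<le> \<rho>" unfolding \<rho>_def C_def using Wm c0 K0 by (intro mult_left_mono) auto
        finally show ?thesis by (simp add: y_def algebra_simps)
      qed
      have dZ: "norm (Z m - z) \<le> \<rho>"
      proof -
        have "norm (Z m - Z k - H (ts k) (ts m) (Z k)) \<le> K0 * c * (\<omega> (ts m) - \<omega> (ts k)) powr q"
          by (rule trajectory_defect[OF c \<delta> g Z Zb W]) (use * in auto)
        also have "\<dots> \<le> \<rho>" unfolding \<rho>_def C_def using Wm c0 K0 by (intro mult_left_mono) auto
        finally show ?thesis by (simp add: z_def algebra_simps)
      qed
      let ?v = "\<omega> (ts l) - \<omega> (ts m)"
      have Ekm: "E k m = (Y m - Z m) - (y - z)" by (simp add: E_def y_def z_def)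
      have four: "norm ((H (ts m) (ts l) (Y m) - H (ts m) (ts l) (Z m)) - (H (ts m) (ts l) y - H (ts m) (ts l) z))
          \<le> \<epsilon>0 * norm (E k m) + 2 * c * (C + C powr \<alpha>) * M * ?w powr q"
      proof -
        have "norm ((H (ts m) (ts l) (Y m) - H (ts m) (ts l) (Z m)) - (H (ts m) (ts l) y - H (ts m) (ts l) z))
          \<le> c * ?v powr (1/p) * norm (E k m) + c * (?v powr (1/p) * \<rho> + ?v powr (2/p) * \<rho> powr \<alpha>) * norm (y - z)"
          unfolding Ekm by (rule boundsD(4)[OF c t(6,3,4) b(2,4) y z dY dZ])
        moreover have "c * ?v powr (1/p) * norm (E k m) \<le> \<epsilon>0 * norm (E k m)"
          by (intro mult_right_mono small_step(1)[OF c \<delta> t(6,3,4) w(2)]) auto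
        moreover have "c * (?v powr (1/p) * \<rho> + ?v powr (2/p) * \<rho> powr \<alpha>) * norm (y - z)
            \<le> c * (C * ?w powr q + C powr \<alpha> * ?w powr q) * (2 * M)"
        proof -
          have "?v powr (1/p) \<le> 1" using w w1 p * gridD(4)[OF g, of k m] by (intro powr_le1) auto
          then have i: "?v powr (1/p) * \<rho> \<le> C * ?w powr q"
            using \<rho>0 mult_right_mono[of "?v powr (1/p)" 1 \<rho>] by (simp add: \<rho>_def)
          have "?v powr (2/p) * \<rho> powr \<alpha> \<le> ?w powr (2/p) * \<rho> powr \<alpha>"
            using W_powr_mono[OF g, of k m l l "2/p"] * p by (intro mult_right_mono) auto
          also have "\<dots> = C powr \<alpha> * ?w powr (2/p + q * \<alpha>)"
            using C0 w by (simp add: \<rho>_def powr_mult powr_powr powr_add)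
          \<comment> \<open>The exponent 2/p + q \<alpha> is at least q because \<alpha> \<le>
            \<alpha> (2 + \<alpha>); as ?w \<le> 1, the term with \<rho>^\<alpha> is absorbed into
            the order that the bisection requires.\<close>
          also have "?w powr (2/p + q * \<alpha>) \<le> ?w powr q"
          proof (rule powr_mono')
            have "\<alpha> * 1 \<le> \<alpha> * (2 + \<alpha>)" using \<alpha> by (intro mult_left_mono) auto
            then show "q \<le> 2/p + q * \<alpha>" using p by (simp add: field_simps)
          qed (use w w1 in auto)
          finally have ii: "?v powr (2/p) * \<rho> powr \<alpha> \<le> C powr \<alpha> * ?w powr q" by (simp add: mult_left_mono)
          have "norm (y - z) \<le> (1 + \<epsilon>0) * norm (Y k - Z k)"
            unfolding y_def z_def by (rule small_step(4)[OF c \<delta> t(1,2,5) w(1) b(1,3)])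
          also have "\<dots> \<le> 2 * M" using \<epsilon>0 M[of k] * by (intro mult_mono) auto
          finally have iii: "norm (y - z) \<le> 2 * M" .
          show ?thesis using c0 C0 by (intro mult_mono[OF mult_left_mono[OF add_mono[OF i ii]] iii]) auto
        qed
        ultimately show ?thesis by (simp add: algebra_simps)
      qed
      have defect: "norm ((H (ts m) (ts l) y + H (ts k) (ts m) (Y k) - H (ts k) (ts l) (Y k)) -
           (H (ts m) (ts l) z + H (ts k) (ts m) (Z k) - H (ts k) (ts l) (Z k))) \<le> c * ?w powr q * M"
      proof -
        have "norm ((H (ts m) (ts l) y + H (ts k) (ts m) (Y k) - H (ts k) (ts l) (Y k)) -
           (H (ts m) (ts l) z + H (ts k) (ts m) (Z k) - H (ts k) (ts l) (Z k))) \<le> c * ?w powr q * norm (Y k - Z k)"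
          unfolding y_def z_def by (rule boundsD(6)[OF c t(1-4) b(1,3)])
        also have "\<dots> \<le> c * ?w powr q * M" using M[of k] * c0 by (intro mult_left_mono) auto
        finally show ?thesis .
      qed
      have "E k l = (E m l + E k m) + ((H (ts m) (ts l) (Y m) - H (ts m) (ts l) (Z m)) - (H (ts m) (ts l) y - H (ts m) (ts l) z))
         + ((H (ts m) (ts l) y + H (ts k) (ts m) (Y k) - H (ts k) (ts l) (Y k)) -
           (H (ts m) (ts l) z + H (ts k) (ts m) (Z k) - H (ts k) (ts l) (Z k)))"
        by (simp add: E_def)
      then have "norm (E k l) \<le> norm (E m l + E k m) + norm ((H (ts m) (ts l) (Y m) - H (ts m) (ts l) (Z m)) - (H (ts m) (ts l) y - H (ts m) (ts l) z))
         + norm ((H (ts m) (ts l) y + H (ts k) (ts m) (Y k) - H (ts k) (ts l) (Y k)) -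
           (H (ts m) (ts l) z + H (ts k) (ts m) (Z k) - H (ts k) (ts l) (Z k)))"
        by (simp only: norm_add3)
      then have "norm (E k l) \<le> norm (E m l + E k m) + (\<epsilon>0 * norm (E k m) + 2 * c * (C + C powr \<alpha>) * M * ?w powr q) + c * ?w powr q * M"
        using four defect by linarith
      also have "\<dots> \<le> (norm (E m l) + norm (E k m)) + (\<epsilon>0 * norm (E k m) + 2 * c * (C + C powr \<alpha>) * M * ?w powr q) + c * ?w powr q * M"
        using norm_triangle_ineq by (intro add_mono) auto
      also have "\<dots> = (1 + \<epsilon>0) * norm (E k m) + norm (E m l) + c' * M * ?w powr q"
        by (simp add: c'_def algebra_simps)
      finally show ?thesis .
    qed
  qed (use that in auto)
  have bnd: "norm (Y l - Z l) \<le> 2 * norm (Y a - Z a) + M / 2" if l: "a \<le> l" "l \<le> b" for l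
  proof -
    have t: "0 \<le> ts a" "ts a \<le> ts l" "ts l \<le> T" using gridD[OF g] l by auto
    have w: "\<omega> (ts l) - \<omega> (ts a) \<le> \<delta>" "0 \<le> \<omega> (ts l) - \<omega> (ts a)"
      using gridD(4)[OF g, of a l] gridD(4)[OF g, of l b] l W by auto
    have "norm (E a l) \<le> K0 * c' * M * (\<omega> (ts l) - \<omega> (ts a)) powr q"
      using J[of a l] l by (simp add: K0_def mult.assoc)
    also have "\<dots> \<le> K0 * c' * M * \<delta> powr q"
      using w q K0 c'0 M0 by (intro mult_left_mono powr_mono2) auto
    also have "\<dots> \<le> M / 2" using mult_right_mono[OF \<delta>2 M0] by (simp add: c'_def C_def algebra_simps)
    finally have 1: "norm (E a l) \<le> M / 2" .
    have "norm ((Y a + H (ts a) (ts l) (Y a)) - (Z a + H (ts a) (ts l) (Z a))) \<le> (1 + \<epsilon>0) * norm (Y a - Z a)"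
      using Yb[of a] Zb[of a] l by (intro small_step(4)[OF c \<delta> t w(1)]) auto
    also have "\<dots> \<le> 2 * norm (Y a - Z a)" using \<epsilon>0 by (intro mult_right_mono) auto
    finally have 2: "norm ((Y a + H (ts a) (ts l) (Y a)) - (Z a + H (ts a) (ts l) (Z a))) \<le> 2 * norm (Y a - Z a)" .
    have "Y l - Z l = ((Y a + H (ts a) (ts l) (Y a)) - (Z a + H (ts a) (ts l) (Z a))) + E a l"
      by (simp add: E_def)
    then have "norm (Y l - Z l) \<le> norm ((Y a + H (ts a) (ts l) (Y a)) - (Z a + H (ts a) (ts l) (Z a))) + norm (E a l)"
      by (simp only: norm_triangle_ineq)
    then show ?thesis using 1 2 by linarith
  qed
  \<comment> \<open>Maximising over the end index gives M \<le> 4 norm (Y a - Z a): the factor 2 of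
    the one-step map is doubled by absorbing M / 2.\<close>
  have "M \<le> 2 * norm (Y a - Z a) + M / 2"
    unfolding M_def using bnd l by (subst Max_le_iff) (auto simp: M_def)
  then show ?thesis using M[of l] l by linarith
qed

text \<open>Greedy blocks: from \<open>a\<close> advance to the last index with accumulated control
  at most \<delta>. Unless the end is reached, the mesh bound \<delta>/2 forces the block to consume
  more than \<delta>/2, so there are at most N + 1 blocks, each costing a factor 4.\<close>

lemma trajectories_lipschitz_chain:
  assumes c: "scheme_bounds H \<omega> T p \<alpha> (R + 1) c" and \<delta>: "small c \<delta>"
    and \<delta>2: "2 * K0 * (c + 2 * c * (K0 * c + (K0 * c) powr \<alpha>)) * \<delta> powr q \<le> 1"
    and g: "grid ts a b" and Y: "traj ts a b Y" and Z: "traj ts a b Z"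
    and Yb: "\<And>k. a \<le> k \<Longrightarrow> k \<le> b \<Longrightarrow> norm (Y k) \<le> R"
    and Zb: "\<And>k. a \<le> k \<Longrightarrow> k \<le> b \<Longrightarrow> norm (Z k) \<le> R"
    and mesh: "\<And>k. a \<le> k \<Longrightarrow> k < b \<Longrightarrow> \<omega> (ts (Suc k)) - \<omega> (ts k) \<le> \<delta> / 2"
    and W: "\<omega> (ts b) - \<omega> (ts a) \<le> real (Suc N) * \<delta> / 2" and ab: "a \<le> b"
  shows "norm (Y b - Z b) \<le> 4 ^ Suc N * norm (Y a - Z a)"
  using W g Y Z Yb Zb mesh ab
proof (induction N arbitrary: a)
  case 0
  have "\<omega> (ts b) - \<omega> (ts a) \<le> \<delta>" using 0(1) \<delta> by (simp add: small_def)
  then show ?case using trajectories_lipschitz_local[OF c \<delta> \<delta>2 0(2,3,4,5,6)] 0 by simp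
next
  case (Suc N)
  show ?case
  proof (cases "\<omega> (ts b) - \<omega> (ts a) \<le> \<delta>")
    case True
    have "norm (Y b - Z b) \<le> 4 * norm (Y a - Z a)"
      using trajectories_lipschitz_local[OF c \<delta> \<delta>2 Suc.prems(2-6)] True Suc.prems(8) by simp
    also have "\<dots> \<le> 4 ^ Suc (Suc N) * norm (Y a - Z a)"
      using one_le_power[of "4::real" "Suc N"] by (intro mult_right_mono) auto
    finally show ?thesis .
  next
    case False
    define P where "P m \<longleftrightarrow> a \<le> m \<and> m < b \<and> \<omega> (ts m) - \<omega> (ts a) \<le> \<delta>" for m
    have ab: "a \<noteq> b" using False \<delta> by (auto simp: small_def)
    have Pa: "P a" using ab Suc.prems(8) \<delta> by (auto simp: P_def small_def)
    have bnd: "\<And>m. P m \<Longrightarrow> m \<le> b" by (simp add: P_def)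
    define m where "m = (GREATEST m. P m)"
    have Pm: "P m" unfolding m_def by (rule GreatestI_nat[of P, OF Pa bnd])
    have great: "j \<le> m" if "P j" for j unfolding m_def using Greatest_le_nat[of P j b, OF that] bnd by blast
    have m: "a \<le> m" "m < b" "\<omega> (ts m) - \<omega> (ts a) \<le> \<delta>" using Pm by (auto simp: P_def)
    have "\<not> P (Suc m)" using great[of "Suc m"] by auto
    then have "\<delta> < \<omega> (ts (Suc m)) - \<omega> (ts a)" using m False by (cases "Suc m = b") (auto simp: P_def)
    then have "\<delta> / 2 < \<omega> (ts m) - \<omega> (ts a)" using Suc.prems(7)[of m] m by simp
    then have W: "\<omega> (ts b) - \<omega> (ts m) \<le> real (Suc N) * \<delta> / 2" using Suc.prems(1) by (simp add: field_simps)
    have sub: "grid ts m b" "traj ts m b Y" "traj ts m b Z" "grid ts a m" "traj ts a m Y" "traj ts a m Z"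
      using Suc.prems(2,3,4) m by (auto simp: grid_def traj_def)
    have 1: "norm (Y b - Z b) \<le> 4 ^ Suc N * norm (Y m - Z m)"
      by (rule Suc.IH[OF W sub(1-3)]) (use Suc.prems m in auto)
    have 2: "norm (Y m - Z m) \<le> 4 * norm (Y a - Z a)"
      by (rule trajectories_lipschitz_local[OF c \<delta> \<delta>2 sub(4-6) _ _ m(3,1) order_refl]) (use Suc.prems m in auto)
    have "4 ^ Suc N * norm (Y m - Z m) \<le> 4 ^ Suc N * (4 * norm (Y a - Z a))"
      using 2 by (intro mult_left_mono) auto
    then show ?thesis using order_trans[OF 1] by (simp add: mult.assoc)
  qed
qed

text \<open>The number of blocks is governed by the total control \<omega> T - \<omega> 0, so
  \<open>L\<close> depends on \<open>R\<close> but neither on the grid nor on the number of its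
  points. That the orbits stay in the ball of radius \<open>R\<close> is left to the caller.\<close>

lemma trajectories_lipschitz:
  "\<exists>\<delta>>0. \<exists>L\<ge>0. \<forall>ts a b Y Z. grid ts a b \<and> traj ts a b Y \<and> traj ts a b Z \<and> a \<le> b \<and>
     (\<forall>k. a \<le> k \<and> k \<le> b \<longrightarrow> norm (Y k) \<le> R \<and> norm (Z k) \<le> R) \<and>
     (\<forall>k. a \<le> k \<and> k < b \<longrightarrow> \<omega> (ts (Suc k)) - \<omega> (ts k) \<le> \<delta>) \<longrightarrow>
     norm (Y b - Z b) \<le> L * norm (Y a - Z a)"
proof -
  obtain c where c: "scheme_bounds H \<omega> T p \<alpha> (R + 1) c" using bounds by blast
  have "\<forall>\<^sub>F \<delta> in at_right 0. small c \<delta> \<and>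
      2 * K0 * (c + 2 * c * (K0 * c + (K0 * c) powr \<alpha>)) * \<delta> powr q \<le> 1"
    unfolding small_def using p q \<epsilon>0
    by (intro eventually_conj eventually_mult_powr_le eventually_at_right_less)
       (auto simp: eventually_at_right intro!: exI[of _ 1])
  then obtain \<delta> where \<delta>: "small c \<delta>" "2 * K0 * (c + 2 * c * (K0 * c + (K0 * c) powr \<alpha>)) * \<delta> powr q \<le> 1"
    using eventually_happens trivial_limit_at_right_real by blast
  have \<delta>0: "0 < \<delta>" using \<delta> by (simp add: small_def)
  obtain N where "(\<omega> T - \<omega> 0) / (\<delta> / 2) \<le> real N" using real_arch_simple by blast
  then have N: "\<omega> T - \<omega> 0 \<le> real (Suc N) * \<delta> / 2" using \<delta>0 by (simp add: field_simps)
  show ?thesis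
  proof (rule exI[of _ "\<delta> / 2"], intro conjI, goal_cases)
    case 1 show ?case using \<delta>0 by simp
  next
    case 2 show ?case
  proof (rule exI[of _ "4 ^ Suc N"], intro conjI allI impI)
    fix ts a b Y Z
    assume *: "grid ts a b \<and> traj ts a b Y \<and> traj ts a b Z \<and> a \<le> b \<and>
      (\<forall>k. a \<le> k \<and> k \<le> b \<longrightarrow> norm (Y k) \<le> R \<and> norm (Z k) \<le> R) \<and>
      (\<forall>k. a \<le> k \<and> k < b \<longrightarrow> \<omega> (ts (Suc k)) - \<omega> (ts k) \<le> \<delta> / 2)"
    then have g: "grid ts a b" and ab: "a \<le> b" by auto
    have "\<omega> (ts b) \<le> \<omega> T" "\<omega> 0 \<le> \<omega> (ts a)"
      using gridD(1,2)[OF g, of a] gridD(1,2)[OF g, of b] ab \<omega>_le T by auto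
    then have W: "\<omega> (ts b) - \<omega> (ts a) \<le> real (Suc N) * \<delta> / 2" using N by linarith
    show "norm (Y b - Z b) \<le> 4 ^ Suc N * norm (Y a - Z a)"
      by (rule trajectories_lipschitz_chain[OF c \<delta> g _ _ _ _ _ W ab]) (use * in auto)
  qed auto
  qed
qed

end

section \<open>Convergence and uniqueness\<close>

context rough_scheme begin

text \<open>The two functions of the definition of a solution are only used through the fact that the
  local errors over a fine grid have a small sum.\<close>

definition solves :: "real \<Rightarrow> (real \<Rightarrow> 'a) \<Rightarrow> bool" where
  "solves t1 y \<longleftrightarrow> (\<exists>\<omega>'. mono_on {0..t1} \<omega>' \<and> (\<forall>\<eta>>0. \<exists>d>0. \<forall>s t. 0 \<le> s \<and> s \<le> t \<and> t \<le> t1 \<and> t - s < d \<longrightarrow>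
     norm (y t - y s - H s t (y s)) \<le> \<eta> * (\<omega>' t - \<omega>' s)))"

lemma solves_mono: "solves t1 y \<Longrightarrow> t2 \<le> t1 \<Longrightarrow> solves t2 y"
proof -
  assume a: "solves t1 y" "t2 \<le> t1"
  then obtain w where w: "mono_on {0..t1} w" "\<And>\<eta>. \<eta> > 0 \<Longrightarrow> \<exists>d>0. \<forall>s t. 0 \<le> s \<and> s \<le> t \<and> t \<le> t1 \<and> t - s < d \<longrightarrow>
     norm (y t - y s - H s t (y s)) \<le> \<eta> * (w t - w s)" unfolding solves_def by blast
  have "mono_on {0..t2} w" by (rule mono_on_subset[OF w(1)]) (use a in auto)
  moreover have "\<exists>d>0. \<forall>s t. 0 \<le> s \<and> s \<le> t \<and> t \<le> t2 \<and> t - s < d \<longrightarrow>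
     norm (y t - y s - H s t (y s)) \<le> \<eta> * (w t - w s)" if "\<eta> > 0" for \<eta>
    using w(2)[OF that] a(2) by (meson order_trans)
  ultimately show ?thesis unfolding solves_def by blast
qed

text \<open>No bound on \<open>y\<close> is built into \<open>solves\<close>. Stages of length d/2
  exhaust [0, t1] in finitely many steps, and each adds at most one increment of the scheme plus the
  whole variation of \<open>w\<close>. The constant \<open>c\<close> is chosen anew at every stage,
  since it depends on the radius reached so far.\<close>

lemma solves_bounded:
  assumes y: "solves t1 y" and t1: "0 \<le> t1" "t1 \<le> T"
  shows "\<exists>R. \<forall>t. 0 \<le> t \<and> t \<le> t1 \<longrightarrow> norm (y t) \<le> R"
proof -
  obtain w where w: "mono_on {0..t1} w" and "\<exists>d>0. \<forall>s t. 0 \<le> s \<and> s \<le> t \<and> t \<le> t1 \<and> t - s < d \<longrightarrow>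
     norm (y t - y s - H s t (y s)) \<le> 1 * (w t - w s)"
    using y unfolding solves_def by (meson zero_less_one)
  then obtain d where d: "0 < d" "\<And>s t. 0 \<le> s \<Longrightarrow> s \<le> t \<Longrightarrow> t \<le> t1 \<Longrightarrow> t - s < d \<Longrightarrow>
     norm (y t - y s - H s t (y s)) \<le> w t - w s" by auto
  have wle: "w s \<le> w t" if "0 \<le> s" "s \<le> t" "t \<le> t1" for s t using w that by (auto simp: mono_on_def)
  have "\<exists>R. \<forall>t. 0 \<le> t \<and> t \<le> t1 \<and> t \<le> real n * (d/2) \<longrightarrow> norm (y t) \<le> R" for n
  proof (induction n)
    case 0
    show ?case by (intro exI[of _ "norm (y 0)"]) auto
  next
    case (Suc n)
    then obtain R where R: "\<And>t. 0 \<le> t \<Longrightarrow> t \<le> t1 \<Longrightarrow> t \<le> real n * (d/2) \<Longrightarrow> norm (y t) \<le> R" by auto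
    let ?s = "real n * (d/2)"
    obtain c where c: "scheme_bounds H \<omega> T p \<alpha> R c" using bounds by blast
    have c0: "0 \<le> c" using boundsD(1)[OF c] .
    define B where "B = c * (\<omega> T - \<omega> 0) powr (1/p) + (w t1 - w 0)"
    have B0: "0 \<le> B" using c0 wle[of 0 t1] t1 by (simp add: B_def)
    have "norm (y t) \<le> R + B" if t: "0 \<le> t" "t \<le> t1" "t \<le> real (Suc n) * (d/2)" for t
    proof (cases "t \<le> ?s")
      case True then show ?thesis using R[OF t(1,2)] B0 by simp
    next
      case False
      have s0: "0 \<le> ?s" using d by simp
      have s: "?s \<le> t" "?s \<le> t1" using False t by auto
      have "t - ?s < d" using t(3) d by (simp add: algebra_simps)
      then have 1: "norm (y t - y ?s - H ?s t (y ?s)) \<le> w t1 - w 0"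
        using d(2)[OF s0 s(1) t(2)] wle[OF t(1,2)] wle[of t t1] wle[of 0 ?s] s0 s t by auto
      have 2: "norm (y ?s) \<le> R" using R[OF s0 s(2)] by simp
      have "norm (H ?s t (y ?s)) \<le> c * (\<omega> t - \<omega> ?s) powr (1/p)"
        using boundsD(2)[OF c s0 s(1) _ 2] t t1 by simp
      also have "\<dots> \<le> c * (\<omega> T - \<omega> 0) powr (1/p)"
        using \<omega>_le[of 0 ?s] \<omega>_le[of ?s t] \<omega>_le[of t T] s0 s t t1 p c0
        by (intro mult_left_mono powr_mono2) auto
      finally have 3: "norm (H ?s t (y ?s)) \<le> c * (\<omega> T - \<omega> 0) powr (1/p)" .
      have "norm (y t) \<le> norm (y ?s) + norm (H ?s t (y ?s)) + norm (y t - y ?s - H ?s t (y ?s))"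
        using norm_add3[of "y ?s" "H ?s t (y ?s)" "y t - y ?s - H ?s t (y ?s)"] by simp
      then show ?thesis using 1 2 3 by (simp add: B_def)
    qed
    then show ?case by blast
  qed
  moreover obtain n where "t1 / (d/2) \<le> real n" using real_arch_simple by blast
  then have "t1 \<le> real n * (d/2)" using d by (simp add: field_simps)
  ultimately obtain R where "\<forall>t. 0 \<le> t \<and> t \<le> t1 \<and> t \<le> real n * (d/2) \<longrightarrow> norm (y t) \<le> R" by blast
  then show ?thesis using \<open>t1 \<le> real n * (d/2)\<close> by (intro exI[of _ R]) auto
qed

text \<open>\<open>restarted y ts k\<close> follows \<open>y\<close> along the grid up to index \<open>k\<close> and the scheme from then on;
  two consecutive restarts differ at index \<open>k + 1\<close> by a local error of \<open>y\<close> only.\<close>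

primrec restarted :: "(real \<Rightarrow> 'a) \<Rightarrow> (nat \<Rightarrow> real) \<Rightarrow> nat \<Rightarrow> nat \<Rightarrow> 'a" where
  "restarted y ts k 0 = y (ts 0)"
| "restarted y ts k (Suc l) = (if Suc l \<le> k then y (ts (Suc l))
     else restarted y ts k l + H (ts l) (ts (Suc l)) (restarted y ts k l))"

lemma restarted_le: "l \<le> k \<Longrightarrow> restarted y ts k l = y (ts l)"
  by (cases l) auto

lemma restarted_traj: "traj ts k l (restarted y ts k)"
  by (auto simp: traj_def)

lemma restarted_eq_traj:
  assumes "traj ts 0 K Y" "Y 0 = y (ts 0)" "l \<le> K"
  shows "restarted y ts 0 l = Y l"
  using assms(3) by (induction l) (use assms(1,2) in \<open>auto simp: traj_def\<close>)

text \<open>The mesh is measured in time but the estimates use the control; uniform continuity of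
  \<omega> on the compact interval links the two.\<close>

lemma \<omega>_uniform:
  assumes "0 < \<epsilon>"
  shows "\<exists>d>0. \<forall>s t. 0 \<le> s \<and> s \<le> t \<and> t \<le> T \<and> t - s < d \<longrightarrow> \<omega> t - \<omega> s < \<epsilon>"
proof -
  have "uniformly_continuous_on {0..T} \<omega>" using \<omega>_cont by (intro compact_uniformly_continuous) auto
  then obtain d where d: "0 < d" "\<And>x x'. x \<in> {0..T} \<Longrightarrow> x' \<in> {0..T} \<Longrightarrow> dist x' x < d \<Longrightarrow> dist (\<omega> x') (\<omega> x) < \<epsilon>"
    using assms unfolding uniformly_continuous_on_def by metis
  have "\<omega> t - \<omega> s < \<epsilon>" if "0 \<le> s" "s \<le> t" "t \<le> T" "t - s < d" for s t
    using d(2)[of s t] that by (auto simp: dist_real_def)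
  then show ?thesis using d(1) by blast
qed

text \<open>A telescoping sum over restarts (Lady Windermere's fan): the values of consecutive
  restarts at the end index differ by at most \<open>L\<close> times one local error, and the local
  errors sum to at most \<eta> V. \<open>L\<close> is available only while all restarts stay in a
  fixed ball, so closeness and confinement are proved together by strong induction on the end
  index.\<close>

theorem scheme_converges:
  assumes t: "0 \<le> t" "t \<le> T" and y: "solves t y" and \<epsilon>: "0 < \<epsilon>"
  shows "\<exists>\<delta>>0. \<forall>K ts Y. ts 0 = 0 \<and> ts K = t \<and> (\<forall>k<K. ts k \<le> ts (Suc k) \<and> ts (Suc k) - ts k < \<delta>) \<and>
     Y 0 = y 0 \<and> traj ts 0 K Y \<longrightarrow> (\<forall>k\<le>K. norm (Y k - y (ts k)) < \<epsilon>)"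
proof -
  obtain R where R: "\<And>s. 0 \<le> s \<Longrightarrow> s \<le> t \<Longrightarrow> norm (y s) \<le> R" using solves_bounded[OF y t] by blast
  obtain c where c: "scheme_bounds H \<omega> T p \<alpha> (R + 1) c" using bounds by blast
  obtain \<delta>1 L where \<delta>1: "0 < \<delta>1" and L0: "0 \<le> L" and
    lip: "\<And>ts a b Y Z. grid ts a b \<Longrightarrow> traj ts a b Y \<Longrightarrow> traj ts a b Z \<Longrightarrow> a \<le> b \<Longrightarrow>
     (\<And>k. a \<le> k \<Longrightarrow> k \<le> b \<Longrightarrow> norm (Y k) \<le> R + 2) \<Longrightarrow> (\<And>k. a \<le> k \<Longrightarrow> k \<le> b \<Longrightarrow> norm (Z k) \<le> R + 2) \<Longrightarrow>
     (\<And>k. a \<le> k \<Longrightarrow> k < b \<Longrightarrow> \<omega> (ts (Suc k)) - \<omega> (ts k) \<le> \<delta>1) \<Longrightarrow>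
     norm (Y b - Z b) \<le> L * norm (Y a - Z a)"
    using trajectories_lipschitz[of "R + 2"] by metis
  have "\<forall>\<^sub>F \<delta> in at_right 0. small c \<delta> \<and> \<delta> \<le> \<delta>1"
    unfolding small_def using p \<epsilon>0 \<delta>1
    by (intro eventually_conj eventually_mult_powr_le eventually_at_right_less)
       (auto simp: eventually_at_right intro: exI[of _ 1] exI[of _ \<delta>1])
  then obtain \<delta> where \<delta>: "small c \<delta>" "\<delta> \<le> \<delta>1"
    using eventually_happens trivial_limit_at_right_real by blast
  have \<delta>0: "0 < \<delta>" using \<delta> by (simp add: small_def)
  obtain d1 where d1: "0 < d1" "\<And>s t. 0 \<le> s \<Longrightarrow> s \<le> t \<Longrightarrow> t \<le> T \<Longrightarrow> t - s < d1 \<Longrightarrow> \<omega> t - \<omega> s < \<delta>"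
    using \<omega>_uniform[OF \<delta>0] by blast
  obtain w where w: "mono_on {0..t} w" and wd: "\<And>\<eta>. \<eta> > 0 \<Longrightarrow> \<exists>d>0. \<forall>s s'. 0 \<le> s \<and> s \<le> s' \<and> s' \<le> t \<and> s' - s < d \<longrightarrow>
     norm (y s' - y s - H s s' (y s)) \<le> \<eta> * (w s' - w s)" using y unfolding solves_def by blast
  have wle: "w s \<le> w s'" if "0 \<le> s" "s \<le> s'" "s' \<le> t" for s s' using w that by (auto simp: mono_on_def)
  define V where "V = w t - w 0"
  have V0: "0 \<le> V" using wle[of 0 t] t by (simp add: V_def)
  \<comment> \<open>Chosen so that L \<eta> V is at most 1, which confines the restarts, and at most
    \<epsilon>/2. Adding 1 to \<open>L\<close> and \<open>V\<close> avoids division by 0.\<close>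
  define \<eta> where "\<eta> = min 1 (\<epsilon> / 2) / ((L + 1) * (V + 1))"
  have \<eta>: "0 < \<eta>" using \<epsilon> L0 V0 by (simp add: \<eta>_def)
  have \<eta>V: "L * (\<eta> * V) \<le> min 1 (\<epsilon> / 2)"
  proof -
    have "L * V \<le> (L + 1) * (V + 1)" using L0 V0 by (intro mult_mono) auto
    then have "\<eta> * (L * V) \<le> \<eta> * ((L + 1) * (V + 1))" using \<eta> by (intro mult_left_mono) auto
    also have "\<dots> = min 1 (\<epsilon> / 2)" using L0 V0 by (simp add: \<eta>_def)
    finally show ?thesis by (simp add: algebra_simps)
  qed
  obtain d2 where d2: "0 < d2" "\<And>s s'. 0 \<le> s \<Longrightarrow> s \<le> s' \<Longrightarrow> s' \<le> t \<Longrightarrow> s' - s < d2 \<Longrightarrow>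
     norm (y s' - y s - H s s' (y s)) \<le> \<eta> * (w s' - w s)" using wd[OF \<eta>] by blast
  show ?thesis
  proof (rule exI[of _ "min d1 d2"], intro conjI allI impI, goal_cases)
    case 1 show ?case using d1 d2 by simp
  next
    case (2 K ts Y k)
    then have ts: "ts 0 = 0" "ts K = t" and st: "\<And>k. k < K \<Longrightarrow> ts k \<le> ts (Suc k)"
      "\<And>k. k < K \<Longrightarrow> ts (Suc k) - ts k < d1" "\<And>k. k < K \<Longrightarrow> ts (Suc k) - ts k < d2"
      and Y: "Y 0 = y 0" "traj ts 0 K Y" and k: "k \<le> K" by auto
    have tmono: "ts i \<le> ts j" if "i \<le> j" "j \<le> K" for i j
      using that
    proof (induction j rule: dec_induct)
      case (step n) then show ?case using st(1)[of n] by simp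
    qed simp
    have tr: "0 \<le> ts j" "ts j \<le> t" if "j \<le> K" for j using tmono[of 0 j] tmono[of j K] that ts by auto
    have g: "grid ts 0 K" using tr t tmono unfolding grid_def by (auto intro: order_trans)
    define X where "X = restarted y ts"
    \<comment> \<open>The restart index \<open>i\<close> is arbitrary because confinement is needed
      for every restart in the sum, not only for the scheme itself, which is
      \<open>X 0\<close>.\<close>
    have main: "norm (X i l - y (ts l)) \<le> L * (\<eta> * (w (ts l) - w (ts i)))" if "i \<le> l" "l \<le> K" for i l
      using that
    proof (induction l arbitrary: i rule: less_induct)
      case (less l)
      have close: "norm (X i m) \<le> R + 1" if "i \<le> m" "m < l" for i m
      proof -
        have "norm (X i m - y (ts m)) \<le> L * (\<eta> * (w (ts m) - w (ts i)))"
          using less.IH[of m i] that less.prems by simp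
        also have "\<dots> \<le> L * (\<eta> * V)"
          using L0 \<eta> wle[of 0 "ts i"] wle[of "ts m" t] tr that less.prems
          by (intro mult_left_mono) (auto simp: V_def)
        also have "\<dots> \<le> 1" using \<eta>V by simp
        finally have "norm (X i m - y (ts m)) \<le> 1" .
        moreover have "norm (y (ts m)) \<le> R" using R tr that less.prems by simp
        ultimately show ?thesis using norm_triangle_ineq2[of "X i m" "y (ts m)"] by linarith
      qed
      \<comment> \<open>At the new end index the estimate is not yet available; one step from the
        confined point \<open>X i j\<close> adds at most 1, hence R + 2.\<close>
      have close2: "norm (X i m) \<le> R + 2" if im: "i \<le> m" "m \<le> l" for i m
      proof (cases "m = l")
        case False then show ?thesis using close[of i m] im by simp
      next
        case True
        show ?thesis
        proof (cases "i = l")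
          case True
          then show ?thesis using R[of "ts l"] tr less.prems \<open>m = l\<close> by (simp add: X_def restarted_le)
        next
          case False
          then obtain j where j: "l = Suc j" "i \<le> j" using im True by (cases l) auto
          have X: "X i l = X i j + H (ts j) (ts l) (X i j)" using j by (simp add: X_def)
          have cj: "norm (X i j) \<le> R + 1" using close[of i j] j by simp
          have "norm (H (ts j) (ts l) (X i j)) \<le> 1"
            using small_step(2)[OF c \<delta>(1) _ _ _ _ cj] d1(2)[of "ts j" "ts l"] st[of j] tr[of j] tr[of l] t j less.prems
            by (simp add: less_imp_le)
          then show ?thesis using cj norm_triangle_ineq[of "X i j" "H (ts j) (ts l) (X i j)"] True X by simp
        qed
      qed
      have one: "norm (X j l - X (Suc j) l) \<le> L * (\<eta> * (w (ts (Suc j)) - w (ts j)))" if j: "j < l" for j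
      proof -
        have "norm (X j l - X (Suc j) l) \<le> L * norm (X j (Suc j) - X (Suc j) (Suc j))"
        proof (rule lip[of ts "Suc j" l])
          show "grid ts (Suc j) l" using g less.prems by (auto simp: grid_def)
          show "traj ts (Suc j) l (X j)" using restarted_traj[of ts j l y] by (auto simp: X_def traj_def)
          show "traj ts (Suc j) l (X (Suc j))" by (simp add: X_def restarted_traj)
          show "norm (X j k) \<le> R + 2" if "Suc j \<le> k" "k \<le> l" for k using close2[of j k] that by simp
          show "norm (X (Suc j) k) \<le> R + 2" if "Suc j \<le> k" "k \<le> l" for k using close2[of "Suc j" k] that by simp
          show "\<omega> (ts (Suc k)) - \<omega> (ts k) \<le> \<delta>1" if "Suc j \<le> k" "k < l" for k
            using d1(2)[of "ts k" "ts (Suc k)"] st[of k] tr[of k] tr[of "Suc k"] that less.prems t \<delta> by simp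
        qed (use j in auto)
        also have "X j (Suc j) - X (Suc j) (Suc j) = - (y (ts (Suc j)) - y (ts j) - H (ts j) (ts (Suc j)) (y (ts j)))"
          by (simp add: X_def restarted_le)
        also have "norm \<dots> \<le> \<eta> * (w (ts (Suc j)) - w (ts j))"
          unfolding norm_minus_cancel using d2(2)[of "ts j" "ts (Suc j)"] st[of j] tr[of j] tr[of "Suc j"] j less.prems by simp
        finally show ?thesis using L0 by (simp add: mult_left_mono)
      qed
      have "norm (X i l - X (i + n) l) \<le> L * (\<eta> * (w (ts (i + n)) - w (ts i)))" if "i + n \<le> l" for n
        using that
      proof (induction n)
        case 0 then show ?case by simp
      next
        case (Suc n)
        have "norm (X i l - X (i + Suc n) l) \<le> norm (X i l - X (i + n) l) + norm (X (i + n) l - X (Suc (i + n)) l)"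
          using norm_triangle_ineq[of "X i l - X (i + n) l" "X (i + n) l - X (Suc (i + n)) l"] by simp
        also have "\<dots> \<le> L * (\<eta> * (w (ts (i + n)) - w (ts i))) + L * (\<eta> * (w (ts (Suc (i + n))) - w (ts (i + n))))"
          using Suc by (intro add_mono one) auto
        finally show ?case by (simp add: algebra_simps)
      qed
      from this[of "l - i"] show ?case using less.prems by (simp add: X_def restarted_le)
    qed
    have "norm (X 0 k - y (ts k)) \<le> L * (\<eta> * (w (ts k) - w (ts 0)))" using main[of 0 k] k by simp
    also have "\<dots> \<le> L * (\<eta> * V)"
      using L0 \<eta> wle[of "ts k" t] tr[OF k] ts by (intro mult_left_mono) (auto simp: V_def)
    also have "\<dots> < \<epsilon>" using \<eta>V \<epsilon> by linarith
    finally show ?case using restarted_eq_traj[of ts K Y y k] Y ts k by (simp add: X_def)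
  qed
qed

text \<open>The scheme, run from the common initial value on one fine uniform grid of [0, s], ends
  closer than half the supposed distance to both \<open>y s\<close> and \<open>z s\<close>, which is
  absurd.\<close>

theorem solves_unique:
  assumes t: "0 \<le> t" "t \<le> T" and y: "solves t y" and z: "solves t z" and eq: "y 0 = z 0" and s: "0 \<le> s" "s \<le> t"
  shows "y s = z s"
proof (rule ccontr)
  assume ne: "y s \<noteq> z s"
  define \<epsilon> where "\<epsilon> = norm (y s - z s) / 2"
  have \<epsilon>: "0 < \<epsilon>" using ne by (simp add: \<epsilon>_def)
  have sT: "s \<le> T" using s t by simp
  obtain d where d: "0 < d" "\<And>K ts Y. ts 0 = 0 \<Longrightarrow> ts K = s \<Longrightarrow> (\<And>k. k<K \<Longrightarrow> ts k \<le> ts (Suc k) \<and> ts (Suc k) - ts k < d) \<Longrightarrow>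
     Y 0 = y 0 \<Longrightarrow> traj ts 0 K Y \<Longrightarrow> norm (Y K - y (ts K)) < \<epsilon>"
    using scheme_converges[OF s(1) sT solves_mono[OF y s(2)] \<epsilon>] by (metis order_refl)
  obtain d' where d': "0 < d'" "\<And>K ts Y. ts 0 = 0 \<Longrightarrow> ts K = s \<Longrightarrow> (\<And>k. k<K \<Longrightarrow> ts k \<le> ts (Suc k) \<and> ts (Suc k) - ts k < d') \<Longrightarrow>
     Y 0 = z 0 \<Longrightarrow> traj ts 0 K Y \<Longrightarrow> norm (Y K - z (ts K)) < \<epsilon>"
    using scheme_converges[OF s(1) sT solves_mono[OF z s(2)] \<epsilon>] by (metis order_refl)
  define e where "e = min d d'"
  have e: "0 < e" "e \<le> d" "e \<le> d'" using d d' by (auto simp: e_def)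
  obtain n where n: "s / e < real n" using reals_Archimedean2 by blast
  have "0 \<le> s / e" using s e by simp
  then have n0: "0 < n" using n by (cases n) auto
  define ts where "ts k = real k * (s / real n)" for k
  define Y where "Y = restarted y ts 0"
  have "ts (Suc k) - ts k = s / real n" for k by (simp add: ts_def algebra_simps add_divide_distrib)
  moreover have "s / real n < e" using n n0 e by (simp add: field_simps)
  moreover have "0 \<le> s / real n" using s by simp
  ultimately have mesh: "ts k \<le> ts (Suc k) \<and> ts (Suc k) - ts k < e" for k by (metis diff_ge_0_iff_ge)
  have ts: "ts 0 = 0" "ts n = s" using n0 by (auto simp: ts_def)
  have Y: "Y 0 = y 0" "traj ts 0 n Y" using restarted_traj[of ts 0 n y] ts by (auto simp: Y_def)
  have "norm (Y n - y s) < \<epsilon>" using d(2)[of ts n Y] ts Y mesh e by (metis order_less_le_trans)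
  moreover have "norm (Y n - z s) < \<epsilon>" using d'(2)[of ts n Y] ts Y mesh e eq by (metis order_less_le_trans)
  moreover have "norm (y s - z s) \<le> norm (Y n - z s) + norm (Y n - y s)"
    using norm_triangle_ineq4[of "Y n - z s" "Y n - y s"] by simp
  ultimately show False by (simp add: \<epsilon>_def)
qed

end

section \<open>Existence\<close>

text \<open>Tychonoff's theorem, transferred to the topology of the function type.\<close>

lemma compact_PiE_UNIV:
  fixes S :: "'i \<Rightarrow> 'b::topological_space set"
  assumes "\<And>i. compact (S i)"
  shows "compact (PiE UNIV S)"
  using compactin_PiE[of "\<lambda>_. euclidean" UNIV S] assms by (simp add: euclidean_product_topology)

context rough_scheme begin

text \<open>Serves to make the local error conditions closed under pointwise convergence; continuity
  follows from the Lipschitz bound on a ball around each point.\<close>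

lemma continuous_H:
  assumes "0 \<le> s" "s \<le> t" "t \<le> T"
  shows "continuous_on UNIV (H s t)"
proof (intro continuous_at_imp_continuous_on ballI)
  fix v :: 'a
  obtain c where c: "scheme_bounds H \<omega> T p \<alpha> (norm v + 1) c" using bounds by blast
  have "(c * (\<omega> t - \<omega> s) powr (1/p))-lipschitz_on (ball v 1) (H s t)"
  proof (rule lipschitz_onI)
    fix x y assume *: "x \<in> ball v 1" "y \<in> ball v 1"
    have "norm x \<le> norm v + 1" "norm y \<le> norm v + 1"
      using * norm_triangle_ineq2[of x v] norm_triangle_ineq2[of y v] by (auto simp: dist_norm norm_minus_commute)
    then show "dist (H s t x) (H s t y) \<le> c * (\<omega> t - \<omega> s) powr (1/p) * dist x y"
      using boundsD(3)[OF c assms] by (simp add: dist_norm)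
  qed (use boundsD(1)[OF c] in auto)
  then have "continuous_on (ball v 1) (H s t)" by (rule lipschitz_on_continuous_on)
  then show "isCont (H s t) v" by (simp add: continuous_on_eq_continuous_at)
qed

text \<open>The notion in which existence is carried out: the error is measured by the given control
  with a definite power above 1. For fixed \<open>C\<close> the condition passes to pointwise
  limits, and with \<open>C\<close> free the class is closed under concatenation.\<close>

definition rough_sol :: "real \<Rightarrow> real \<Rightarrow> (real \<Rightarrow> 'a) \<Rightarrow> bool" where
  "rough_sol a b y \<longleftrightarrow> (\<exists>C\<ge>0. \<forall>s t. a \<le> s \<and> s \<le> t \<and> t \<le> b \<longrightarrow>
     norm (y t - y s - H s t (y s)) \<le> C * (\<omega> t - \<omega> s) powr q)"

lemma finite_grid_solution:
  assumes c: "scheme_bounds H \<omega> T p \<alpha> (R + 3) c" and \<delta>: "small c \<delta>"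
    "2 * c * \<delta> powr (1/p) \<le> 1" "2 * K0 * c * \<delta> powr q \<le> 1"
    and ab: "0 \<le> a" "a \<le> b" "b \<le> T" "\<omega> b - \<omega> a \<le> \<delta>" and v: "norm v \<le> R"
    and Q: "finite Q" "Q \<subseteq> {a..b}"
  shows "\<exists>y. y a = v \<and> (\<forall>t. norm (y t) \<le> R + 1) \<and> (\<forall>s\<in>Q. \<forall>t\<in>Q. s \<le> t \<longrightarrow>
     norm (y t - y s - H s t (y s)) \<le> K0 * c * (\<omega> t - \<omega> s) powr q)"
proof -
  define xs where "xs = sorted_list_of_set (insert a Q)"
  define ts where "ts k = xs ! k" for k
  have fin: "finite (insert a Q)" using Q by simp
  have set: "set xs = insert a Q" unfolding xs_def by (rule set_sorted_list_of_set[OF fin])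
  have sw: "sorted_wrt (<) xs" unfolding xs_def by (rule strict_sorted_list_of_set)
  obtain K where K: "length xs = Suc K" using set by (cases xs) auto
  have less: "ts i < ts j" if "i < j" "j \<le> K" for i j
    using sorted_wrt_nth_less[OF sw that(1)] that K by (simp add: ts_def)
  have le: "ts i \<le> ts j" if "i \<le> j" "j \<le> K" for i j using less[of i j] that by (cases "i = j") auto
  have inQ: "ts i \<in> insert a Q" if "i \<le> K" for i using that K set nth_mem[of i xs] by (simp add: ts_def)
  have rng: "a \<le> ts i" "ts i \<le> b" if "i \<le> K" for i using inQ[OF that] Q ab by auto
  have "\<forall>t\<in>insert a Q. \<exists>i. i \<le> K \<and> ts i = t" using set K by (metis in_set_conv_nth less_Suc_eq_le ts_def)
  then obtain idx where idx: "\<And>t. t \<in> insert a Q \<Longrightarrow> idx t \<le> K \<and> ts (idx t) = t" by metis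
  have idx_le: "idx s \<le> idx t" if "s \<in> Q" "t \<in> Q" "s \<le> t" for s t
  proof (rule ccontr)
    assume "\<not> idx s \<le> idx t"
    then have "ts (idx t) < ts (idx s)" using idx[of s] that by (intro less) auto
    then show False using idx that by auto
  qed
  have ts0: "ts 0 = a" using le[of 0 "idx a"] idx[of a] rng[of 0] by auto
  have idxa: "idx a = 0" using less[of 0 "idx a"] idx[of a] ts0 by (cases "idx a") auto
  have g: "grid ts 0 K" using rng ab le unfolding grid_def by (auto intro: order_trans)
  define Y where "Y = restarted (\<lambda>_. v) ts 0"
  have Y0: "Y 0 = v" by (simp add: Y_def)
  have Y: "traj ts 0 K Y" by (simp add: Y_def restarted_traj)
  have W: "\<omega> (ts K) - \<omega> (ts 0) \<le> \<delta>"
    using \<omega>_le[of "ts K" b] rng[of K] ts0 ab by auto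
  have Yb: "norm (Y k) \<le> R + 1" if "k \<le> K" for k
    by (rule trajectory_bounded[OF c \<delta> g Y _ W]) (use Y0 v that in auto)
  \<comment> \<open>Times off the grid only have to stay in the ball of radius R + 1, which the
    value \<open>v\<close> does.\<close>
  define y where "y t = (if t \<in> insert a Q then Y (idx t) else v)" for t
  show ?thesis
  proof (intro exI[of _ y] conjI allI ballI impI)
    show "y a = v" by (simp add: y_def idxa Y0)
    show "norm (y t) \<le> R + 1" for t using Yb idx v by (auto simp: y_def)
    fix s t assume st: "s \<in> Q" "t \<in> Q" "s \<le> t"
    have "norm (Y (idx t) - Y (idx s) - H (ts (idx s)) (ts (idx t)) (Y (idx s)))
       \<le> K0 * c * (\<omega> (ts (idx t)) - \<omega> (ts (idx s))) powr q"
    proof (rule trajectory_defect[where R = "R + 2", OF _ \<delta>(1) g Y _ W])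
      show "norm (Y k) \<le> R + 2" if "k \<le> K" for k using Yb[OF that] by simp
    qed (use c idx idx_le st in \<open>auto simp: add.assoc\<close>)
    then show "norm (y t - y s - H s t (y s)) \<le> K0 * c * (\<omega> t - \<omega> s) powr q"
      using idx st by (simp add: y_def)
  qed
qed

text \<open>Existence by compactness: on every finite grid the scheme satisfies the local estimates with
  the same constant, and these are closed conditions on a product of balls.\<close>

lemma local_existence:
  "\<exists>\<delta>>0. \<forall>a b v. 0 \<le> a \<and> a \<le> b \<and> b \<le> T \<and> \<omega> b - \<omega> a \<le> \<delta> \<and> norm v \<le> R \<longrightarrow>
     (\<exists>y. y a = v \<and> rough_sol a b y)"
proof -
  obtain c where c: "scheme_bounds H \<omega> T p \<alpha> (R + 3) c" using bounds by blast
  have "\<forall>\<^sub>F \<delta> in at_right 0. small c \<delta> \<and> 2 * c * \<delta> powr (1/p) \<le> 1 \<and> 2 * K0 * c * \<delta> powr q \<le> 1"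
    unfolding small_def using p q \<epsilon>0
    by (intro eventually_conj eventually_mult_powr_le eventually_at_right_less)
       (auto simp: eventually_at_right intro!: exI[of _ 1])
  then obtain \<delta> where \<delta>: "small c \<delta>" "2 * c * \<delta> powr (1/p) \<le> 1" "2 * K0 * c * \<delta> powr q \<le> 1"
    using eventually_happens trivial_limit_at_right_real by blast
  show ?thesis
  \<comment> \<open>\<delta> was chosen from \<open>c\<close>, thus from \<open>R\<close> alone,
    uniformly in \<open>a\<close>, \<open>b\<close> and \<open>v\<close>; continuation up to blow-up
    rests on this uniformity.\<close>
  proof (rule exI[of _ \<delta>], intro conjI allI impI)
    show "0 < \<delta>" using \<delta> by (simp add: small_def)
    fix a b and v :: 'a assume *: "0 \<le> a \<and> a \<le> b \<and> b \<le> T \<and> \<omega> b - \<omega> a \<le> \<delta> \<and> norm v \<le> R"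
    define I where "I = {(s, t). a \<le> s \<and> s \<le> t \<and> t \<le> b}"
    define F where "F = (\<lambda>(s, t). {y :: real \<Rightarrow> 'a. norm (y t - y s - H s t (y s)) \<le> K0 * c * (\<omega> t - \<omega> s) powr q})"
    \<comment> \<open>The initial condition is built into the compact set as a singleton factor at
      time \<open>a\<close>.\<close>
    define S :: "(real \<Rightarrow> 'a) set" where "S = PiE UNIV (\<lambda>t. if t = a then {v} else cball 0 (R + 1))"
    have "S \<inter> (\<Inter>i\<in>I. F i) \<noteq> {}"
    proof (rule compact_imp_fip_image)
      show "compact S" unfolding S_def by (rule compact_PiE_UNIV) auto
      show "closed (F i)" if "i \<in> I" for i
      proof -
        obtain s t where st: "i = (s, t)" "a \<le> s" "s \<le> t" "t \<le> b" using \<open>i \<in> I\<close> unfolding I_def by blast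
        then have i: "i = (s, t)" "0 \<le> s" "s \<le> t" "t \<le> T" using * by auto
        have "continuous_on UNIV (\<lambda>y. H s t (y s))"
          by (rule continuous_on_compose2[OF continuous_H[OF i(2-4)] continuous_on_product_coordinates]) auto
        then show ?thesis unfolding i F_def prod.case
          by (intro closed_Collect_le continuous_on_norm continuous_on_diff continuous_on_const continuous_on_product_coordinates)
      qed
      fix I' assume I': "finite I'" "I' \<subseteq> I"
      obtain y where y: "y a = v" "\<And>t. norm (y t) \<le> R + 1" "\<And>s t. s \<in> fst ` I' \<union> snd ` I' \<Longrightarrow> t \<in> fst ` I' \<union> snd ` I' \<Longrightarrow> s \<le> t \<Longrightarrow>
         norm (y t - y s - H s t (y s)) \<le> K0 * c * (\<omega> t - \<omega> s) powr q"
        using finite_grid_solution[OF c \<delta>, of a b v "fst ` I' \<union> snd ` I'"] * I' unfolding I_def by fastforce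
      have "y \<in> S" using y by (auto simp: S_def PiE_iff)
      moreover have "y \<in> F i" if "i \<in> I'" for i
        using y(3)[of "fst i" "snd i"] that I' by (auto simp: F_def I_def)
      ultimately show "S \<inter> (\<Inter>i\<in>I'. F i) \<noteq> {}" by auto
    qed
    then obtain y where "y \<in> S" "\<And>i. i \<in> I \<Longrightarrow> y \<in> F i" by auto
    then have "y a = v" "\<And>s t. a \<le> s \<Longrightarrow> s \<le> t \<Longrightarrow> t \<le> b \<Longrightarrow> norm (y t - y s - H s t (y s)) \<le> K0 * c * (\<omega> t - \<omega> s) powr q"
      by (auto simp: S_def I_def F_def PiE_iff split: if_splits)
    then show "\<exists>y. y a = v \<and> rough_sol a b y"
      unfolding rough_sol_def using K0 boundsD(1)[OF c] by (metis mult_nonneg_nonneg)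
  qed
qed

section \<open>Concatenation of solutions and maximal existence\<close>

lemma rough_sol_bounded:
  assumes "rough_sol a b y" "0 \<le> a" "b \<le> T"
  shows "\<exists>R. \<forall>t. a \<le> t \<and> t \<le> b \<longrightarrow> norm (y t) \<le> R"
proof -
  obtain C where C: "0 \<le> C" "\<And>s t. a \<le> s \<Longrightarrow> s \<le> t \<Longrightarrow> t \<le> b \<Longrightarrow> norm (y t - y s - H s t (y s)) \<le> C * (\<omega> t - \<omega> s) powr q"
    using assms unfolding rough_sol_def by blast
  obtain c where c: "scheme_bounds H \<omega> T p \<alpha> (norm (y a)) c" using bounds by blast
  have "norm (y t) \<le> norm (y a) + c * (\<omega> b - \<omega> a) powr (1/p) + C * (\<omega> b - \<omega> a) powr q" if t: "a \<le> t" "t \<le> b" for t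
  proof -
    have W: "0 \<le> \<omega> t - \<omega> a" "\<omega> t - \<omega> a \<le> \<omega> b - \<omega> a" using \<omega>_le[of a t] \<omega>_le[of t b] t assms by auto
    have "norm (y t - y a - H a t (y a)) \<le> C * (\<omega> t - \<omega> a) powr q" using C(2)[of a t] t by simp
    also have "\<dots> \<le> C * (\<omega> b - \<omega> a) powr q" using W q C by (intro mult_left_mono powr_mono2) auto
    finally have 1: "norm (y t - y a - H a t (y a)) \<le> C * (\<omega> b - \<omega> a) powr q" .
    have "norm (H a t (y a)) \<le> c * (\<omega> t - \<omega> a) powr (1/p)" using boundsD(2)[OF c, of a t] t assms by simp
    also have "\<dots> \<le> c * (\<omega> b - \<omega> a) powr (1/p)" using W p boundsD(1)[OF c] by (intro mult_left_mono powr_mono2) auto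
    finally have 2: "norm (H a t (y a)) \<le> c * (\<omega> b - \<omega> a) powr (1/p)" .
    have "norm (y t) \<le> norm (y a) + norm (H a t (y a)) + norm (y t - y a - H a t (y a))"
      using norm_add3[of "y a" "H a t (y a)" "y t - y a - H a t (y a)"] by simp
    then show ?thesis using 1 2 by linarith
  qed
  then show ?thesis by blast
qed

lemma rough_sol_cong:
  assumes "rough_sol a b y" "\<And>t. a \<le> t \<Longrightarrow> t \<le> b \<Longrightarrow> y t = z t"
  shows "rough_sol a b z"
proof -
  obtain C where C: "0 \<le> C" "\<And>s t. a \<le> s \<Longrightarrow> s \<le> t \<Longrightarrow> t \<le> b \<Longrightarrow> norm (y t - y s - H s t (y s)) \<le> C * (\<omega> t - \<omega> s) powr q"
    using assms unfolding rough_sol_def by blast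
  have "norm (z t - z s - H s t (z s)) \<le> C * (\<omega> t - \<omega> s) powr q" if "a \<le> s" "s \<le> t" "t \<le> b" for s t
    using C(2)[OF that] assms(2)[of s] assms(2)[of t] that by simp
  then show ?thesis using C(1) unfolding rough_sol_def by blast
qed

lemma rough_sol_mono: "rough_sol a b y \<Longrightarrow> b' \<le> b \<Longrightarrow> rough_sol a b' y"
  unfolding rough_sol_def by (meson order_trans)

text \<open>Only intervals straddling \<open>m\<close> are at issue. There the error splits at
  \<open>m\<close> into the error of \<open>z\<close>, the error of \<open>y\<close> transported by
  the step map over [m, u], and the flow error started at \<open>y s\<close>. No control is small
  here, so the step map enters with its full Lipschitz constant, bounded by
  \<open>B\<close>.\<close>

lemma rough_sol_concat:
  assumes y: "rough_sol a m y" and z: "rough_sol m b z" and eq: "y m = z m"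
    and amb: "0 \<le> a" "a \<le> m" "m \<le> b" "b \<le> T"
  shows "rough_sol a b (\<lambda>t. if t \<le> m then y t else z t)"
proof -
  obtain C1 where C1: "0 \<le> C1" "\<And>s t. a \<le> s \<Longrightarrow> s \<le> t \<Longrightarrow> t \<le> m \<Longrightarrow> norm (y t - y s - H s t (y s)) \<le> C1 * (\<omega> t - \<omega> s) powr q"
    using y unfolding rough_sol_def by blast
  obtain C2 where C2: "0 \<le> C2" "\<And>s t. m \<le> s \<Longrightarrow> s \<le> t \<Longrightarrow> t \<le> b \<Longrightarrow> norm (z t - z s - H s t (z s)) \<le> C2 * (\<omega> t - \<omega> s) powr q"
    using z unfolding rough_sol_def by blast
  obtain R where R: "\<And>t. a \<le> t \<Longrightarrow> t \<le> m \<Longrightarrow> norm (y t) \<le> R"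
    using rough_sol_bounded[OF y] amb by auto
  obtain c0 where c0: "scheme_bounds H \<omega> T p \<alpha> R c0" using bounds by blast
  \<comment> \<open>A radius that also contains the one-step predictions made from points of
    \<open>y\<close>.\<close>
  define R' where "R' = R + c0 * (\<omega> T - \<omega> 0) powr (1/p)"
  have RR': "R \<le> R'" using boundsD(1)[OF c0] by (simp add: R'_def)
  obtain c where c: "scheme_bounds H \<omega> T p \<alpha> R' c" using bounds by blast
  have cnn: "0 \<le> c" using boundsD(1)[OF c] .
  define B where "B = 1 + c * (\<omega> T - \<omega> 0) powr (1/p)"
  define C where "C = C2 + B * C1 + c"
  have B0: "0 \<le> B" using cnn by (simp add: B_def)
  have straddle: "norm (z u - y s - H s u (y s)) \<le> C * (\<omega> u - \<omega> s) powr q" if s: "a \<le> s" "s \<le> m" "m \<le> u" "u \<le> b" for s u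
  proof -
    define v where "v = y s + H s m (y s)"
    have ys: "norm (y s) \<le> R" "norm (y m) \<le> R'" using R[of s] R[of m] s amb RR' by auto
    have w: "0 \<le> \<omega> m - \<omega> s" "\<omega> m - \<omega> s \<le> \<omega> T - \<omega> 0" "0 \<le> \<omega> u - \<omega> m" "\<omega> u - \<omega> m \<le> \<omega> T - \<omega> 0"
      "\<omega> u - \<omega> m \<le> \<omega> u - \<omega> s" "\<omega> m - \<omega> s \<le> \<omega> u - \<omega> s"
      using \<omega>_le[of 0 s] \<omega>_le[of s m] \<omega>_le[of m u] \<omega>_le[of u T] s amb by auto
    have "norm (H s m (y s)) \<le> c0 * (\<omega> m - \<omega> s) powr (1/p)" using boundsD(2)[OF c0 _ _ _ ys(1)] s amb by simp
    also have "\<dots> \<le> c0 * (\<omega> T - \<omega> 0) powr (1/p)" using w p boundsD(1)[OF c0] by (intro mult_left_mono powr_mono2) auto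
    finally have v: "norm v \<le> R'" using ys norm_triangle_ineq[of "y s" "H s m (y s)"] by (simp add: v_def R'_def)
    have 1: "norm (z u - z m - H m u (z m)) \<le> C2 * (\<omega> u - \<omega> s) powr q"
      using order_trans[OF C2(2)[of m u] mult_left_mono[OF powr_mono2[of q "\<omega> u - \<omega> m" "\<omega> u - \<omega> s"] C2(1)]] s w q by simp
    have 2: "norm (y m - v) \<le> C1 * (\<omega> u - \<omega> s) powr q"
      using order_trans[OF C1(2)[of s m] mult_left_mono[OF powr_mono2[of q "\<omega> m - \<omega> s" "\<omega> u - \<omega> s"] C1(1)]] s w q
      by (simp add: v_def algebra_simps)
    have "norm (H m u (y m) - H m u v) \<le> c * (\<omega> u - \<omega> m) powr (1/p) * norm (y m - v)"
      using boundsD(3)[OF c _ _ _ ys(2) v] s amb by simp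
    also have "\<dots> \<le> c * (\<omega> T - \<omega> 0) powr (1/p) * norm (y m - v)"
      using w p cnn by (intro mult_right_mono mult_left_mono powr_mono2) auto
    finally have "norm ((y m - v) + (H m u (y m) - H m u v)) \<le> B * norm (y m - v)"
      using norm_triangle_ineq[of "y m - v" "H m u (y m) - H m u v"] unfolding B_def distrib_right mult_1
      by linarith
    then have "norm ((y m + H m u (y m)) - (v + H m u v)) \<le> B * norm (y m - v)" by (simp add: algebra_simps)
    also have "\<dots> \<le> B * (C1 * (\<omega> u - \<omega> s) powr q)" using 2 B0 by (intro mult_left_mono) auto
    finally have 3: "norm ((y m + H m u (y m)) - (v + H m u v)) \<le> B * (C1 * (\<omega> u - \<omega> s) powr q)" .
    have 4: "norm (H m u v + H s m (y s) - H s u (y s)) \<le> c * (\<omega> u - \<omega> s) powr q"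
      unfolding v_def using boundsD(5)[OF c, of s m u "y s"] ys RR' s amb by simp
    have "z u - y s - H s u (y s) = (z u - z m - H m u (z m)) + ((y m + H m u (y m)) - (v + H m u v)) + (H m u v + H s m (y s) - H s u (y s))"
      using eq by (simp add: v_def)
    then have "norm (z u - y s - H s u (y s)) \<le> norm (z u - z m - H m u (z m)) + norm ((y m + H m u (y m)) - (v + H m u v)) + norm (H m u v + H s m (y s) - H s u (y s))"
      by (simp only: norm_add3)
    then show ?thesis using 1 3 4 by (simp add: C_def algebra_simps)
  qed
  have CC: "C1 \<le> max C1 (max C2 C)" "C2 \<le> max C1 (max C2 C)" "C \<le> max C1 (max C2 C)" by auto
  show ?thesis unfolding rough_sol_def
  proof (intro exI[of _ "max C1 (max C2 C)"] conjI allI impI)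
    show "0 \<le> max C1 (max C2 C)" using C1 by simp
    fix s t assume st: "a \<le> s \<and> s \<le> t \<and> t \<le> b"
    let ?w = "(\<omega> t - \<omega> s) powr q"
    have CCw: "C1 * ?w \<le> max C1 (max C2 C) * ?w" "C2 * ?w \<le> max C1 (max C2 C) * ?w" "C * ?w \<le> max C1 (max C2 C) * ?w"
      by (intro mult_right_mono CC powr_ge_zero)+
    consider "t \<le> m" | "m < s" | "s \<le> m" "m < t" by linarith
    then show "norm ((if t \<le> m then y t else z t) - (if s \<le> m then y s else z s) - H s t (if s \<le> m then y s else z s))
      \<le> max C1 (max C2 C) * ?w"
    proof cases
      case 1 then show ?thesis using order_trans[OF C1(2)[of s t] CCw(1)] st by simp
    next
      case 2 then show ?thesis using order_trans[OF C2(2)[of s t] CCw(2)] st by simp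
    next
      case 3 then show ?thesis using order_trans[OF straddle[of s t] CCw(3)] st by simp
    qed
  qed
qed

text \<open>Write w^q as w^(q-1) w: the first factor is small on short intervals because q > 1 and
  \<omega> is uniformly continuous, the second is the increment of the control, so \<omega> itself
  serves as the auxiliary function in \<open>solves\<close>.\<close>

lemma rough_sol_imp_solves:
  assumes "rough_sol 0 t y" "t \<le> T"
  shows "solves t y"
proof -
  obtain C where C: "0 \<le> C" "\<And>s u. 0 \<le> s \<Longrightarrow> s \<le> u \<Longrightarrow> u \<le> t \<Longrightarrow> norm (y u - y s - H s u (y s)) \<le> C * (\<omega> u - \<omega> s) powr q"
    using assms unfolding rough_sol_def by blast
  have "\<exists>d>0. \<forall>s u. 0 \<le> s \<and> s \<le> u \<and> u \<le> t \<and> u - s < d \<longrightarrow> norm (y u - y s - H s u (y s)) \<le> \<eta> * (\<omega> u - \<omega> s)"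
    if \<eta>: "0 < \<eta>" for \<eta>
  proof -
    have "\<forall>\<^sub>F e in at_right 0. 0 < e \<and> C * e powr (q - 1) \<le> \<eta>"
      using q \<eta> by (intro eventually_conj eventually_mult_powr_le eventually_at_right_less) auto
    then obtain e where e: "0 < e" "C * e powr (q - 1) \<le> \<eta>"
      using eventually_happens trivial_limit_at_right_real by blast
    obtain d where d: "0 < d" "\<And>s u. 0 \<le> s \<Longrightarrow> s \<le> u \<Longrightarrow> u \<le> T \<Longrightarrow> u - s < d \<Longrightarrow> \<omega> u - \<omega> s < e"
      using \<omega>_uniform[OF e(1)] by blast
    have "norm (y u - y s - H s u (y s)) \<le> \<eta> * (\<omega> u - \<omega> s)" if su: "0 \<le> s" "s \<le> u" "u \<le> t" "u - s < d" for s u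
    proof -
      let ?w = "\<omega> u - \<omega> s"
      have w: "0 \<le> ?w" "?w < e" using \<omega>_le[of s u] d(2)[of s u] su assms by auto
      have "norm (y u - y s - H s u (y s)) \<le> C * ?w powr q" using C(2) su by simp
      also have "?w powr q = ?w powr (q - 1) * ?w" using w by (cases "?w = 0") (auto simp: powr_diff)
      also have "C * (?w powr (q - 1) * ?w) \<le> C * (e powr (q - 1) * ?w)"
        using w q C by (intro mult_left_mono mult_right_mono powr_mono2) auto
      also have "\<dots> \<le> \<eta> * ?w" using mult_right_mono[OF e(2) w(1)] by (simp add: mult.assoc)
      finally show ?thesis .
    qed
    then show ?thesis using d(1) by blast
  qed
  moreover have "mono_on {0..t} \<omega>" by (rule mono_on_subset[OF \<omega>_mono]) (use assms in auto)
  ultimately show ?thesis unfolding solves_def by blast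
qed

text \<open>Below the supremum of the solvable times, solutions on different intervals agree by
  \<open>solves_unique\<close> and so define one function. If the supremum is below \<open>T\<close>
  and the norm does not tend to infinity, the function visits one fixed ball at times arbitrarily
  close to the supremum; local existence over a length determined by that ball then reaches beyond
  it.\<close>

theorem maximal_rough_sol:
  "\<exists>\<tau> y. 0 < \<tau> \<and> \<tau> \<le> T \<and> y 0 = y0 \<and> (\<forall>t. 0 \<le> t \<and> t < \<tau> \<longrightarrow> rough_sol 0 t y) \<and>
     (\<tau> = T \<or> filterlim (\<lambda>t. norm (y t)) at_top (at_left \<tau>))"
proof -
  define D where "D = {t. 0 \<le> t \<and> t \<le> T \<and> (\<exists>y. y 0 = y0 \<and> rough_sol 0 t y)}"
  have "\<exists>b\<in>D. 0 < b"
  proof -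
    obtain \<delta> where \<delta>: "0 < \<delta>" "\<And>a b v. 0 \<le> a \<Longrightarrow> a \<le> b \<Longrightarrow> b \<le> T \<Longrightarrow> \<omega> b - \<omega> a \<le> \<delta> \<Longrightarrow> norm v \<le> norm y0 \<Longrightarrow>
      \<exists>y. y a = v \<and> rough_sol a b y" using local_existence[of "norm y0"] by blast
    obtain d where d: "0 < d" "\<And>s u. 0 \<le> s \<Longrightarrow> s \<le> u \<Longrightarrow> u \<le> T \<Longrightarrow> u - s < d \<Longrightarrow> \<omega> u - \<omega> s < \<delta>"
      using \<omega>_uniform[OF \<delta>(1)] by blast
    define b where "b = min T (d / 2)"
    have b: "0 < b" "b \<le> T" "b < d" using d T by (auto simp: b_def)
    have "\<omega> b - \<omega> 0 \<le> \<delta>" using d(2)[of 0 b] b by simp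
    then obtain y where "y 0 = y0" "rough_sol 0 b y" using \<delta>(2)[of 0 b y0] b by auto
    then have "b \<in> D" using b by (auto simp: D_def)
    then show ?thesis using b by blast
  qed
  then obtain b where b: "b \<in> D" "0 < b" by blast
  have bdd: "bdd_above D" by (rule bdd_aboveI[of _ T]) (auto simp: D_def)
  define \<tau> where "\<tau> = Sup D"
  have upper: "t \<le> \<tau>" if "t \<in> D" for t unfolding \<tau>_def using that bdd by (rule cSup_upper)
  have \<tau>: "0 < \<tau>" "\<tau> \<le> T"
  proof -
    show "0 < \<tau>" using upper[OF b(1)] b by simp
    show "\<tau> \<le> T" unfolding \<tau>_def by (rule cSup_least) (use b in \<open>auto simp: D_def\<close>)
  qed
  have D: "t \<in> D" if t: "0 \<le> t" "t < \<tau>" for t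
  proof -
    obtain t' where "t' \<in> D" "t < t'" using t less_cSupD[of D t] b unfolding \<tau>_def by blast
    then show ?thesis using t rough_sol_mono[of 0 t' _ t] by (auto simp: D_def)
  qed
  then have "\<forall>t. \<exists>y. 0 \<le> t \<and> t < \<tau> \<longrightarrow> y 0 = y0 \<and> rough_sol 0 t y" by (auto simp: D_def)
  then obtain yy where yy: "\<And>t. 0 \<le> t \<Longrightarrow> t < \<tau> \<Longrightarrow> yy t 0 = y0 \<and> rough_sol 0 t (yy t)" by metis
  define y where "y t = yy t t" for t
  have agree: "yy t s = y s" if "0 \<le> s" "s \<le> t" "t < \<tau>" for s t
    unfolding y_def
  proof (rule solves_unique[of s "yy t" "yy s" s])
    show "solves s (yy t)" "solves s (yy s)"
      using yy[of t] yy[of s] that \<tau> by (auto intro!: rough_sol_imp_solves rough_sol_mono[of 0 t "yy t" s])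
  qed (use that \<tau> yy[of t] yy[of s] in auto)
  have sol: "rough_sol 0 t y" if "0 \<le> t" "t < \<tau>" for t
    by (rule rough_sol_cong[of 0 t "yy t"]) (use yy agree that in auto)
  have y0: "y 0 = y0" using yy[of 0] \<tau> by (simp add: y_def)
  have "filterlim (\<lambda>t. norm (y t)) at_top (at_left \<tau>)" if "\<tau> \<noteq> T"
  proof (rule ccontr)
    assume "\<not> filterlim (\<lambda>t. norm (y t)) at_top (at_left \<tau>)"
    then obtain R where R: "\<not> (\<forall>\<^sub>F t in at_left \<tau>. R \<le> norm (y t))" unfolding filterlim_at_top by blast
    obtain \<delta> where \<delta>: "0 < \<delta>" "\<And>a b v. 0 \<le> a \<Longrightarrow> a \<le> b \<Longrightarrow> b \<le> T \<Longrightarrow> \<omega> b - \<omega> a \<le> \<delta> \<Longrightarrow> norm v \<le> R \<Longrightarrow>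
      \<exists>y. y a = v \<and> rough_sol a b y" using local_existence[of R] by blast
    obtain d where d: "0 < d" "\<And>s u. 0 \<le> s \<Longrightarrow> s \<le> u \<Longrightarrow> u \<le> T \<Longrightarrow> u - s < d \<Longrightarrow> \<omega> u - \<omega> s < \<delta>"
      using \<omega>_uniform[OF \<delta>(1)] by blast
    \<comment> \<open>The restart time \<open>s\<close> will lie less than d/2 before \<tau> and the
      target \<open>u\<close> at most d/2 after it, so the control over [s, u] is below
      \<delta>.\<close>
    have "max 0 (\<tau> - d / 2) < \<tau>" using d \<tau> by simp
    then obtain s where s: "max 0 (\<tau> - d / 2) < s" "s < \<tau>" "norm (y s) < R"
      using R unfolding eventually_at_left_field by (metis linorder_not_le)
    define u where "u = min T (\<tau> + d / 2)"
    have u: "\<tau> < u" "u \<le> T" "u - s < d" "s \<le> u" using \<tau> that d s by (auto simp: u_def)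
    obtain z where z: "z s = y s" "rough_sol s u z" using \<delta>(2)[of s u "y s"] d(2)[of s u] s u by auto
    have "rough_sol 0 u (\<lambda>t. if t \<le> s then y t else z t)"
      by (rule rough_sol_concat[OF sol[of s]]) (use s u z in auto)
    moreover have "(if 0 \<le> s then y 0 else z 0) = y0" using y0 s by simp
    ultimately have "u \<in> D" using u \<tau> unfolding D_def
      by (auto intro!: exI[of _ "\<lambda>t. if t \<le> s then y t else z t"])
    then show False using upper u by fastforce
  qed
  then show ?thesis using \<tau> y0 sol by blast
qed

end

section \<open>Four-point estimates and Taylor remainders\<close>

text \<open>A cover of \<open>S\<close> alone would treat only pairs in a common ball. A cover of S
  \<times> S treats all pairs: around diagonal points by the local estimate, elsewhere because the
  two points keep a positive distance while \<open>g\<close> is bounded near each of the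
  centres.\<close>

lemma locally_holder_compact:
  fixes g :: "'a::metric_space \<Rightarrow> real"
  assumes g: "locally_holder \<alpha> g" and S: "compact S" and \<alpha>: "0 < \<alpha>"
  shows "\<exists>C\<ge>0. \<forall>u\<in>S. \<forall>v\<in>S. \<bar>g u - g v\<bar> \<le> C * dist u v powr \<alpha>"
proof -
  have loc: "\<exists>e>0. \<exists>C\<ge>0. \<forall>u\<in>ball z e. \<forall>v\<in>ball z e. \<bar>g u - g v\<bar> \<le> C * dist u v powr \<alpha>" for z
  proof -
    obtain e C where e: "0 < e" "\<forall>u\<in>ball z e. \<forall>v\<in>ball z e. \<bar>g u - g v\<bar> \<le> C * dist u v powr \<alpha>"
      using g unfolding locally_holder_def by blast
    have "\<bar>g u - g v\<bar> \<le> max C 0 * dist u v powr \<alpha>" if "u \<in> ball z e" "v \<in> ball z e" for u v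
      using e(2) that order_trans[OF _ mult_right_mono[of C "max C 0" "dist u v powr \<alpha>"]] by simp
    then show ?thesis using e(1) by (metis max.cobounded2)
  qed
  have pair: "\<exists>e>0. \<exists>C\<ge>0. \<forall>u\<in>ball a e. \<forall>v\<in>ball b e. \<bar>g u - g v\<bar> \<le> C * dist u v powr \<alpha>" for a b
  proof (cases "a = b")
    case True then show ?thesis using loc by simp
  next
    case False
    obtain e1 C1 where 1: "0 < e1" "0 \<le> C1" "\<And>u v. u \<in> ball a e1 \<Longrightarrow> v \<in> ball a e1 \<Longrightarrow> \<bar>g u - g v\<bar> \<le> C1 * dist u v powr \<alpha>"
      using loc[of a] by blast
    obtain e2 C2 where 2: "0 < e2" "0 \<le> C2" "\<And>u v. u \<in> ball b e2 \<Longrightarrow> v \<in> ball b e2 \<Longrightarrow> \<bar>g u - g v\<bar> \<le> C2 * dist u v powr \<alpha>"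
      using loc[of b] by blast
    \<comment> \<open>With radii at most a quarter of the distance of the centres, points of the two
      balls are at least \<open>d\<close> apart.\<close>
    define d where "d = dist a b / 4"
    define e where "e = min d (min e1 e2)"
    have d: "0 < d" using False by (simp add: d_def)
    have e: "0 < e" "e \<le> d" "e \<le> e1" "e \<le> e2" using d 1 2 by (auto simp: e_def)
    define M where "M = C1 * e powr \<alpha> + \<bar>g a - g b\<bar> + C2 * e powr \<alpha>"
    have M: "0 \<le> M" using 1 2 by (simp add: M_def)
    have "\<bar>g u - g v\<bar> \<le> M / d powr \<alpha> * dist u v powr \<alpha>" if uv: "u \<in> ball a e" "v \<in> ball b e" for u v
    proof -
      have "\<bar>g u - g a\<bar> \<le> C1 * dist u a powr \<alpha>" using 1(3)[of u a] uv e 1 by auto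
      also have "\<dots> \<le> C1 * e powr \<alpha>" using uv \<alpha> 1 by (intro mult_left_mono powr_mono2) (auto simp: dist_commute)
      finally have i: "\<bar>g u - g a\<bar> \<le> C1 * e powr \<alpha>" .
      have "\<bar>g v - g b\<bar> \<le> C2 * dist v b powr \<alpha>" using 2(3)[of v b] uv e 2 by auto
      also have "\<dots> \<le> C2 * e powr \<alpha>" using uv \<alpha> 2 by (intro mult_left_mono powr_mono2) (auto simp: dist_commute)
      finally have ii: "\<bar>g v - g b\<bar> \<le> C2 * e powr \<alpha>" .
      have iii: "\<bar>g u - g v\<bar> \<le> M" using i ii by (simp add: M_def)
      have "dist a b \<le> dist a u + dist u v + dist v b"
        using dist_triangle[of a b u] dist_triangle[of u b v] by linarith
      then have "d \<le> dist u v" using uv e d by (auto simp: d_def dist_commute)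
      then have "d powr \<alpha> \<le> dist u v powr \<alpha>" using d \<alpha> by (intro powr_mono2) auto
      then have "M * 1 \<le> M * (dist u v powr \<alpha> / d powr \<alpha>)" using M d by (intro mult_left_mono) auto
      then show ?thesis using iii by simp
    qed
    then show ?thesis using e M by (intro exI[of _ e] conjI exI[of _ "M / d powr \<alpha>"]) auto
  qed
  then obtain e C where eC: "\<And>a b. 0 < e a b" "\<And>a b. 0 \<le> C a b"
    "\<And>a b u v. u \<in> ball a (e a b) \<Longrightarrow> v \<in> ball b (e a b) \<Longrightarrow> \<bar>g u - g v\<bar> \<le> C a b * dist u v powr \<alpha>"
    by metis
  have "compact (S \<times> S)" using S by (intro compact_Times)
  moreover have "\<And>z. z \<in> S \<times> S \<Longrightarrow> open (case z of (a, b) \<Rightarrow> ball a (e a b) \<times> ball b (e a b))"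
    by (auto intro: open_Times)
  moreover have "S \<times> S \<subseteq> (\<Union>z\<in>S \<times> S. case z of (a, b) \<Rightarrow> ball a (e a b) \<times> ball b (e a b))"
  proof
    fix z assume "z \<in> S \<times> S"
    then show "z \<in> (\<Union>z\<in>S \<times> S. case z of (a, b) \<Rightarrow> ball a (e a b) \<times> ball b (e a b))"
      using eC(1) by (intro UN_I[of z]) auto
  qed
  ultimately obtain D where D: "D \<subseteq> S \<times> S" "finite D" "S \<times> S \<subseteq> (\<Union>z\<in>D. case z of (a, b) \<Rightarrow> ball a (e a b) \<times> ball b (e a b))"
    by (rule compactE_image)
  define K where "K = (\<Sum>(a, b)\<in>D. C a b)"
  have "\<bar>g u - g v\<bar> \<le> K * dist u v powr \<alpha>" if "u \<in> S" "v \<in> S" for u v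
  proof -
    have "(u, v) \<in> S \<times> S" using that by simp
    then obtain z where "z \<in> D" "(u, v) \<in> (case z of (a, b) \<Rightarrow> ball a (e a b) \<times> ball b (e a b))" using D(3) by blast
    then obtain a b where ab: "(a, b) \<in> D" "u \<in> ball a (e a b)" "v \<in> ball b (e a b)" by (cases z) auto
    have "C a b \<le> K" unfolding K_def using D(2) ab(1) member_le_sum[of "(a, b)" D "\<lambda>(a, b). C a b"] eC(2) by auto
    then show ?thesis using eC(3)[OF ab(2,3)] order_trans mult_right_mono[of "C a b" K "dist u v powr \<alpha>"] by fastforce
  qed
  moreover have "0 \<le> K" unfolding K_def using eC(2) by (auto intro: sum_nonneg)
  ultimately show ?thesis by blast
qed

text \<open>The four-point estimate holds for functions whose gradient is \<open>\<beta>\<close>-Hoelder; unlike that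
  condition it is stable under products without any reference to derivatives.\<close>

definition four_point :: "real \<Rightarrow> real \<Rightarrow> real \<Rightarrow> ('a::real_normed_vector \<Rightarrow> real) \<Rightarrow> bool" where
  "four_point R \<beta> c g \<longleftrightarrow> 0 \<le> c \<and> (\<forall>u. norm u \<le> R \<longrightarrow> \<bar>g u\<bar> \<le> c) \<and>
     (\<forall>u v. norm u \<le> R \<and> norm v \<le> R \<longrightarrow> \<bar>g u - g v\<bar> \<le> c * norm (u - v)) \<and>
     (\<forall>u v u' v' \<rho>. norm u \<le> R \<and> norm v \<le> R \<and> norm u' \<le> R \<and> norm v' \<le> R \<and>
         norm (u - u') \<le> \<rho> \<and> norm (v - v') \<le> \<rho> \<longrightarrow>
       \<bar>(g u - g v) - (g u' - g v')\<bar> \<le> c * norm ((u - v) - (u' - v')) + c * \<rho> powr \<beta> * norm (u' - v'))"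

lemma four_pointD:
  assumes "four_point R \<beta> c g"
  shows "0 \<le> c" "\<And>u. norm u \<le> R \<Longrightarrow> \<bar>g u\<bar> \<le> c"
    "\<And>u v. norm u \<le> R \<Longrightarrow> norm v \<le> R \<Longrightarrow> \<bar>g u - g v\<bar> \<le> c * norm (u - v)"
    "\<And>u v u' v' \<rho>. norm u \<le> R \<Longrightarrow> norm v \<le> R \<Longrightarrow> norm u' \<le> R \<Longrightarrow> norm v' \<le> R \<Longrightarrow>
         norm (u - u') \<le> \<rho> \<Longrightarrow> norm (v - v') \<le> \<rho> \<Longrightarrow>
       \<bar>(g u - g v) - (g u' - g v')\<bar> \<le> c * norm ((u - v) - (u' - v')) + c * \<rho> powr \<beta> * norm (u' - v')"
  using assms unfolding four_point_def by simp_all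

lemma four_pointI:
  assumes "0 \<le> c" "\<And>u. norm u \<le> R \<Longrightarrow> \<bar>g u\<bar> \<le> c"
    "\<And>u v. norm u \<le> R \<Longrightarrow> norm v \<le> R \<Longrightarrow> \<bar>g u - g v\<bar> \<le> c * norm (u - v)"
    "\<And>u v u' v' \<rho>. norm u \<le> R \<Longrightarrow> norm v \<le> R \<Longrightarrow> norm u' \<le> R \<Longrightarrow> norm v' \<le> R \<Longrightarrow>
         norm (u - u') \<le> \<rho> \<Longrightarrow> norm (v - v') \<le> \<rho> \<Longrightarrow>
       \<bar>(g u - g v) - (g u' - g v')\<bar> \<le> c * norm ((u - v) - (u' - v')) + c * \<rho> powr \<beta> * norm (u' - v')"
  shows "four_point R \<beta> c g"
  using assms unfolding four_point_def by simp

lemma four_point_mono: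
  assumes g: "four_point R \<beta> c g" and c: "c \<le> c'"
  shows "four_point R \<beta> c' g"
proof (rule four_pointI)
  show "0 \<le> c'" using four_pointD(1)[OF g] c by simp
  show "\<bar>g u\<bar> \<le> c'" if "norm u \<le> R" for u using four_pointD(2)[OF g that] c by simp
  show "\<bar>g u - g v\<bar> \<le> c' * norm (u - v)" if "norm u \<le> R" "norm v \<le> R" for u v
    using four_pointD(3)[OF g that] mult_right_mono[OF c, of "norm (u - v)"] by simp
  show "\<bar>(g u - g v) - (g u' - g v')\<bar> \<le> c' * norm ((u - v) - (u' - v')) + c' * \<rho> powr \<beta> * norm (u' - v')"
    if "norm u \<le> R" "norm v \<le> R" "norm u' \<le> R" "norm v' \<le> R" "norm (u - u') \<le> \<rho>" "norm (v - v') \<le> \<rho>" for u v u' v' \<rho>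
    using four_pointD(4)[OF g that] mult_right_mono[OF c, of "norm ((u - v) - (u' - v'))"]
      mult_right_mono[OF mult_right_mono[OF c, of "\<rho> powr \<beta>"], of "norm (u' - v')"] by simp
qed

lemma four_point_uniform:
  fixes g :: "'i::finite \<Rightarrow> 'a::real_normed_vector \<Rightarrow> real"
  assumes "\<And>i. \<exists>c. four_point R \<beta> c (g i)"
  shows "\<exists>c. \<forall>i. four_point R \<beta> c (g i)"
proof -
  obtain c where c: "\<And>i. four_point R \<beta> (c i) (g i)" using assms by metis
  have "c i \<le> (\<Sum>i\<in>UNIV. c i)" for i using four_pointD(1)[OF c] by (intro member_le_sum) auto
  then show ?thesis using four_point_mono[OF c] by blast
qed

lemma sum_le_card:
  fixes f :: "'i::finite \<Rightarrow> real"
  assumes "\<And>i. \<bar>f i\<bar> \<le> B"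
  shows "\<bar>\<Sum>i\<in>UNIV. f i\<bar> \<le> real CARD('i) * B"
  using order_trans[OF sum_abs[of f UNIV] sum_bounded_above[of UNIV "\<lambda>i. \<bar>f i\<bar>" B]] assms by simp

text \<open>The constant is kept linear in \<open>l\<close>: the coefficients will be increments of
  \<open>x\<close> or of the area, whose size in the control must not be lost.\<close>

lemma four_point_linear_combination:
  fixes g :: "'i::finite \<Rightarrow> 'a::real_normed_vector \<Rightarrow> real"
  assumes g: "\<And>i. four_point R \<beta> c (g i)" and \<xi>: "\<And>i. \<bar>\<xi> i\<bar> \<le> l"
  shows "four_point R \<beta> (real CARD('i) * (c * l)) (\<lambda>v. \<Sum>i\<in>UNIV. g i v * \<xi> i)"
proof -
  have c: "0 \<le> c" using four_pointD(1)[OF g] .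
  have l: "0 \<le> l" using \<xi> abs_ge_zero order_trans by blast
  have bnd: "\<bar>\<Sum>i\<in>UNIV. h i * \<xi> i\<bar> \<le> real CARD('i) * (B * l)" if "\<And>i. \<bar>h i\<bar> \<le> B" for h B
    using that \<xi> order_trans[OF abs_ge_zero that] by (intro sum_le_card) (auto simp: abs_mult intro: mult_mono)
  show ?thesis
  proof (rule four_pointI)
    show "0 \<le> real CARD('i) * (c * l)" using c l by simp
    show "\<bar>\<Sum>i\<in>UNIV. g i u * \<xi> i\<bar> \<le> real CARD('i) * (c * l)" if "norm u \<le> R" for u
      by (rule bnd) (rule four_pointD(2)[OF g that])
    show "\<bar>(\<Sum>i\<in>UNIV. g i u * \<xi> i) - (\<Sum>i\<in>UNIV. g i v * \<xi> i)\<bar> \<le> real CARD('i) * (c * l) * norm (u - v)"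
      if "norm u \<le> R" "norm v \<le> R" for u v
      using bnd[OF four_pointD(3)[OF g that]] by (simp add: sum_subtractf[symmetric] algebra_simps)
    show "\<bar>((\<Sum>i\<in>UNIV. g i u * \<xi> i) - (\<Sum>i\<in>UNIV. g i v * \<xi> i)) - ((\<Sum>i\<in>UNIV. g i u' * \<xi> i) - (\<Sum>i\<in>UNIV. g i v' * \<xi> i))\<bar>
        \<le> real CARD('i) * (c * l) * norm ((u - v) - (u' - v')) + real CARD('i) * (c * l) * \<rho> powr \<beta> * norm (u' - v')"
      if "norm u \<le> R" "norm v \<le> R" "norm u' \<le> R" "norm v' \<le> R" "norm (u - u') \<le> \<rho>" "norm (v - v') \<le> \<rho>" for u v u' v' \<rho>
    proof -
      have "((\<Sum>i\<in>UNIV. g i u * \<xi> i) - (\<Sum>i\<in>UNIV. g i v * \<xi> i)) - ((\<Sum>i\<in>UNIV. g i u' * \<xi> i) - (\<Sum>i\<in>UNIV. g i v' * \<xi> i))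
        = (\<Sum>i\<in>UNIV. ((g i u - g i v) - (g i u' - g i v')) * \<xi> i)"
        by (simp add: sum_subtractf[symmetric] left_diff_distrib)
      then show ?thesis using bnd[OF four_pointD(4)[OF g that]] by (simp add: algebra_simps)
    qed
  qed
qed

lemma four_point_sum:
  fixes g :: "'i::finite \<Rightarrow> 'a::real_normed_vector \<Rightarrow> real"
  assumes "\<And>i. \<exists>c. four_point R \<beta> c (g i)"
  shows "\<exists>c. four_point R \<beta> c (\<lambda>v. \<Sum>i\<in>UNIV. g i v)"
proof -
  obtain c where "\<forall>i. four_point R \<beta> c (g i)" using four_point_uniform[of R \<beta> g, OF assms] by blast
  then show ?thesis using four_point_linear_combination[of R \<beta> c g "\<lambda>_. 1" 1] by auto
qed

text \<open>Interpolation, by splitting x into x^(1-\<beta>) x^\<beta>; it weakens a factor \<rho>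
  to \<rho>^\<beta> on a ball.\<close>

lemma le_powr_of_bounded:
  fixes x D \<rho> \<beta> :: real
  assumes "0 \<le> x" "x \<le> D" "x \<le> \<rho>" "0 < \<beta>" "\<beta> \<le> 1"
  shows "x \<le> D powr (1 - \<beta>) * \<rho> powr \<beta>"
proof (cases "x = 0")
  case False
  have "x = x powr (1 - \<beta>) * x powr \<beta>" using assms False by (simp flip: powr_add)
  also have "\<dots> \<le> D powr (1 - \<beta>) * \<rho> powr \<beta>" using assms by (intro mult_mono powr_mono2) auto
  finally show ?thesis .
qed auto

lemma four_point_weaken:
  assumes g: "four_point R 1 c g" and \<beta>: "0 < \<beta>" "\<beta> \<le> 1"
  shows "\<exists>c. four_point R \<beta> c g"
proof (intro exI four_pointI)
  define K where "K = (2 * R) powr (1 - \<beta>)"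
  have c: "0 \<le> c" using four_pointD(1)[OF g] .
  have K: "0 \<le> K" by (simp add: K_def)
  show "0 \<le> c * (1 + K)" using c K by simp
  have cc: "c \<le> c * (1 + K)" using mult_left_mono[of 1 "1 + K" c] c K by simp
  show "\<bar>g u\<bar> \<le> c * (1 + K)" if "norm u \<le> R" for u using four_pointD(2)[OF g that] cc by simp
  show "\<bar>g u - g v\<bar> \<le> c * (1 + K) * norm (u - v)" if "norm u \<le> R" "norm v \<le> R" for u v
    using order_trans[OF four_pointD(3)[OF g that] mult_right_mono[OF cc, of "norm (u - v)"]] by simp
  show "\<bar>(g u - g v) - (g u' - g v')\<bar> \<le> c * (1 + K) * norm ((u - v) - (u' - v')) + c * (1 + K) * \<rho> powr \<beta> * norm (u' - v')"
    if *: "norm u \<le> R" "norm v \<le> R" "norm u' \<le> R" "norm v' \<le> R" "norm (u - u') \<le> \<rho>" "norm (v - v') \<le> \<rho>" for u v u' v' \<rho>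
  proof -
    \<comment> \<open>\<rho> is only an upper bound and may exceed 2 R. The true distance \<sigma>
      does not, so the interpolation applies to it.\<close>
    define \<sigma> where "\<sigma> = max (norm (u - u')) (norm (v - v'))"
    have "\<sigma> \<le> 2 * R" using norm_triangle_ineq4[of u u'] norm_triangle_ineq4[of v v'] * by (auto simp: \<sigma>_def)
    moreover have "\<sigma> \<le> \<rho>" "0 \<le> \<sigma>" using * by (auto simp: \<sigma>_def max_def)
    ultimately have "\<sigma> \<le> K * \<rho> powr \<beta>" using \<beta> unfolding K_def by (intro le_powr_of_bounded) auto
    also have "\<dots> \<le> (1 + K) * \<rho> powr \<beta>" by (intro mult_right_mono) auto
    finally have "c * \<sigma> powr 1 * norm (u' - v') \<le> c * ((1 + K) * \<rho> powr \<beta>) * norm (u' - v')"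
      using c \<open>0 \<le> \<sigma>\<close> by (intro mult_right_mono mult_left_mono) auto
    moreover have "\<bar>(g u - g v) - (g u' - g v')\<bar> \<le> c * norm ((u - v) - (u' - v')) + c * \<sigma> powr 1 * norm (u' - v')"
      by (rule four_pointD(4)[OF g *(1-4)]) (auto simp: \<sigma>_def)
    moreover have "c * norm ((u - v) - (u' - v')) \<le> c * (1 + K) * norm ((u - v) - (u' - v'))"
      by (rule mult_right_mono[OF cc]) simp
    ultimately show ?thesis by (simp add: mult.assoc)
  qed
qed

lemma four_point_mult:
  assumes g: "four_point R \<beta> c g" and h: "four_point R \<beta> c h" and \<beta>: "0 < \<beta>" "\<beta> \<le> 1"
  shows "\<exists>c. four_point R \<beta> c (\<lambda>v. g v * h v)"
proof (intro exI four_pointI)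
  define K where "K = (2 * R) powr (1 - \<beta>)"
  define C where "C = 2 * c * c * (1 + K)"
  have c: "0 \<le> c" using four_pointD(1)[OF g] .
  have K: "0 \<le> K" by (simp add: K_def)
  show "0 \<le> C" using c K by (simp add: C_def)
  have C: "2 * (c * c) \<le> C" using mult_left_mono[of 1 "1 + K" "2 * (c * c)"] c K by (simp add: C_def)
  note bg = four_pointD(2)[OF g] and bh = four_pointD(2)[OF h]
  have ml: "\<bar>a * b\<bar> \<le> A * B" if "\<bar>a\<bar> \<le> A" "\<bar>b\<bar> \<le> B" for a b A B :: real
    using that by (auto simp: abs_mult intro!: mult_mono)
  show "\<bar>g u * h u\<bar> \<le> C" if "norm u \<le> R" for u
    using ml[OF bg[OF that] bh[OF that]] C c mult_nonneg_nonneg[OF c c] by linarith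
  show "\<bar>g u * h u - g v * h v\<bar> \<le> C * norm (u - v)" if uv: "norm u \<le> R" "norm v \<le> R" for u v
  proof -
    have "g u * h u - g v * h v = (g u - g v) * h u + g v * (h u - h v)" by (simp add: algebra_simps)
    moreover have "\<bar>(g u - g v) * h u\<bar> \<le> (c * norm (u - v)) * c" by (intro ml four_pointD(3)[OF g] bh uv)
    moreover have "\<bar>g v * (h u - h v)\<bar> \<le> c * (c * norm (u - v))" by (intro ml four_pointD(3)[OF h] bg uv)
    ultimately have "\<bar>g u * h u - g v * h v\<bar> \<le> (c * norm (u - v)) * c + c * (c * norm (u - v))" by linarith
    also have "\<dots> = 2 * (c * c) * norm (u - v)" by simp
    also have "\<dots> \<le> C * norm (u - v)" using C by (intro mult_right_mono) auto
    finally show ?thesis .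
  qed
  show "\<bar>(g u * h u - g v * h v) - (g u' * h u' - g v' * h v')\<bar> \<le> C * norm ((u - v) - (u' - v')) + C * \<rho> powr \<beta> * norm (u' - v')"
    if *: "norm u \<le> R" "norm v \<le> R" "norm u' \<le> R" "norm v' \<le> R" "norm (u - u') \<le> \<rho>" "norm (v - v') \<le> \<rho>" for u v u' v' \<rho>
  proof -
    let ?n = "norm ((u - v) - (u' - v'))" and ?d = "norm (u' - v')" and ?r = "\<rho> powr \<beta>"
    have "norm (u - u') \<le> 2 * R" using norm_triangle_ineq4[of u u'] * by auto
    then have "norm (u - u') \<le> K * ?r" using \<beta> * unfolding K_def by (intro le_powr_of_bounded) auto
    then have dh: "\<bar>h u - h u'\<bar> \<le> c * (K * ?r)"
      using order_trans[OF four_pointD(3)[OF h *(1,3)] mult_left_mono[OF _ c]] by blast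
    have "norm (v - v') \<le> 2 * R" using norm_triangle_ineq4[of v v'] * by auto
    then have "norm (v - v') \<le> K * ?r" using \<beta> * unfolding K_def by (intro le_powr_of_bounded) auto
    then have dg: "\<bar>g v - g v'\<bar> \<le> c * (K * ?r)"
      using order_trans[OF four_pointD(3)[OF g *(2,4)] mult_left_mono[OF _ c]] by blast
    \<comment> \<open>A Leibniz rule for the mixed difference. Two terms carry the four-point
      differences of the factors; in the cross terms one Lipschitz factor gives norm (u' - v') and
      the other a distance at most \<rho>, weakened to \<rho>^\<beta>.\<close>
    have e: "(g u * h u - g v * h v) - (g u' * h u' - g v' * h v') =
      ((g u - g v) - (g u' - g v')) * h u + (g u' - g v') * (h u - h u') +
      g v * ((h u - h v) - (h u' - h v')) + (g v - g v') * (h u' - h v')" by (simp add: algebra_simps)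
    have 1: "\<bar>((g u - g v) - (g u' - g v')) * h u\<bar> \<le> (c * ?n + c * ?r * ?d) * c"
      by (intro ml four_pointD(4)[OF g *] bh *)
    have 2: "\<bar>(g u' - g v') * (h u - h u')\<bar> \<le> (c * ?d) * (c * (K * ?r))"
      by (intro ml four_pointD(3)[OF g] dh *)
    have 3: "\<bar>g v * ((h u - h v) - (h u' - h v'))\<bar> \<le> c * (c * ?n + c * ?r * ?d)"
      by (intro ml four_pointD(4)[OF h *] bg *)
    have 4: "\<bar>(g v - g v') * (h u' - h v')\<bar> \<le> (c * (K * ?r)) * (c * ?d)"
      by (intro ml four_pointD(3)[OF h] dg *)
    have "\<bar>(g u * h u - g v * h v) - (g u' * h u' - g v' * h v')\<bar> \<le>
       (c * ?n + c * ?r * ?d) * c + (c * ?d) * (c * (K * ?r)) + c * (c * ?n + c * ?r * ?d) + (c * (K * ?r)) * (c * ?d)"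
      unfolding e using 1 2 3 4 by linarith
    also have "\<dots> = 2 * (c * c) * ?n + C * ?r * ?d" by (simp add: C_def algebra_simps)
    also have "\<dots> \<le> C * ?n + C * ?r * ?d" using C by (intro add_right_mono mult_right_mono) auto
    finally show ?thesis .
  qed
qed

section \<open>Mean value estimates along segments\<close>

lemma has_derivative_partial:
  fixes g :: "real^'n::finite \<Rightarrow> real"
  assumes "g differentiable (at z)"
  shows "(g has_derivative (\<lambda>v. \<Sum>h\<in>UNIV. v $ h * partial_deriv h g z)) (at z)"
proof -
  have d: "(g has_derivative frechet_derivative g (at z)) (at z)" using assms by (simp add: frechet_derivative_works)
  then have lin: "linear (frechet_derivative g (at z))" by (rule has_derivative_linear)
  have "frechet_derivative g (at z) v = (\<Sum>h\<in>UNIV. v $ h * partial_deriv h g z)" for v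
  proof -
    have "frechet_derivative g (at z) v = frechet_derivative g (at z) (\<Sum>h\<in>UNIV. v $ h *\<^sub>R axis h 1)"
      using basis_expansion[of v] by (simp add: scalar_mult_eq_scaleR)
    also have "\<dots> = (\<Sum>h\<in>UNIV. v $ h * partial_deriv h g z)"
      using lin by (simp add: linear_sum linear_scale partial_deriv_def)
    finally show ?thesis .
  qed
  then have "frechet_derivative g (at z) = (\<lambda>v. \<Sum>h\<in>UNIV. v $ h * partial_deriv h g z)" by blast
  then show ?thesis using d by simp
qed

lemma DERIV_along_line:
  fixes g :: "real^'n::finite \<Rightarrow> real"
  assumes "\<And>z. g differentiable (at z)"
  shows "((\<lambda>s. g (b + s *\<^sub>R e)) has_real_derivative (\<Sum>h\<in>UNIV. e $ h * partial_deriv h g (b + s *\<^sub>R e))) (at s)"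
proof -
  have "((\<lambda>s. b + s *\<^sub>R e) has_derivative (\<lambda>s. s *\<^sub>R e)) (at s)" by (auto intro!: derivative_eq_intros)
  from has_derivative_compose[OF this has_derivative_partial[OF assms]]
  have "((\<lambda>s. g (b + s *\<^sub>R e)) has_derivative (\<lambda>t. \<Sum>h\<in>UNIV. (t *\<^sub>R e) $ h * partial_deriv h g (b + s *\<^sub>R e))) (at s)" .
  then show ?thesis unfolding has_field_derivative_def
    by (rule has_derivative_eq_rhs) (simp add: fun_eq_iff sum_distrib_left ac_simps)
qed

lemma segment_in_ball:
  fixes a b :: "'a::real_normed_vector"
  assumes "norm b \<le> R" "norm (b + e) \<le> R" "0 \<le> s" "s \<le> 1"
  shows "norm (b + s *\<^sub>R e) \<le> R"
proof -
  have "b + s *\<^sub>R e = (1 - s) *\<^sub>R b + s *\<^sub>R (b + e)" by (simp add: algebra_simps)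
  then have "norm (b + s *\<^sub>R e) \<le> (1 - s) * norm b + s * norm (b + e)"
    using norm_triangle_ineq[of "(1 - s) *\<^sub>R b" "s *\<^sub>R (b + e)"] assms by simp
  also have "\<dots> \<le> (1 - s) * R + s * R" using assms by (intro add_mono mult_left_mono) auto
  finally show ?thesis by (simp add: algebra_simps)
qed

text \<open>The mean value theorem is applied once, to the difference of \<open>g\<close> along the
  two segments, so that both gradients are taken at the same parameter \<open>s\<close>; the two
  points at that parameter are within \<rho> of each other by convexity. Separate applications would
  give unrelated points.\<close>

lemma four_point_differentiable:
  fixes g :: "real^'n::finite \<Rightarrow> real"
  assumes d: "\<And>z. g differentiable (at z)" and \<beta>: "0 < \<beta>"
    and M: "\<And>h z. norm z \<le> R \<Longrightarrow> \<bar>partial_deriv h g z\<bar> \<le> M"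
    and C: "\<And>h u v. norm u \<le> R \<Longrightarrow> norm v \<le> R \<Longrightarrow>
      \<bar>partial_deriv h g u - partial_deriv h g v\<bar> \<le> C * norm (u - v) powr \<beta>"
    and MC: "0 \<le> M" "0 \<le> C" and R: "0 \<le> R"
  shows "\<exists>c. four_point R \<beta> c g"
proof -
  define n where "n = real CARD('n)"
  define c1 where "c1 = n * (M + C)"
  define c where "c = \<bar>g 0\<bar> + c1 * (1 + R)"
  have c1: "0 \<le> c1" using MC by (simp add: c1_def n_def)
  have four: "\<bar>(g u - g v) - (g u' - g v')\<bar> \<le> c1 * norm ((u - v) - (u' - v')) + c1 * \<rho> powr \<beta> * norm (u' - v')"
    if *: "norm u \<le> R" "norm v \<le> R" "norm u' \<le> R" "norm v' \<le> R" "norm (u - u') \<le> \<rho>" "norm (v - v') \<le> \<rho>" for u v u' v' \<rho>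
  proof -
    let ?a = "\<lambda>s. v + s *\<^sub>R (u - v)" and ?b = "\<lambda>s. v' + s *\<^sub>R (u' - v')"
    have \<rho>: "0 \<le> \<rho>" using * norm_ge_zero order_trans by blast
    have D: "((\<lambda>s. g (?a s) - g (?b s)) has_real_derivative
        (\<Sum>h\<in>UNIV. (u - v) $ h * partial_deriv h g (?a s)) - (\<Sum>h\<in>UNIV. (u' - v') $ h * partial_deriv h g (?b s))) (at s)" for s
      by (rule DERIV_diff[OF DERIV_along_line[OF d] DERIV_along_line[OF d]])
    obtain s where s: "0 < s" "s < 1" and eq: "(g (?a 1) - g (?b 1)) - (g (?a 0) - g (?b 0)) = (1 - 0) *
        ((\<Sum>h\<in>UNIV. (u - v) $ h * partial_deriv h g (?a s)) - (\<Sum>h\<in>UNIV. (u' - v') $ h * partial_deriv h g (?b s)))"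
      using MVT2[OF zero_less_one D] by blast
    have in_ball: "norm (?a s) \<le> R" "norm (?b s) \<le> R" using s * by (auto intro!: segment_in_ball)
    have "?a s - ?b s = (1 - s) *\<^sub>R (v - v') + s *\<^sub>R (u - u')" by (simp add: algebra_simps)
    then have "norm (?a s - ?b s) \<le> (1 - s) * norm (v - v') + s * norm (u - u')"
      using norm_triangle_ineq[of "(1 - s) *\<^sub>R (v - v')" "s *\<^sub>R (u - u')"] s by simp
    also have "\<dots> \<le> (1 - s) * \<rho> + s * \<rho>" using s * by (intro add_mono mult_left_mono) auto
    finally have dist: "norm (?a s - ?b s) \<le> \<rho>" by (simp add: algebra_simps)
    let ?w = "(u - v) - (u' - v')"
    have "\<bar>(g u - g v) - (g u' - g v')\<bar> = \<bar>\<Sum>h\<in>UNIV. ?w $ h * partial_deriv h g (?a s) +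
        (u' - v') $ h * (partial_deriv h g (?a s) - partial_deriv h g (?b s))\<bar>"
      using eq by (simp add: sum_subtractf[symmetric] algebra_simps)
    also have "\<dots> \<le> n * (norm ?w * M + norm (u' - v') * (C * \<rho> powr \<beta>))"
      unfolding n_def
    proof (rule sum_le_card)
      fix h
      have "\<bar>?w $ h * partial_deriv h g (?a s)\<bar> \<le> norm ?w * M"
        unfolding abs_mult using M[OF in_ball(1)] component_le_norm_cart[of ?w h] by (intro mult_mono) auto
      moreover have "\<bar>partial_deriv h g (?a s) - partial_deriv h g (?b s)\<bar> \<le> C * \<rho> powr \<beta>"
        using order_trans[OF C[OF in_ball] mult_left_mono[OF powr_mono2[OF _ _ dist] MC(2)]] \<beta> by simp
      then have "\<bar>(u' - v') $ h * (partial_deriv h g (?a s) - partial_deriv h g (?b s))\<bar> \<le> norm (u' - v') * (C * \<rho> powr \<beta>)"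
        unfolding abs_mult using component_le_norm_cart[of "u' - v'" h] by (intro mult_mono) auto
      ultimately show "\<bar>?w $ h * partial_deriv h g (?a s) + (u' - v') $ h * (partial_deriv h g (?a s) - partial_deriv h g (?b s))\<bar>
        \<le> norm ?w * M + norm (u' - v') * (C * \<rho> powr \<beta>)" by linarith
    qed
    also have "\<dots> \<le> n * (norm ?w * (M + C) + norm (u' - v') * ((M + C) * \<rho> powr \<beta>))"
      using MC by (intro mult_left_mono add_mono mult_right_mono) (auto simp: n_def)
    also have "\<dots> = c1 * norm ?w + c1 * \<rho> powr \<beta> * norm (u' - v')" by (simp add: c1_def algebra_simps)
    finally show ?thesis .
  qed
  \<comment> \<open>The Lipschitz bound is the case of a degenerate second pair u' = v' = v.\<close>
  have lip: "\<bar>g u - g v\<bar> \<le> c1 * norm (u - v)" if "norm u \<le> R" "norm v \<le> R" for u v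
    using four[of u v v v "norm (u - v)"] that by simp
  have c1c: "c1 \<le> c" using mult_left_mono[of 1 "1 + R" c1] c1 R by (simp add: c_def)
  have "four_point R \<beta> c g"
  proof (rule four_pointI)
    show "0 \<le> c" using c1 c1c by simp
    show "\<bar>g u\<bar> \<le> c" if "norm u \<le> R" for u
    proof -
      have "\<bar>g u - g 0\<bar> \<le> c1 * norm (u - 0)" using lip[of u 0] that R by simp
      also have "\<dots> \<le> c1 * (1 + R)" using that c1 by (intro mult_left_mono) auto
      finally show ?thesis by (simp add: c_def)
    qed
    show "\<bar>g u - g v\<bar> \<le> c * norm (u - v)" if "norm u \<le> R" "norm v \<le> R" for u v
      using order_trans[OF lip[OF that] mult_right_mono[OF c1c, of "norm (u - v)"]] by simp
    show "\<bar>(g u - g v) - (g u' - g v')\<bar> \<le> c * norm ((u - v) - (u' - v')) + c * \<rho> powr \<beta> * norm (u' - v')"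
      if "norm u \<le> R" "norm v \<le> R" "norm u' \<le> R" "norm v' \<le> R" "norm (u - u') \<le> \<rho>" "norm (v - v') \<le> \<rho>" for u v u' v' \<rho>
      using four[OF that] mult_right_mono[OF c1c, of "norm ((u - v) - (u' - v'))"]
        mult_right_mono[OF mult_right_mono[OF c1c, of "\<rho> powr \<beta>"], of "norm (u' - v')"] by simp
  qed
  then show ?thesis by blast
qed

definition taylor_remainder :: "(real^'n::finite \<Rightarrow> real) \<Rightarrow> real^'n \<Rightarrow> real^'n \<Rightarrow> real" where
  "taylor_remainder g v e = g (v + e) - g v - (\<Sum>h\<in>UNIV. e $ h * partial_deriv h g v)"

text \<open>Along each segment the linear term is subtracted, so the derivative of \<phi> contains
  gradient increments over a part of the step. Comparing these for the two segments, at one common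
  mean value parameter, is a four-point expression with \<rho> = \<mu>, whence \<mu>^\<beta> times
  norm (v - v'); the further factor \<mu> is the length of the step.\<close>

lemma taylor_remainder_lipschitz:
  fixes g :: "real^'n::finite \<Rightarrow> real"
  assumes d: "\<And>z. g differentiable (at z)" and fp: "\<And>h. four_point R \<beta> c (partial_deriv h g)"
    and b: "norm v \<le> R" "norm (v + e) \<le> R" "norm v' \<le> R" "norm (v' + e') \<le> R"
    and \<mu>: "norm e \<le> \<mu>" "norm e' \<le> \<mu>" and \<beta>: "0 < \<beta>"
  shows "\<bar>taylor_remainder g v e - taylor_remainder g v' e'\<bar> \<le>
    real CARD('n) * (c * (2 * \<mu> * norm (e - e') + \<mu> powr \<beta> * \<mu> * norm (v - v')))"
proof -
  have c: "0 \<le> c" using four_pointD(1)[OF fp] .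
  have \<mu>0: "0 \<le> \<mu>" using \<mu> norm_ge_zero order_trans by blast
  let ?S = "\<lambda>v e s. \<Sum>h\<in>UNIV. e $ h * partial_deriv h g (v + s *\<^sub>R e)"
  let ?L = "\<lambda>v e. \<Sum>h\<in>UNIV. e $ h * partial_deriv h g v"
  define \<phi> where "\<phi> v e s = g (v + s *\<^sub>R e) - s * ?L v e" for v e s
  have D: "((\<lambda>s. \<phi> v e s) has_real_derivative (?S v e s - ?L v e)) (at s)" for v e s
    unfolding \<phi>_def by (rule DERIV_diff[OF DERIV_along_line[OF d]]) (auto intro!: derivative_eq_intros)
  obtain s where s: "0 < s" "s < 1" and eq: "(\<phi> v e 1 - \<phi> v' e' 1) - (\<phi> v e 0 - \<phi> v' e' 0) =
      (1 - 0) * ((?S v e s - ?L v e) - (?S v' e' s - ?L v' e'))"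
    using MVT2[OF zero_less_one DERIV_diff[OF D[of v e] D[of v' e']]] by blast
  let ?a = "v + s *\<^sub>R e" and ?b = "v' + s *\<^sub>R e'"
  have in_ball: "norm ?a \<le> R" "norm ?b \<le> R" using s b by (auto intro!: segment_in_ball)
  have se: "norm (s *\<^sub>R e) \<le> \<mu>" "norm (s *\<^sub>R e') \<le> \<mu>"
    using s \<mu> mult_mono[of s 1 "norm e" \<mu>] mult_mono[of s 1 "norm e'" \<mu>] \<mu>0 by auto
  have "taylor_remainder g v e - taylor_remainder g v' e' = (\<phi> v e 1 - \<phi> v' e' 1) - (\<phi> v e 0 - \<phi> v' e' 0)"
    by (simp add: taylor_remainder_def \<phi>_def)
  also have "\<dots> = (\<Sum>h\<in>UNIV. e $ h * ((partial_deriv h g ?a - partial_deriv h g ?b) - (partial_deriv h g v - partial_deriv h g v')) +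
       (e - e') $ h * (partial_deriv h g ?b - partial_deriv h g v'))"
    unfolding eq by (simp add: sum_subtractf[symmetric] algebra_simps)
  also have "\<bar>\<dots>\<bar> \<le> real CARD('n) * (c * (2 * \<mu> * norm (e - e') + \<mu> powr \<beta> * \<mu> * norm (v - v')))"
  proof (rule sum_le_card)
    fix h
    have "\<bar>(partial_deriv h g ?a - partial_deriv h g ?b) - (partial_deriv h g v - partial_deriv h g v')\<bar>
       \<le> c * norm ((?a - ?b) - (v - v')) + c * \<mu> powr \<beta> * norm (v - v')"
      using se by (intro four_pointD(4)[OF fp] in_ball b) auto
    also have "(?a - ?b) - (v - v') = s *\<^sub>R (e - e')" by (simp add: algebra_simps)
    also have "c * norm (s *\<^sub>R (e - e')) \<le> c * norm (e - e')"
      using s c mult_right_mono[of s 1 "norm (e - e')"] by (intro mult_left_mono) auto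
    finally have 1: "\<bar>(partial_deriv h g ?a - partial_deriv h g ?b) - (partial_deriv h g v - partial_deriv h g v')\<bar>
       \<le> c * norm (e - e') + c * \<mu> powr \<beta> * norm (v - v')" by simp
    have 2: "\<bar>e $ h * ((partial_deriv h g ?a - partial_deriv h g ?b) - (partial_deriv h g v - partial_deriv h g v'))\<bar>
      \<le> \<mu> * (c * norm (e - e') + c * \<mu> powr \<beta> * norm (v - v'))"
      unfolding abs_mult using component_le_norm_cart[of e h] \<mu> \<mu>0 1 by (intro mult_mono) auto
    have "\<bar>partial_deriv h g ?b - partial_deriv h g v'\<bar> \<le> c * norm (?b - v')"
      by (intro four_pointD(3)[OF fp] in_ball b)
    also have "\<dots> \<le> c * \<mu>" using se c by (intro mult_left_mono) auto
    finally have 3: "\<bar>(e - e') $ h * (partial_deriv h g ?b - partial_deriv h g v')\<bar> \<le> norm (e - e') * (c * \<mu>)"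
      unfolding abs_mult using component_le_norm_cart[of "e - e'" h] by (intro mult_mono) auto
    show "\<bar>e $ h * ((partial_deriv h g ?a - partial_deriv h g ?b) - (partial_deriv h g v - partial_deriv h g v')) +
       (e - e') $ h * (partial_deriv h g ?b - partial_deriv h g v')\<bar> \<le> c * (2 * \<mu> * norm (e - e') + \<mu> powr \<beta> * \<mu> * norm (v - v'))"
      using abs_triangle_ineq[THEN order_trans, OF add_mono[OF 2 3]] by (simp add: algebra_simps)
  qed
  finally show ?thesis .
qed

text \<open>Comparison with the zero step from the same point, whose remainder vanishes.\<close>

lemma taylor_remainder_bound:
  fixes g :: "real^'n::finite \<Rightarrow> real"
  assumes d: "\<And>z. g differentiable (at z)" and fp: "\<And>h. four_point R \<beta> c (partial_deriv h g)"
    and b: "norm v \<le> R" "norm (v + e) \<le> R" and \<mu>: "norm e \<le> \<mu>" and \<beta>: "0 < \<beta>"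
  shows "\<bar>taylor_remainder g v e\<bar> \<le> real CARD('n) * (c * (2 * \<mu> * \<mu>))"
proof -
  have c: "0 \<le> c" using four_pointD(1)[OF fp] .
  have \<mu>0: "0 \<le> \<mu>" using \<mu> norm_ge_zero order_trans by blast
  have "taylor_remainder g v 0 = 0" by (simp add: taylor_remainder_def)
  then have "\<bar>taylor_remainder g v e\<bar> \<le> real CARD('n) * (c * (2 * \<mu> * norm e))"
    using taylor_remainder_lipschitz[OF d fp b(1,2) b(1) _ \<mu> _ \<beta>, of 0] b \<mu>0 by simp
  also have "\<dots> \<le> real CARD('n) * (c * (2 * \<mu> * \<mu>))" using \<mu> \<mu>0 c by (intro mult_left_mono) auto
  finally show ?thesis .
qed

section \<open>Bounds for the second-order increment\<close>

lemma holder_uniform_bound: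
  fixes g :: "real^'n::finite \<Rightarrow> real"
  assumes g: "locally_holder \<alpha> g" and \<alpha>: "0 < \<alpha>"
  shows "\<exists>C\<ge>0. (\<forall>u v. norm u \<le> R \<and> norm v \<le> R \<longrightarrow> \<bar>g u - g v\<bar> \<le> C * norm (u - v) powr \<alpha>) \<and>
    (\<forall>u. norm u \<le> R \<longrightarrow> \<bar>g u\<bar> \<le> C)"
proof -
  obtain C where C: "0 \<le> C" "\<And>u v. norm u \<le> R \<Longrightarrow> norm v \<le> R \<Longrightarrow> \<bar>g u - g v\<bar> \<le> C * norm (u - v) powr \<alpha>"
    using locally_holder_compact[OF g compact_cball \<alpha>, of 0 R] by (auto simp: dist_norm)
  define K where "K = C + C * R powr \<alpha> + \<bar>g 0\<bar>"
  have K: "C \<le> K" "0 \<le> K" using C(1) by (auto simp: K_def)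
  have "\<bar>g u - g v\<bar> \<le> K * norm (u - v) powr \<alpha>" if "norm u \<le> R" "norm v \<le> R" for u v
    using order_trans[OF C(2)[OF that] mult_right_mono[OF K(1)]] by simp
  moreover have "\<bar>g u\<bar> \<le> K" if u: "norm u \<le> R" for u
  proof -
    have "0 \<le> R" using u norm_ge_zero order_trans by blast
    then have "\<bar>g u - g 0\<bar> \<le> C * norm (u - 0) powr \<alpha>" using u by (intro C(2)) auto
    also have "\<dots> \<le> C * R powr \<alpha>" using u C(1) \<alpha> by (intro mult_left_mono powr_mono2) auto
    finally show ?thesis using C(1) by (simp add: K_def)
  qed
  ultimately show ?thesis using K(2) by blast
qed

lemma finite_uniform_bound:
  fixes P :: "'i::finite \<Rightarrow> real \<Rightarrow> bool"
  assumes "\<And>i. \<exists>c\<ge>0. P i c" and mono: "\<And>i c c'. P i c \<Longrightarrow> c \<le> c' \<Longrightarrow> P i c'"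
  shows "\<exists>c\<ge>0. \<forall>i. P i c"
proof -
  obtain c where c: "\<And>i. 0 \<le> c i" "\<And>i. P i (c i)" using assms(1) by metis
  have "c i \<le> (\<Sum>i\<in>UNIV. c i)" for i using c(1) by (intro member_le_sum) auto
  then show ?thesis using mono c by (meson sum_nonneg)
qed

lemma holder_smooth_four_point:
  fixes g :: "real^'n::finite \<Rightarrow> real"
  assumes d: "\<And>z. g differentiable (at z)" and g: "\<And>h. locally_holder \<beta> (partial_deriv h g)"
    and \<beta>: "0 < \<beta>" and R: "0 \<le> R"
  shows "\<exists>c. four_point R \<beta> c g"
proof -
  let ?P = "\<lambda>h C. (\<forall>u v. norm u \<le> R \<and> norm v \<le> R \<longrightarrow>
      \<bar>partial_deriv h g u - partial_deriv h g v\<bar> \<le> C * norm (u - v) powr \<beta>) \<and> (\<forall>u. norm u \<le> R \<longrightarrow> \<bar>partial_deriv h g u\<bar> \<le> C)"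
  have "\<exists>C\<ge>0. \<forall>h. ?P h C"
  proof (rule finite_uniform_bound)
    show "\<exists>C\<ge>0. ?P h C" for h by (rule holder_uniform_bound[OF g \<beta>])
    show "?P h C'" if "?P h C" "C \<le> C'" for h C C'
      using that order_trans[OF _ mult_right_mono[OF \<open>C \<le> C'\<close> powr_ge_zero]] by fastforce
  qed
  then obtain C where C: "0 \<le> C" "\<And>h u v. norm u \<le> R \<Longrightarrow> norm v \<le> R \<Longrightarrow> \<bar>partial_deriv h g u - partial_deriv h g v\<bar> \<le> C * norm (u - v) powr \<beta>"
    "\<And>h u. norm u \<le> R \<Longrightarrow> \<bar>partial_deriv h g u\<bar> \<le> C" by auto
  show ?thesis by (rule four_point_differentiable[OF d \<beta> C(3) C(2) C(1) C(1) R])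
qed

text \<open>One derivative makes the difference: the gradient of \<open>g\<close> is Lipschitz on
  balls, giving exponent 1, while the partial derivatives have only \<alpha>-Hoelder gradients. The
  area coefficients will inherit the weaker exponent.\<close>

lemma holder_smooth_2:
  fixes g :: "real^'n::finite \<Rightarrow> real"
  assumes g: "holder_smooth 2 \<alpha> g" and \<alpha>: "0 < \<alpha>" and R: "0 \<le> R"
  shows "g differentiable (at z)" "\<exists>c. four_point R 1 c g" "\<exists>c. four_point R \<alpha> c (partial_deriv h g)"
proof -
  have g': "\<And>z. g differentiable (at z)" "\<And>h z. partial_deriv h g differentiable (at z)"
    "\<And>h k. locally_holder \<alpha> (partial_deriv k (partial_deriv h g))"
    using g by (auto simp: numeral_2_eq_2)
  show "g differentiable (at z)" by (rule g')
  show fp: "\<exists>c. four_point R \<alpha> c (partial_deriv h g)" for h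
    by (rule holder_smooth_four_point[OF g'(2,3) \<alpha> R])
  obtain c where c: "\<And>h. four_point R \<alpha> c (partial_deriv h g)"
    using four_point_uniform[of R \<alpha> "\<lambda>h. partial_deriv h g", OF fp] by blast
  show "\<exists>c. four_point R 1 c g"
    by (rule four_point_differentiable[OF g'(1) zero_less_one four_pointD(2)[OF c] _ four_pointD(1)[OF c] four_pointD(1)[OF c] R])
      (use four_pointD(3)[OF c] in \<open>simp_all add: powr_one\<close>)
qed

lemma norm_le_card_mult:
  fixes w :: "real^'n::finite"
  assumes "\<And>i. \<bar>w $ i\<bar> \<le> B"
  shows "norm w \<le> real CARD('n) * B"
  using order_trans[OF norm_le_l1_cart sum_bounded_above[of UNIV "\<lambda>i. \<bar>w $ i\<bar>" B]] assms by simp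

section \<open>The step of the differential equation and its flow error\<close>

locale rough_equation =
  fixes f :: "'n::finite \<Rightarrow> 'd::finite \<Rightarrow> real^'n \<Rightarrow> real" and x :: "real \<Rightarrow> real^'d"
    and A :: "'d \<Rightarrow> 'd \<Rightarrow> real \<Rightarrow> real \<Rightarrow> real" and \<omega> :: "real \<Rightarrow> real" and T p \<alpha> :: real
  assumes p: "2 \<le> p" "p < 2 + \<alpha>" and \<alpha>: "0 < \<alpha>" "\<alpha> \<le> 1" and T: "0 < T"
    and x: "finite_p_variation_by \<omega> p T x" and A: "area_data \<omega> p T x A"
    and f: "\<And>i j. holder_smooth 2 \<alpha> (f i j)"
begin

definition H :: "real \<Rightarrow> real \<Rightarrow> real^'n \<Rightarrow> real^'n" where
  "H s t v = (\<chi> i. increment f x A s t v i)"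

text \<open>The derivative of \<open>f i j\<close> along the vector field with components
  \<open>f h r\<close>; this is the coefficient of the area \<open>A r j\<close>.\<close>

definition G :: "'n \<Rightarrow> 'd \<Rightarrow> 'd \<Rightarrow> real^'n \<Rightarrow> real" where
  "G i r j v = (\<Sum>h\<in>UNIV. f h r v * partial_deriv h (f i j) v)"

text \<open>The natural length of an interval: increments of \<open>x\<close> are of order
  \<open>lam\<close>, the area is of order \<open>lam\<close> squared, and the flow error will be of
  order \<open>lam\<close> to the power 2 + \<alpha>.\<close>

definition lam :: "real \<Rightarrow> real \<Rightarrow> real" where
  "lam s t = (\<omega> t - \<omega> s) powr (1/p)"

lemma f_differentiable: "f i j differentiable (at z)"
  using holder_smooth_2(1)[OF f \<alpha>(1) order_refl] .

lemma \<omega>_le: "0 \<le> s \<Longrightarrow> s \<le> t \<Longrightarrow> t \<le> T \<Longrightarrow> \<omega> s \<le> \<omega> t"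
  using x by (auto simp: finite_p_variation_by_def mono_on_def)

lemma lam_nonneg: "0 \<le> lam s t" by (simp add: lam_def)

lemma lam_powr: "lam s t powr e = (\<omega> t - \<omega> s) powr (e / p)"
  by (simp add: lam_def powr_powr)

lemma lam_sq: "(lam s t)\<^sup>2 = (\<omega> t - \<omega> s) powr (2 / p)"
  using lam_powr[of s t 2] lam_nonneg[of s t] by simp

lemma lam_mono:
  assumes "0 \<le> s'" "s' \<le> s" "s \<le> t" "t \<le> t'" "t' \<le> T"
  shows "lam s t \<le> lam s' t'"
  unfolding lam_def using \<omega>_le[of s' s] \<omega>_le[of s t] \<omega>_le[of t t'] assms p by (intro powr_mono2) auto

lemma le_lam:
  assumes "0 \<le> z" "z powr e \<le> \<omega> t - \<omega> s" "0 < e"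
  shows "z \<le> (\<omega> t - \<omega> s) powr (1 / e)"
proof -
  have "z = (z powr e) powr (1 / e)" using assms by (simp add: powr_powr)
  also have "\<dots> \<le> (\<omega> t - \<omega> s) powr (1 / e)" using assms by (intro powr_mono2) auto
  finally show ?thesis .
qed

lemma x_bound: assumes "0 \<le> s" "s \<le> t" "t \<le> T" shows "\<bar>x t $ j - x s $ j\<bar> \<le> lam s t"
proof -
  have "\<bar>x t $ j - x s $ j\<bar> \<le> norm (x t - x s)" using component_le_norm_cart[of "x t - x s" j] by simp
  also have "\<dots> \<le> lam s t" unfolding lam_def
    by (rule le_lam) (use x assms p in \<open>auto simp: finite_p_variation_by_def\<close>)
  finally show ?thesis .
qed

lemma A_bound: assumes "0 \<le> s" "s \<le> t" "t \<le> T" shows "\<bar>A r j s t\<bar> \<le> (lam s t)\<^sup>2"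
proof -
  have "\<bar>A r j s t\<bar> \<le> (\<omega> t - \<omega> s) powr (1 / (p / 2))"
    by (rule le_lam) (use A assms p in \<open>auto simp: area_data_def\<close>)
  then show ?thesis by (simp add: lam_sq)
qed

lemma H_component:
  "H s t v $ i = (\<Sum>j\<in>UNIV. f i j v * (x t $ j - x s $ j)) + (\<Sum>r\<in>UNIV. \<Sum>j\<in>UNIV. G i r j v * A r j s t)"
proof -
  have "(\<Sum>h\<in>UNIV. \<Sum>r\<in>UNIV. \<Sum>j\<in>UNIV. f h r v * partial_deriv h (f i j) v * A r j s t)
     = (\<Sum>r\<in>UNIV. \<Sum>h\<in>UNIV. \<Sum>j\<in>UNIV. f h r v * partial_deriv h (f i j) v * A r j s t)"
    by (rule sum.swap)
  also have "\<dots> = (\<Sum>r\<in>UNIV. \<Sum>j\<in>UNIV. \<Sum>h\<in>UNIV. f h r v * partial_deriv h (f i j) v * A r j s t)"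
    by (intro sum.cong refl sum.swap)
  finally show ?thesis by (simp add: H_def increment_def G_def sum_distrib_right)
qed

lemma coefficient_bounds:
  assumes R: "0 \<le> R"
  shows "\<exists>c. (\<forall>i j. four_point R 1 c (f i j)) \<and> (\<forall>h i j. four_point R \<alpha> c (partial_deriv h (f i j))) \<and>
     (\<forall>i r j. four_point R \<alpha> c (G i r j))"
proof -
  have fp1: "\<exists>c. four_point R 1 c (f i j)" for i j using holder_smooth_2(2)[OF f \<alpha>(1) R] .
  have fp\<alpha>: "\<exists>c. four_point R \<alpha> c (f i j)" for i j using fp1 four_point_weaken[OF _ \<alpha>] by blast
  have fpd: "\<exists>c. four_point R \<alpha> c (partial_deriv h (f i j))" for h i j using holder_smooth_2(3)[OF f \<alpha>(1) R] .
  have fpG: "\<exists>c. four_point R \<alpha> c (G i r j)" for i r j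
    unfolding G_def
  proof (rule four_point_sum)
    fix h
    obtain c1 c2 where "four_point R \<alpha> c1 (f h r)" "four_point R \<alpha> c2 (partial_deriv h (f i j))" using fp\<alpha> fpd by blast
    then have "four_point R \<alpha> (max c1 c2) (f h r)" "four_point R \<alpha> (max c1 c2) (partial_deriv h (f i j))"
      by (auto elim: four_point_mono)
    then show "\<exists>c. four_point R \<alpha> c (\<lambda>v. f h r v * partial_deriv h (f i j) v)" by (rule four_point_mult[OF _ _ \<alpha>])
  qed
  \<comment> \<open>Index tuples are uncurried into one finite index type, which yields a constant
    common to all of them.\<close>
  obtain c1 where c1: "\<And>k. four_point R 1 c1 ((\<lambda>(i, j). f i j) k)"
    using four_point_uniform[of R 1 "\<lambda>(i, j). f i j"] fp1 by fastforce
  obtain c2 where c2: "\<And>k. four_point R \<alpha> c2 ((\<lambda>(h, i, j). partial_deriv h (f i j)) k)"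
    using four_point_uniform[of R \<alpha> "\<lambda>(h, i, j). partial_deriv h (f i j)"] fpd by fastforce
  obtain c3 where c3: "\<And>k. four_point R \<alpha> c3 ((\<lambda>(i, r, j). G i r j) k)"
    using four_point_uniform[of R \<alpha> "\<lambda>(i, r, j). G i r j"] fpG by fastforce
  let ?c = "max c1 (max c2 c3)"
  have "four_point R 1 ?c (f i j)" for i j using four_point_mono[OF c1[of "(i, j)"], of ?c] by simp
  moreover have "four_point R \<alpha> ?c (partial_deriv h (f i j))" for h i j using four_point_mono[OF c2[of "(h, i, j)"], of ?c] by simp
  moreover have "four_point R \<alpha> ?c (G i r j)" for i r j using four_point_mono[OF c3[of "(i, r, j)"], of ?c] by simp
  ultimately show ?thesis by blast
qed

definition area_term :: "'n \<Rightarrow> real \<Rightarrow> real \<Rightarrow> real^'n \<Rightarrow> real" where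
  "area_term i s t v = (\<Sum>r\<in>UNIV. \<Sum>j\<in>UNIV. G i r j v * A r j s t)"

lemma area_term_four_point:
  assumes "\<And>i r j. four_point R \<alpha> c (G i r j)" "0 \<le> s" "s \<le> t" "t \<le> T" "lam s t \<le> m"
  shows "four_point R \<alpha> (real CARD('d) * (real CARD('d) * (c * m\<^sup>2))) (area_term i s t)"
proof -
  have "\<bar>A r j s t\<bar> \<le> m\<^sup>2" for r j
    using A_bound[OF assms(2-4), of r j] power_mono[OF assms(5) lam_nonneg, of 2] by linarith
  then have "four_point R \<alpha> (real CARD('d) * (c * m\<^sup>2)) (\<lambda>v. \<Sum>j\<in>UNIV. G i r j v * A r j s t)" for r
    by (intro four_point_linear_combination assms(1))
  from four_point_linear_combination[OF this, of "\<lambda>_. 1" 1] show ?thesis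
    by (simp add: area_term_def[abs_def])
qed

lemma drift_four_point:
  assumes "\<And>i j. four_point R 1 c (f i j)" "0 \<le> s" "s \<le> t" "t \<le> T" "lam s t \<le> m"
  shows "four_point R 1 (real CARD('d) * (c * m)) (\<lambda>v. \<Sum>j\<in>UNIV. f i j v * (x t $ j - x s $ j))"
  by (rule four_point_linear_combination[OF assms(1)]) (use x_bound[OF assms(2-4)] assms(5) order_trans in blast)

lemma H_eq: "H s t v $ i = (\<Sum>j\<in>UNIV. f i j v * (x t $ j - x s $ j)) + area_term i s t v"
  by (simp add: H_component area_term_def)

text \<open>The drift has size \<open>lam\<close> and exponent 1, the area term has size
  \<open>lam\<close> squared and exponent \<alpha>; these give the two summands with \<rho>. Where a
  bound of order \<open>lam\<close> is wanted, one factor \<open>lam\<close> of the area term is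
  estimated by \<open>lam 0 T\<close>, which enters \<open>K\<close>.\<close>

lemma H_bounds:
  assumes R: "0 \<le> R"
  shows "\<exists>C\<ge>0. \<forall>s t. 0 \<le> s \<and> s \<le> t \<and> t \<le> T \<longrightarrow>
       (\<forall>v. norm v \<le> R \<longrightarrow> norm (H s t v) \<le> C * lam s t) \<and>
       (\<forall>u v. norm u \<le> R \<and> norm v \<le> R \<longrightarrow> norm (H s t u - H s t v) \<le> C * lam s t * norm (u - v)) \<and>
       (\<forall>u v u' v' \<rho>. norm u \<le> R \<and> norm v \<le> R \<and> norm u' \<le> R \<and> norm v' \<le> R \<and>
            norm (u - u') \<le> \<rho> \<and> norm (v - v') \<le> \<rho> \<longrightarrow>
          norm ((H s t u - H s t v) - (H s t u' - H s t v')) \<le>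
            C * lam s t * norm ((u - v) - (u' - v')) + C * (lam s t * \<rho> + (lam s t)\<^sup>2 * \<rho> powr \<alpha>) * norm (u' - v'))"
proof -
  obtain c where c: "\<And>i j. four_point R 1 c (f i j)" "\<And>i r j. four_point R \<alpha> c (G i r j)"
    using coefficient_bounds[OF R] by blast
  have c0: "0 \<le> c" using four_pointD(1)[OF c(1)] .
  define d where "d = real CARD('d)"
  define K where "K = d * c + d * (d * c) * (lam 0 T + 1)"
  have d0: "0 \<le> d" by (simp add: d_def)
  have K: "0 \<le> K" "d * c \<le> K" "d * (d * c) \<le> K" "d * c + d * (d * c) * lam 0 T \<le> K"
    using c0 d0 lam_nonneg[of 0 T] by (auto simp: K_def algebra_simps)
  show ?thesis
  proof (intro exI[of _ "real CARD('n) * K"] conjI allI impI)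
    show "0 \<le> real CARD('n) * K" using K by simp
    fix s t assume "0 \<le> s \<and> s \<le> t \<and> t \<le> T"
    then have st: "0 \<le> s" "s \<le> t" "t \<le> T" by auto
    let ?l = "lam s t"
    have l: "0 \<le> ?l" "?l \<le> lam 0 T" using lam_nonneg lam_mono[of 0 s t T] st by auto
    note fp1 = drift_four_point[OF c(1) st order_refl, folded d_def]
    note fp2 = area_term_four_point[OF c(2) st order_refl, folded d_def]
    have sum_le: "d * (c * ?l) + d * (d * (c * ?l\<^sup>2)) \<le> K * ?l"
    proof -
      have "d * (c * ?l) + d * (d * (c * ?l\<^sup>2)) = (d * c + d * (d * c) * ?l) * ?l" by (simp add: algebra_simps power2_eq_square)
      also have "\<dots> \<le> (d * c + d * (d * c) * lam 0 T) * ?l" using l d0 c0 by (intro mult_right_mono add_left_mono mult_left_mono) auto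
      also have "\<dots> \<le> K * ?l" using K l by (intro mult_right_mono) auto
      finally show ?thesis .
    qed
    {
      fix v :: "real^'n" assume v: "norm v \<le> R"
      have "norm (H s t v) \<le> real CARD('n) * (K * ?l)"
      proof (rule norm_le_card_mult)
        show "\<bar>H s t v $ i\<bar> \<le> K * ?l" for i
          unfolding H_eq using four_pointD(2)[OF fp1 v, of i] four_pointD(2)[OF fp2 v, of i] sum_le by linarith
      qed
      then show "norm (H s t v) \<le> real CARD('n) * K * ?l" by simp
    next
      fix u v :: "real^'n" assume uv: "norm u \<le> R \<and> norm v \<le> R"
      have "norm (H s t u - H s t v) \<le> real CARD('n) * (K * ?l * norm (u - v))"
      proof (rule norm_le_card_mult)
        fix i
        have "\<bar>(H s t u - H s t v) $ i\<bar> \<le> (d * (c * ?l)) * norm (u - v) + (d * (d * (c * ?l\<^sup>2))) * norm (u - v)"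
          unfolding vector_minus_component H_eq
          using four_pointD(3)[OF fp1, of u v i] four_pointD(3)[OF fp2, of u v i] uv by linarith
        also have "\<dots> = (d * (c * ?l) + d * (d * (c * ?l\<^sup>2))) * norm (u - v)" by (simp add: algebra_simps)
        also have "\<dots> \<le> K * ?l * norm (u - v)" by (intro mult_right_mono sum_le) auto
        finally show "\<bar>(H s t u - H s t v) $ i\<bar> \<le> K * ?l * norm (u - v)" .
      qed
      then show "norm (H s t u - H s t v) \<le> real CARD('n) * K * ?l * norm (u - v)" by simp
    next
      fix u v u' v' :: "real^'n" and \<rho>
      assume *: "norm u \<le> R \<and> norm v \<le> R \<and> norm u' \<le> R \<and> norm v' \<le> R \<and> norm (u - u') \<le> \<rho> \<and> norm (v - v') \<le> \<rho>"
      have \<rho>: "0 \<le> \<rho>" using * norm_ge_zero order_trans by blast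
      let ?w = "norm ((u - v) - (u' - v'))" and ?z = "norm (u' - v')"
      have "norm ((H s t u - H s t v) - (H s t u' - H s t v')) \<le> real CARD('n) * (K * ?l * ?w + K * (?l * \<rho> + ?l\<^sup>2 * \<rho> powr \<alpha>) * ?z)"
      proof (rule norm_le_card_mult)
        fix i
        have 1: "\<bar>((H s t u - H s t v) - (H s t u' - H s t v')) $ i\<bar> \<le> (d * (c * ?l)) * ?w + (d * (c * ?l)) * \<rho> powr 1 * ?z
            + ((d * (d * (c * ?l\<^sup>2))) * ?w + (d * (d * (c * ?l\<^sup>2))) * \<rho> powr \<alpha> * ?z)"
          unfolding vector_minus_component H_eq
          using four_pointD(4)[OF fp1, of u v u' v' \<rho> i] four_pointD(4)[OF fp2, of u v u' v' \<rho> i] * by linarith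
        have 2: "(d * (c * ?l)) * ?w + (d * (d * (c * ?l\<^sup>2))) * ?w \<le> K * ?l * ?w"
          using mult_right_mono[OF sum_le, of ?w] by (simp add: algebra_simps)
        have 3: "(d * (c * ?l)) * \<rho> powr 1 * ?z \<le> K * (?l * \<rho> * ?z)"
          using mult_right_mono[OF K(2), of "?l * \<rho> * ?z"] l \<rho> by (simp add: algebra_simps)
        have 4: "(d * (d * (c * ?l\<^sup>2))) * \<rho> powr \<alpha> * ?z \<le> K * (?l\<^sup>2 * \<rho> powr \<alpha> * ?z)"
          using mult_right_mono[OF K(3), of "?l\<^sup>2 * \<rho> powr \<alpha> * ?z"] by (simp add: algebra_simps)
        show "\<bar>((H s t u - H s t v) - (H s t u' - H s t v')) $ i\<bar> \<le> K * ?l * ?w + K * (?l * \<rho> + ?l\<^sup>2 * \<rho> powr \<alpha>) * ?z"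
          using 1 2 3 4 by (simp add: distrib_left distrib_right mult.assoc)
      qed
      then show "norm ((H s t u - H s t v) - (H s t u' - H s t v')) \<le>
            real CARD('n) * K * ?l * ?w + real CARD('n) * K * (?l * \<rho> + ?l\<^sup>2 * \<rho> powr \<alpha>) * ?z"
        by (simp add: algebra_simps)
    }
  qed
qed

text \<open>The second-order term of the expansion of \<open>f i j\<close> along one step cancels the cross term in
  Chen's relation for \<open>A\<close>; what is left of it is \<open>level_one_error\<close>.\<close>

definition level_one_error :: "'n \<Rightarrow> 'd \<Rightarrow> real \<Rightarrow> real \<Rightarrow> real^'n \<Rightarrow> real" where
  "level_one_error i j s t v = taylor_remainder (f i j) v (H s t v) +
     (\<Sum>h\<in>UNIV. area_term h s t v * partial_deriv h (f i j) v)"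

text \<open>In the linear Taylor term the drift part of \<open>H\<close> reproduces \<open>G\<close>
  times the increment of \<open>x\<close>; its area part is of second order and counts as
  error.\<close>

lemma level_one_error_eq:
  "level_one_error i j s t v = f i j (v + H s t v) - f i j v - (\<Sum>r\<in>UNIV. G i r j v * (x t $ r - x s $ r))"
proof -
  have "(\<Sum>h\<in>UNIV. H s t v $ h * partial_deriv h (f i j) v) =
     (\<Sum>h\<in>UNIV. (\<Sum>r\<in>UNIV. f h r v * (x t $ r - x s $ r)) * partial_deriv h (f i j) v) +
     (\<Sum>h\<in>UNIV. area_term h s t v * partial_deriv h (f i j) v)"
    by (simp add: H_eq distrib_right sum.distrib)
  moreover have "(\<Sum>h\<in>UNIV. (\<Sum>r\<in>UNIV. f h r v * (x t $ r - x s $ r)) * partial_deriv h (f i j) v) =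
     (\<Sum>r\<in>UNIV. G i r j v * (x t $ r - x s $ r))"
    unfolding sum_distrib_right G_def by (subst sum.swap) (simp add: ac_simps)
  ultimately show ?thesis by (simp add: level_one_error_def taylor_remainder_def)
qed

text \<open>Two sources of error survive: a second-order error multiplied by an increment of
  \<open>x\<close>, and the change of the area coefficients along one step.\<close>

lemma H_defect:
  assumes "0 \<le> s" "s \<le> t" "t \<le> u" "u \<le> T"
  shows "(H t u (v + H s t v) + H s t v - H s u v) $ i =
    (\<Sum>j\<in>UNIV. level_one_error i j s t v * (x u $ j - x t $ j)) +
    (area_term i t u (v + H s t v) - area_term i t u v)"
proof -
  have A': "A r j s u = A r j s t + A r j t u + (x t $ r - x s $ r) * (x u $ j - x t $ j)" for r j
    using A assms unfolding area_data_def by blast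
  let ?w = "v + H s t v"
  have area: "area_term i s u v = area_term i s t v + area_term i t u v +
      (\<Sum>j\<in>UNIV. (\<Sum>r\<in>UNIV. G i r j v * (x t $ r - x s $ r)) * (x u $ j - x t $ j))"
  proof -
    have "(\<Sum>j\<in>UNIV. (\<Sum>r\<in>UNIV. G i r j v * (x t $ r - x s $ r)) * (x u $ j - x t $ j)) =
      (\<Sum>r\<in>UNIV. \<Sum>j\<in>UNIV. G i r j v * ((x t $ r - x s $ r) * (x u $ j - x t $ j)))"
      unfolding sum_distrib_right by (subst sum.swap) (simp add: mult.assoc)
    then show ?thesis by (simp add: area_term_def A' distrib_left sum.distrib)
  qed
  have "(H t u ?w + H s t v - H s u v) $ i =
    (\<Sum>j\<in>UNIV. f i j ?w * (x u $ j - x t $ j)) + (\<Sum>j\<in>UNIV. f i j v * (x t $ j - x s $ j)) - (\<Sum>j\<in>UNIV. f i j v * (x u $ j - x s $ j))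
     + area_term i t u ?w + area_term i s t v - area_term i s u v"
    by (simp add: H_eq)
  also have "\<dots> = (\<Sum>j\<in>UNIV. f i j ?w * (x u $ j - x t $ j) + f i j v * (x t $ j - x s $ j) - f i j v * (x u $ j - x s $ j)
     - (\<Sum>r\<in>UNIV. G i r j v * (x t $ r - x s $ r)) * (x u $ j - x t $ j)) + (area_term i t u ?w - area_term i t u v)"
    by (simp add: area sum.distrib sum_subtractf)
  also have "\<dots> = (\<Sum>j\<in>UNIV. level_one_error i j s t v * (x u $ j - x t $ j)) + (area_term i t u ?w - area_term i t u v)"
    unfolding level_one_error_eq by (simp add: algebra_simps)
  finally show ?thesis .
qed


text \<open>The size is that of a second-order remainder, but the dependence on \<open>v\<close>
  reaches only m^(1+\<alpha>), because the derivatives of \<open>f\<close> have \<alpha>-Hoelder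
  gradients. \<open>m\<close> stands for the scale of a surrounding interval. The bounds on
  \<open>H\<close> are premises because the caller derives them on a smaller ball than
  \<open>S\<close>.\<close>

lemma level_one_error_bounds:
  assumes c: "\<And>h i j. four_point S \<alpha> c (partial_deriv h (f i j))" "\<And>i r j. four_point S \<alpha> c (G i r j)"
    and C: "0 \<le> C"
  shows "\<exists>E\<ge>0. \<forall>i j s t m v v'. 0 \<le> s \<and> s \<le> t \<and> t \<le> T \<and> lam s t \<le> m \<and> m \<le> lam 0 T \<and>
      norm v \<le> S \<and> norm v' \<le> S \<and> norm (v + H s t v) \<le> S \<and> norm (v' + H s t v') \<le> S \<and>
      norm (H s t v) \<le> C * m \<and> norm (H s t v') \<le> C * m \<and> norm (H s t v - H s t v') \<le> C * m * norm (v - v') \<longrightarrow>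
      \<bar>level_one_error i j s t v\<bar> \<le> E * m\<^sup>2 \<and>
      \<bar>level_one_error i j s t v - level_one_error i j s t v'\<bar> \<le> E * (m powr (1 + \<alpha>) * norm (v - v'))"
proof -
  have c0: "0 \<le> c" using four_pointD(1)[OF c(1)] .
  define n where "n = real CARD('n)"
  define d where "d = real CARD('d)"
  \<comment> \<open>Trades m^2 for m^(1+\<alpha>), since m^(1-\<alpha>) \<le> L for m up to
    \<open>lam 0 T\<close>.\<close>
  define L where "L = lam 0 T powr (1 - \<alpha>)"
  define E where "E = n * (c * (2 * C * C)) + n * (d * (d * c) * c) +
    n * (c * (2 * C * C * L + C powr \<alpha> * C)) + 2 * n * (d * (d * c) * c) * L"
  have nn: "0 \<le> n" "0 \<le> d" "0 \<le> L" by (auto simp: n_def d_def L_def)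
  have E0: "0 \<le> E" using nn c0 C by (simp add: E_def)
  have E1: "n * (c * (2 * C * C)) + n * (d * (d * c) * c) \<le> E"
    "n * (c * (2 * C * C * L + C powr \<alpha> * C)) + 2 * n * (d * (d * c) * c) * L \<le> E"
    unfolding E_def using nn c0 C by simp_all
  have bounds: "\<bar>level_one_error i j s t v\<bar> \<le> E * m\<^sup>2 \<and>
      \<bar>level_one_error i j s t v - level_one_error i j s t v'\<bar> \<le> E * (m powr (1 + \<alpha>) * norm (v - v'))"
    if st: "0 \<le> s" "s \<le> t" "t \<le> T" and m: "lam s t \<le> m" "m \<le> lam 0 T"
      and v: "norm v \<le> S" "norm v' \<le> S" "norm (v + H s t v) \<le> S" "norm (v' + H s t v') \<le> S"
      and h: "norm (H s t v) \<le> C * m" "norm (H s t v') \<le> C * m" "norm (H s t v - H s t v') \<le> C * m * norm (v - v')"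
    for i j s t m v v'
  proof -
    let ?z = "norm (v - v')"
    have m0: "0 \<le> m" using m(1) lam_nonneg order_trans by blast
    note B = area_term_four_point[OF c(2) st m(1), folded d_def]
    have b0: "0 \<le> d * (d * (c * m\<^sup>2))" using nn c0 by simp
    let ?p = "\<lambda>h. partial_deriv h (f i j)"
    have ml: "\<bar>a * b\<bar> \<le> A * B" if "\<bar>a\<bar> \<le> A" "\<bar>b\<bar> \<le> B" for a b A B :: real
      using that by (auto simp: abs_mult intro!: mult_mono)
    have "\<bar>\<Sum>h\<in>UNIV. area_term h s t v * ?p h v\<bar> \<le> n * (d * (d * (c * m\<^sup>2)) * c)"
      unfolding n_def by (intro sum_le_card ml four_pointD(2)[OF B v(1)] four_pointD(2)[OF c(1) v(1)])
    moreover have "\<bar>taylor_remainder (f i j) v (H s t v)\<bar> \<le> n * (c * (2 * (C * m) * (C * m)))"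
      unfolding n_def by (rule taylor_remainder_bound[OF f_differentiable c(1) v(1,3) h(1) \<alpha>(1)])
    ultimately have "\<bar>level_one_error i j s t v\<bar> \<le> n * (c * (2 * (C * m) * (C * m))) + n * (d * (d * (c * m\<^sup>2)) * c)"
      unfolding level_one_error_def by linarith
    also have "\<dots> = (n * (c * (2 * C * C)) + n * (d * (d * c) * c)) * m\<^sup>2" by (simp add: algebra_simps power2_eq_square)
    also have "\<dots> \<le> E * m\<^sup>2" by (intro mult_right_mono E1) auto
    finally have 1: "\<bar>level_one_error i j s t v\<bar> \<le> E * m\<^sup>2" .
    have m2: "m\<^sup>2 \<le> L * m powr (1 + \<alpha>)"
    proof -
      have "m\<^sup>2 = m powr (1 - \<alpha>) * m powr (1 + \<alpha>)" using m0 by (simp flip: powr_add)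
      also have "\<dots> \<le> L * m powr (1 + \<alpha>)" unfolding L_def using m m0 \<alpha> by (intro mult_right_mono powr_mono2) auto
      finally show ?thesis .
    qed
    have ma: "m powr \<alpha> * m = m powr (1 + \<alpha>)" using m0 by (cases "m = 0") (auto simp: powr_add)
    have prod: "\<bar>area_term h s t v * ?p h v - area_term h s t v' * ?p h v'\<bar> \<le> 2 * (d * (d * (c * m\<^sup>2)) * c) * ?z" for h
    proof -
      have e: "area_term h s t v * ?p h v - area_term h s t v' * ?p h v' =
        (area_term h s t v - area_term h s t v') * ?p h v + area_term h s t v' * (?p h v - ?p h v')" by (simp add: algebra_simps)
      have "\<bar>(area_term h s t v - area_term h s t v') * ?p h v\<bar> \<le> (d * (d * (c * m\<^sup>2)) * ?z) * c"
        by (intro ml four_pointD(3)[OF B v(1,2)] four_pointD(2)[OF c(1) v(1)])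
      moreover have "\<bar>area_term h s t v' * (?p h v - ?p h v')\<bar> \<le> (d * (d * (c * m\<^sup>2))) * (c * ?z)"
        by (intro ml four_pointD(2)[OF B v(2)] four_pointD(3)[OF c(1) v(1,2)])
      ultimately have "\<bar>area_term h s t v * ?p h v - area_term h s t v' * ?p h v'\<bar>
         \<le> (d * (d * (c * m\<^sup>2)) * ?z) * c + (d * (d * (c * m\<^sup>2))) * (c * ?z)" unfolding e by linarith
      then show ?thesis by (simp add: algebra_simps)
    qed
    have i: "\<bar>(\<Sum>h\<in>UNIV. area_term h s t v * ?p h v) - (\<Sum>h\<in>UNIV. area_term h s t v' * ?p h v')\<bar> \<le> n * (2 * (d * (d * (c * m\<^sup>2)) * c) * ?z)"
      unfolding n_def sum_subtractf[symmetric] by (intro sum_le_card prod)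
    have "\<bar>taylor_remainder (f i j) v (H s t v) - taylor_remainder (f i j) v' (H s t v')\<bar> \<le>
       n * (c * (2 * (C * m) * norm (H s t v - H s t v') + (C * m) powr \<alpha> * (C * m) * ?z))"
      unfolding n_def by (rule taylor_remainder_lipschitz[OF f_differentiable c(1) v(1,3,2,4) h(1,2) \<alpha>(1)])
    also have "\<dots> \<le> n * (c * (2 * (C * m) * (C * m * ?z) + (C * m) powr \<alpha> * (C * m) * ?z))"
      using h(3) nn c0 C m0 by (intro mult_left_mono add_right_mono) auto
    also have "\<dots> = n * (c * (2 * C * C)) * (m\<^sup>2 * ?z) + n * (c * (C powr \<alpha> * C)) * (m powr \<alpha> * m * ?z)"
      using C m0 by (simp add: powr_mult algebra_simps power2_eq_square)
    finally have ii: "\<bar>taylor_remainder (f i j) v (H s t v) - taylor_remainder (f i j) v' (H s t v')\<bar> \<le>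
        n * (c * (2 * C * C)) * (m\<^sup>2 * ?z) + n * (c * (C powr \<alpha> * C)) * (m powr (1 + \<alpha>) * ?z)" unfolding ma .
    have mz: "m\<^sup>2 * ?z \<le> L * (m powr (1 + \<alpha>) * ?z)" using mult_right_mono[OF m2, of ?z] by (simp add: mult.assoc)
    have "\<bar>level_one_error i j s t v - level_one_error i j s t v'\<bar> \<le>
      (n * (c * (2 * C * C)) + n * (2 * (d * (d * c) * c))) * (m\<^sup>2 * ?z) + n * (c * (C powr \<alpha> * C)) * (m powr (1 + \<alpha>) * ?z)"
      unfolding level_one_error_def using i ii by (simp add: algebra_simps)
    also have "\<dots> \<le> (n * (c * (2 * C * C)) + n * (2 * (d * (d * c) * c))) * (L * (m powr (1 + \<alpha>) * ?z)) + n * (c * (C powr \<alpha> * C)) * (m powr (1 + \<alpha>) * ?z)"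
      using nn c0 C by (intro add_right_mono mult_left_mono mz) auto
    also have "\<dots> = (n * (c * (2 * C * C * L + C powr \<alpha> * C)) + 2 * n * (d * (d * c) * c) * L) * (m powr (1 + \<alpha>) * ?z)"
      by (simp add: algebra_simps)
    also have "\<dots> \<le> E * (m powr (1 + \<alpha>) * ?z)" by (intro mult_right_mono E1) auto
    finally show ?thesis using 1 by blast
  qed
  show ?thesis using E0 bounds by blast
qed

text \<open>A single defect is even of third order in \<open>lam\<close>. Its difference at two
  points is estimated only to order 2 + \<alpha>: the Taylor remainder loses there, and the
  four-point estimate of the area coefficients contributes \<rho>^\<alpha> with \<rho> the length of
  a step.\<close>

lemma H_defect_bounds:
  "\<exists>K\<ge>0. \<forall>s t u. 0 \<le> s \<and> s \<le> t \<and> t \<le> u \<and> u \<le> T \<longrightarrow>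
     (\<forall>v. norm v \<le> R \<longrightarrow> norm (H t u (v + H s t v) + H s t v - H s u v) \<le> K * lam s u powr (2 + \<alpha>)) \<and>
     (\<forall>v v'. norm v \<le> R \<and> norm v' \<le> R \<longrightarrow>
        norm ((H t u (v + H s t v) + H s t v - H s u v) - (H t u (v' + H s t v') + H s t v' - H s u v'))
          \<le> K * lam s u powr (2 + \<alpha>) * norm (v - v'))"
proof -
  obtain C where C: "0 \<le> C"
    "\<And>s t v. 0 \<le> s \<Longrightarrow> s \<le> t \<Longrightarrow> t \<le> T \<Longrightarrow> norm v \<le> \<bar>R\<bar> \<Longrightarrow> norm (H s t v) \<le> C * lam s t"
    "\<And>s t u v. 0 \<le> s \<Longrightarrow> s \<le> t \<Longrightarrow> t \<le> T \<Longrightarrow> norm u \<le> \<bar>R\<bar> \<Longrightarrow> norm v \<le> \<bar>R\<bar> \<Longrightarrow> norm (H s t u - H s t v) \<le> C * lam s t * norm (u - v)"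
    using H_bounds[of "\<bar>R\<bar>"] by (auto simp: all_conj_distrib imp_conjR)
  define S where "S = \<bar>R\<bar> + C * lam 0 T"
  have S: "0 \<le> S" using C lam_nonneg by (simp add: S_def)
  obtain c where c: "\<And>i j h. four_point S \<alpha> c (partial_deriv h (f i j))" "\<And>i r j. four_point S \<alpha> c (G i r j)"
    using coefficient_bounds[OF S] by blast
  have c0: "0 \<le> c" using four_pointD(1)[OF c(1)] .
  obtain E where E: "0 \<le> E" and E': "\<And>i j s t m v v'. 0 \<le> s \<Longrightarrow> s \<le> t \<Longrightarrow> t \<le> T \<Longrightarrow> lam s t \<le> m \<Longrightarrow> m \<le> lam 0 T \<Longrightarrow>
      norm v \<le> S \<Longrightarrow> norm v' \<le> S \<Longrightarrow> norm (v + H s t v) \<le> S \<Longrightarrow> norm (v' + H s t v') \<le> S \<Longrightarrow>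
      norm (H s t v) \<le> C * m \<Longrightarrow> norm (H s t v') \<le> C * m \<Longrightarrow> norm (H s t v - H s t v') \<le> C * m * norm (v - v') \<Longrightarrow>
      \<bar>level_one_error i j s t v\<bar> \<le> E * m\<^sup>2 \<and>
      \<bar>level_one_error i j s t v - level_one_error i j s t v'\<bar> \<le> E * (m powr (1 + \<alpha>) * norm (v - v'))"
    using level_one_error_bounds[OF c C(1)] by blast
  define n where "n = real CARD('n)"
  define d where "d = real CARD('d)"
  define L where "L = lam 0 T powr (1 - \<alpha>)"
  define K where "K = d * E + d * E * L + d * (d * c) * C * L + d * (d * c) * C powr \<alpha>"
  have nn: "0 \<le> n" "0 \<le> d" "0 \<le> L" by (auto simp: n_def d_def L_def)
  have K0: "0 \<le> K" using nn c0 C(1) E by (simp add: K_def)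
  have K1: "d * E * L + d * (d * c) * C * L \<le> K" "d * E + d * (d * c) * C * L + d * (d * c) * C powr \<alpha> \<le> K"
    unfolding K_def using nn c0 C(1) E by simp_all
  have main: "\<bar>(H t u (v + H s t v) + H s t v - H s u v) $ i\<bar> \<le> K * lam s u powr (2 + \<alpha>) \<and>
     \<bar>((H t u (v + H s t v) + H s t v - H s u v) - (H t u (v' + H s t v') + H s t v' - H s u v')) $ i\<bar>
          \<le> K * lam s u powr (2 + \<alpha>) * norm (v - v')"
    if stu: "0 \<le> s" "s \<le> t" "t \<le> u" "u \<le> T" and v: "norm v \<le> \<bar>R\<bar>" "norm v' \<le> \<bar>R\<bar>" for s t u v v' i
  proof -
    define m where "m = lam s u"
    let ?z = "norm (v - v')"
    have tT: "t \<le> T" "0 \<le> t" using stu by auto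
    have m: "0 \<le> m" "lam s t \<le> m" "lam t u \<le> m" "m \<le> lam 0 T"
      unfolding m_def using stu by (auto intro!: lam_mono lam_nonneg)
    have Cm: "C * lam s t \<le> C * m" "C * m \<le> C * lam 0 T" using m C(1) by (auto intro!: mult_left_mono)
    have h: "norm (H s t v) \<le> C * m" "norm (H s t v') \<le> C * m" "norm (H s t v - H s t v') \<le> C * m * ?z"
      using C(2)[OF stu(1,2) tT(1) v(1)] C(2)[OF stu(1,2) tT(1) v(2)] C(3)[OF stu(1,2) tT(1) v] Cm
        mult_right_mono[OF Cm(1), of ?z] by simp_all
    have vS: "norm v \<le> S" "norm v' \<le> S" "norm (v + H s t v) \<le> S" "norm (v' + H s t v') \<le> S"
      using v h Cm C(1) m norm_triangle_ineq[of v "H s t v"] norm_triangle_ineq[of v' "H s t v'"]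
        mult_nonneg_nonneg[OF C(1) m(1)] unfolding S_def by linarith+
    note e = E'[OF stu(1,2) tT(1) m(2,4) vS h]
    note B = area_term_four_point[OF c(2) tT(2) stu(3,4) m(3), folded d_def]
    have X: "\<bar>x u $ j - x t $ j\<bar> \<le> m" for j using x_bound[OF tT(2) stu(3,4), of j] m by linarith
    have ml: "\<bar>a * b\<bar> \<le> A * B" if "\<bar>a\<bar> \<le> A" "\<bar>b\<bar> \<le> B" for a b A B :: real
      using that by (auto simp: abs_mult intro!: mult_mono)
    have m3: "m ^ 3 \<le> L * m powr (2 + \<alpha>)"
    proof -
      have "m ^ 3 = m powr (1 - \<alpha>) * m powr (2 + \<alpha>)" using m by (simp flip: powr_add)
      also have "\<dots> \<le> L * m powr (2 + \<alpha>)" unfolding L_def using m \<alpha> by (intro mult_right_mono powr_mono2) auto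
      finally show ?thesis .
    qed
    have ma: "m powr (1 + \<alpha>) * m = m powr (2 + \<alpha>)" "m powr \<alpha> * m\<^sup>2 = m powr (2 + \<alpha>)"
      using m(1) by (cases "m = 0"; simp add: powr_add power2_eq_square)+
    have "\<bar>\<Sum>j\<in>UNIV. level_one_error i j s t v * (x u $ j - x t $ j)\<bar> \<le> d * (E * m\<^sup>2 * m)"
      unfolding d_def by (intro sum_le_card ml X conjunct1[OF e])
    moreover have "\<bar>area_term i t u (v + H s t v) - area_term i t u v\<bar> \<le> d * (d * (c * m\<^sup>2)) * (C * m)"
    proof -
      have "\<bar>area_term i t u (v + H s t v) - area_term i t u v\<bar> \<le> d * (d * (c * m\<^sup>2)) * norm (v + H s t v - v)"
        by (rule four_pointD(3)[OF B vS(3,1)])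
      also have "\<dots> \<le> d * (d * (c * m\<^sup>2)) * (C * m)" using h nn c0 by (intro mult_left_mono) auto
      finally show ?thesis .
    qed
    ultimately have "\<bar>(H t u (v + H s t v) + H s t v - H s u v) $ i\<bar> \<le> d * (E * m\<^sup>2 * m) + d * (d * (c * m\<^sup>2)) * (C * m)"
      unfolding H_defect[OF stu] by linarith
    also have "\<dots> = (d * E + d * (d * c) * C) * m ^ 3" by (simp add: algebra_simps power2_eq_square power3_eq_cube)
    also have "\<dots> \<le> (d * E + d * (d * c) * C) * (L * m powr (2 + \<alpha>))" using nn c0 C(1) E by (intro mult_left_mono m3) auto
    also have "\<dots> = (d * E * L + d * (d * c) * C * L) * m powr (2 + \<alpha>)" by (simp add: algebra_simps)
    also have "\<dots> \<le> K * m powr (2 + \<alpha>)" by (intro mult_right_mono K1) auto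
    finally have 1: "\<bar>(H t u (v + H s t v) + H s t v - H s u v) $ i\<bar> \<le> K * m powr (2 + \<alpha>)" .
    have "\<bar>\<Sum>j\<in>UNIV. (level_one_error i j s t v - level_one_error i j s t v') * (x u $ j - x t $ j)\<bar>
       \<le> d * (E * (m powr (1 + \<alpha>) * ?z) * m)"
      unfolding d_def by (intro sum_le_card ml X conjunct2[OF e])
    also have "\<dots> = d * E * (m powr (2 + \<alpha>) * ?z)" by (simp add: ma(1)[symmetric])
    finally have i: "\<bar>(\<Sum>j\<in>UNIV. level_one_error i j s t v * (x u $ j - x t $ j)) - (\<Sum>j\<in>UNIV. level_one_error i j s t v' * (x u $ j - x t $ j))\<bar>
       \<le> d * E * (m powr (2 + \<alpha>) * ?z)" by (simp add: left_diff_distrib sum_subtractf)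
    let ?a = "area_term i t u"
    have "\<bar>(?a (v + H s t v) - ?a (v' + H s t v')) - (?a v - ?a v')\<bar> \<le>
      d * (d * (c * m\<^sup>2)) * norm ((v + H s t v - (v' + H s t v')) - (v - v')) + d * (d * (c * m\<^sup>2)) * (C * m) powr \<alpha> * ?z"
      by (rule four_pointD(4)[OF B vS(3,4,1,2)]) (use h in auto)
    also have "(v + H s t v - (v' + H s t v')) - (v - v') = H s t v - H s t v'" by simp
    also have "d * (d * (c * m\<^sup>2)) * norm (H s t v - H s t v') + d * (d * (c * m\<^sup>2)) * (C * m) powr \<alpha> * ?z \<le>
       d * (d * (c * m\<^sup>2)) * (C * m * ?z) + d * (d * (c * m\<^sup>2)) * (C * m) powr \<alpha> * ?z"
      using h nn c0 by (intro add_right_mono mult_left_mono) auto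
    also have "\<dots> = d * (d * c) * C * (m ^ 3 * ?z) + d * (d * c) * C powr \<alpha> * (m powr \<alpha> * m\<^sup>2 * ?z)"
      using m C(1) by (simp add: powr_mult algebra_simps power2_eq_square power3_eq_cube)
    also have "\<dots> \<le> d * (d * c) * C * (L * m powr (2 + \<alpha>) * ?z) + d * (d * c) * C powr \<alpha> * (m powr \<alpha> * m\<^sup>2 * ?z)"
      using nn c0 C(1) by (intro add_right_mono mult_left_mono mult_right_mono m3) auto
    finally have ii: "\<bar>(?a (v + H s t v) - ?a (v' + H s t v')) - (?a v - ?a v')\<bar> \<le>
       d * (d * c) * C * (L * m powr (2 + \<alpha>) * ?z) + d * (d * c) * C powr \<alpha> * (m powr (2 + \<alpha>) * ?z)" unfolding ma .
    have "\<bar>((H t u (v + H s t v) + H s t v - H s u v) - (H t u (v' + H s t v') + H s t v' - H s u v')) $ i\<bar> \<le>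
       d * E * (m powr (2 + \<alpha>) * ?z) + (d * (d * c) * C * (L * m powr (2 + \<alpha>) * ?z) + d * (d * c) * C powr \<alpha> * (m powr (2 + \<alpha>) * ?z))"
      unfolding vector_minus_component[of "H t u (v + H s t v) + H s t v - H s u v"] H_defect[OF stu] using i ii by linarith
    also have "\<dots> = (d * E + d * (d * c) * C * L + d * (d * c) * C powr \<alpha>) * (m powr (2 + \<alpha>) * ?z)" by (simp add: algebra_simps)
    also have "\<dots> \<le> K * (m powr (2 + \<alpha>) * ?z)" by (intro mult_right_mono K1) auto
    finally show ?thesis using 1 by (simp add: m_def mult.assoc)
  qed
  show ?thesis
  proof (intro exI[of _ "n * K"] conjI allI impI)
    show "0 \<le> n * K" using nn K0 by simp
    fix s t u assume stu: "0 \<le> s \<and> s \<le> t \<and> t \<le> u \<and> u \<le> T"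
    have R: "norm v \<le> \<bar>R\<bar>" if "norm v \<le> R" for v :: "real^'n" using that by linarith
    show "norm (H t u (v + H s t v) + H s t v - H s u v) \<le> n * K * lam s u powr (2 + \<alpha>)" if "norm v \<le> R" for v
      using norm_le_card_mult[OF conjunct1[OF main, of s t u v v], folded n_def] stu R that by (simp add: mult.assoc)
    show "norm ((H t u (v + H s t v) + H s t v - H s u v) - (H t u (v' + H s t v') + H s t v' - H s u v'))
          \<le> n * K * lam s u powr (2 + \<alpha>) * norm (v - v')" if "norm v \<le> R \<and> norm v' \<le> R" for v v'
      using norm_le_card_mult[OF conjunct2[OF main, of s t u v v'], folded n_def] stu R that by (simp add: mult.assoc)
  qed
qed

end

section \<open>Translation between the equation and the abstract scheme\<close>

context rough_equation begin

lemma \<omega>: "mono_on {0..T} \<omega>" "continuous_on {0..T} \<omega>"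
  using x by (auto simp: finite_p_variation_by_def)

lemma scheme_bounds_H: "\<exists>c. scheme_bounds H \<omega> T p \<alpha> R c"
proof -
  \<comment> \<open>The estimates for \<open>H\<close> are stated on balls of nonnegative radius,
    hence |R|; for negative \<open>R\<close> the bounds at radius \<open>R\<close> are
    vacuous.\<close>
  obtain C where C: "0 \<le> C"
    "\<And>s t v. 0 \<le> s \<Longrightarrow> s \<le> t \<Longrightarrow> t \<le> T \<Longrightarrow> norm v \<le> \<bar>R\<bar> \<Longrightarrow> norm (H s t v) \<le> C * lam s t"
    "\<And>s t u v. 0 \<le> s \<Longrightarrow> s \<le> t \<Longrightarrow> t \<le> T \<Longrightarrow> norm u \<le> \<bar>R\<bar> \<Longrightarrow> norm v \<le> \<bar>R\<bar> \<Longrightarrow> norm (H s t u - H s t v) \<le> C * lam s t * norm (u - v)"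
    "\<And>s t u v u' v' \<rho>. 0 \<le> s \<Longrightarrow> s \<le> t \<Longrightarrow> t \<le> T \<Longrightarrow> norm u \<le> \<bar>R\<bar> \<Longrightarrow> norm v \<le> \<bar>R\<bar> \<Longrightarrow> norm u' \<le> \<bar>R\<bar> \<Longrightarrow> norm v' \<le> \<bar>R\<bar> \<Longrightarrow>
       norm (u - u') \<le> \<rho> \<Longrightarrow> norm (v - v') \<le> \<rho> \<Longrightarrow>
       norm ((H s t u - H s t v) - (H s t u' - H s t v')) \<le>
            C * lam s t * norm ((u - v) - (u' - v')) + C * (lam s t * \<rho> + (lam s t)\<^sup>2 * \<rho> powr \<alpha>) * norm (u' - v')"
    using H_bounds[of "\<bar>R\<bar>"] by auto
  obtain K where K: "0 \<le> K"
    "\<And>s t u v. 0 \<le> s \<Longrightarrow> s \<le> t \<Longrightarrow> t \<le> u \<Longrightarrow> u \<le> T \<Longrightarrow> norm v \<le> R \<Longrightarrow>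
       norm (H t u (v + H s t v) + H s t v - H s u v) \<le> K * lam s u powr (2 + \<alpha>)"
    "\<And>s t u v v'. 0 \<le> s \<Longrightarrow> s \<le> t \<Longrightarrow> t \<le> u \<Longrightarrow> u \<le> T \<Longrightarrow> norm v \<le> R \<Longrightarrow> norm v' \<le> R \<Longrightarrow>
        norm ((H t u (v + H s t v) + H s t v - H s u v) - (H t u (v' + H s t v') + H s t v' - H s u v'))
          \<le> K * lam s u powr (2 + \<alpha>) * norm (v - v')"
    using H_defect_bounds[of R] by auto
  have R: "norm v \<le> \<bar>R\<bar>" if "norm v \<le> R" for v :: "real^'n" using that by linarith
  define M where "M = max C K"
  have M: "0 \<le> M" "C \<le> M" "K \<le> M" using C(1) by (auto simp: M_def)
  have up: "z \<le> M * y" if "z \<le> C * y \<or> z \<le> K * y" "0 \<le> y" for z y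
    using that M mult_right_mono[OF M(2), of y] mult_right_mono[OF M(3), of y] by linarith
  have "scheme_bounds H \<omega> T p \<alpha> R M"
    unfolding scheme_bounds_def lam_def[symmetric] lam_sq[symmetric] lam_powr[where e = "2 + \<alpha>", symmetric]
  proof (intro conjI allI impI)
    fix s t assume "0 \<le> s \<and> s \<le> t \<and> t \<le> T"
    then have st: "0 \<le> s" "s \<le> t" "t \<le> T" by auto
    {
      fix v :: "real^'n" assume "norm v \<le> R"
      then show "norm (H s t v) \<le> M * lam s t" using C(2)[OF st R] up lam_nonneg by blast
    next
      fix u v :: "real^'n" assume "norm u \<le> R \<and> norm v \<le> R"
      then have "norm (H s t u - H s t v) \<le> C * (lam s t * norm (u - v))" using C(3)[OF st R R] by (simp add: mult.assoc)
      then show "norm (H s t u - H s t v) \<le> M * lam s t * norm (u - v)"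
        using up[of "norm (H s t u - H s t v)" "lam s t * norm (u - v)"] lam_nonneg by (simp add: mult.assoc)
    next
      fix u v u' v' :: "real^'n" and \<rho>
      assume *: "norm u \<le> R \<and> norm v \<le> R \<and> norm u' \<le> R \<and> norm v' \<le> R \<and> norm (u - u') \<le> \<rho> \<and> norm (v - v') \<le> \<rho>"
      then have \<rho>: "0 \<le> \<rho>" using norm_ge_zero order_trans by blast
      let ?Y = "lam s t * norm ((u - v) - (u' - v')) + (lam s t * \<rho> + (lam s t)\<^sup>2 * \<rho> powr \<alpha>) * norm (u' - v')"
      have "norm ((H s t u - H s t v) - (H s t u' - H s t v')) \<le>
            C * lam s t * norm ((u - v) - (u' - v')) + C * (lam s t * \<rho> + (lam s t)\<^sup>2 * \<rho> powr \<alpha>) * norm (u' - v')"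
        by (rule C(4)[OF st R R R R]) (use * in auto)
      then have "norm ((H s t u - H s t v) - (H s t u' - H s t v')) \<le> C * ?Y" by (simp add: algebra_simps)
      then have "norm ((H s t u - H s t v) - (H s t u' - H s t v')) \<le> M * ?Y"
        using lam_nonneg \<rho> by (intro up disjI1) auto
      then show "norm ((H s t u - H s t v) - (H s t u' - H s t v')) \<le>
            M * lam s t * norm ((u - v) - (u' - v')) + M * (lam s t * \<rho> + (lam s t)\<^sup>2 * \<rho> powr \<alpha>) * norm (u' - v')"
        by (simp add: algebra_simps)
    }
  next
    fix s t u assume "0 \<le> s \<and> s \<le> t \<and> t \<le> u \<and> u \<le> T"
    then have st: "0 \<le> s" "s \<le> t" "t \<le> u" "u \<le> T" by auto
    {
      fix v :: "real^'n" assume "norm v \<le> R"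
      then show "norm (H t u (v + H s t v) + H s t v - H s u v) \<le> M * lam s u powr (2 + \<alpha>)"
        using K(2)[OF st] up powr_ge_zero by blast
    next
      fix v v' :: "real^'n" assume "norm v \<le> R \<and> norm v' \<le> R"
      then have "norm ((H t u (v + H s t v) + H s t v - H s u v) - (H t u (v' + H s t v') + H s t v' - H s u v'))
          \<le> K * (lam s u powr (2 + \<alpha>) * norm (v - v'))" using K(3)[OF st] by (simp add: mult.assoc)
      then have "norm ((H t u (v + H s t v) + H s t v - H s u v) - (H t u (v' + H s t v') + H s t v' - H s u v'))
          \<le> M * (lam s u powr (2 + \<alpha>) * norm (v - v'))" by (intro up disjI2) auto
      then show "norm ((H t u (v + H s t v) + H s t v - H s u v) - (H t u (v' + H s t v') + H s t v' - H s u v'))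
          \<le> M * lam s u powr (2 + \<alpha>) * norm (v - v')" by (simp add: mult.assoc)
    }
  qed (use M in auto)
  then show ?thesis by blast
qed

sublocale rough_scheme H \<omega> T p \<alpha>
  by unfold_locales (use p \<alpha> T \<omega> scheme_bounds_H in auto)

text \<open>The o(\<delta>) condition gives \<theta>(w) \<le> (\<eta>/n) w for small w, and uniform
  continuity of \<open>\<omega>'\<close> makes w small on short intervals. The factor n pays for
  passing from coordinates to the norm.\<close>

lemma solution_on_imp_solves:
  assumes sol: "solution_on f x A y0 t y" and t: "0 \<le> t" "t \<le> T"
  shows "solves t y" "y 0 = y0"
proof -
  show "y 0 = y0" using sol by (simp add: solution_on_def)
  obtain \<omega>' \<theta> where w: "continuous_on {0..t} \<omega>'" "mono_on {0..t} \<omega>'"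
    and \<theta>: "\<theta> 0 = 0" "\<theta> \<in> o[at_right 0](\<lambda>\<delta>. \<delta>)"
    and err: "\<And>i s u. 0 \<le> s \<Longrightarrow> s < u \<Longrightarrow> u \<le> t \<Longrightarrow> \<bar>y u $ i - y s $ i - increment f x A s u (y s) i\<bar> \<le> \<theta> (\<omega>' u - \<omega>' s)"
    using sol unfolding solution_on_def by blast
  define n where "n = real CARD('n)"
  have n: "0 < n" by (simp add: n_def)
  have "\<exists>d>0. \<forall>s u. 0 \<le> s \<and> s \<le> u \<and> u \<le> t \<and> u - s < d \<longrightarrow> norm (y u - y s - H s u (y s)) \<le> \<eta> * (\<omega>' u - \<omega>' s)"
    if \<eta>: "0 < \<eta>" for \<eta>
  proof -
    have "\<forall>\<^sub>F \<delta> in at_right 0. norm (\<theta> \<delta>) \<le> \<eta> / n * norm \<delta>"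
      by (rule landau_o.smallD[OF \<theta>(2)]) (use \<eta> n in simp)
    then obtain e where e: "0 < e" "\<And>\<delta>. 0 < \<delta> \<Longrightarrow> \<delta> < e \<Longrightarrow> \<bar>\<theta> \<delta>\<bar> \<le> \<eta> / n * \<bar>\<delta>\<bar>"
      unfolding eventually_at_right_field by auto
    have "uniformly_continuous_on {0..t} \<omega>'" using w(1) by (intro compact_uniformly_continuous) auto
    then obtain d where d: "0 < d" "\<And>x x'. x \<in> {0..t} \<Longrightarrow> x' \<in> {0..t} \<Longrightarrow> dist x' x < d \<Longrightarrow> dist (\<omega>' x') (\<omega>' x) < e"
      using e(1) unfolding uniformly_continuous_on_def by metis
    have "norm (y u - y s - H s u (y s)) \<le> \<eta> * (\<omega>' u - \<omega>' s)" if su: "0 \<le> s" "s \<le> u" "u \<le> t" "u - s < d" for s u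
    proof (cases "s = u")
      case True then show ?thesis using H_diag[of s] su t by simp
    next
      case False
      let ?w = "\<omega>' u - \<omega>' s"
      have w0: "0 \<le> ?w" using w(2) su by (auto simp: mono_on_def)
      have "?w < e" using d(2)[of s u] su by (auto simp: dist_real_def)
      \<comment> \<open>Intervals on which \<open>\<omega>'\<close> is constant are covered by
        \<theta> 0 = 0, since the limit at 0 does not see them.\<close>
      then have "\<theta> ?w \<le> \<eta> / n * ?w" using e(2)[of ?w] w0 \<theta>(1) by (cases "?w = 0") auto
      then have "\<bar>(y u - y s - H s u (y s)) $ i\<bar> \<le> \<eta> / n * ?w" for i
        using err[of s u i] su False by (simp add: H_def)
      then have "norm (y u - y s - H s u (y s)) \<le> n * (\<eta> / n * ?w)" unfolding n_def by (rule norm_le_card_mult)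
      then show ?thesis using n by simp
    qed
    then show ?thesis using d(1) by blast
  qed
  then show "solves t y" unfolding solves_def using w(2) by blast
qed

text \<open>The witnesses are \<omega> itself and \<theta>(\<delta>) = C \<delta>^q, which is
  o(\<delta>) since q > 1 and vanishes at 0.\<close>

lemma rough_sol_imp_solution_on:
  assumes sol: "rough_sol 0 t y" and y0: "y 0 = y0" and t: "t \<le> T"
  shows "solution_on f x A y0 t y"
proof -
  obtain C where C: "0 \<le> C" "\<And>s u. 0 \<le> s \<Longrightarrow> s \<le> u \<Longrightarrow> u \<le> t \<Longrightarrow> norm (y u - y s - H s u (y s)) \<le> C * (\<omega> u - \<omega> s) powr q"
    using sol unfolding rough_sol_def by blast
  have "(\<lambda>\<delta>. C * \<delta> powr q) \<in> o[at_right 0](\<lambda>\<delta>. \<delta>)"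
  proof (rule landau_o.smallI)
    fix e :: real assume e: "0 < e"
    have "\<forall>\<^sub>F \<delta> in at_right 0. 0 < \<delta> \<and> C * \<delta> powr (q - 1) \<le> e"
      using q e by (intro eventually_conj eventually_mult_powr_le eventually_at_right_less) auto
    then show "\<forall>\<^sub>F \<delta> in at_right 0. norm (C * \<delta> powr q) \<le> e * norm \<delta>"
    proof eventually_elim
      case (elim \<delta>)
      have "C * \<delta> powr q = C * \<delta> powr (q - 1) * \<delta>" using elim by (simp add: powr_diff)
      also have "\<dots> \<le> e * \<delta>" using elim by (intro mult_right_mono) auto
      finally show ?case using elim C(1) by simp
    qed
  qed
  moreover have "\<bar>y u $ i - y s $ i - increment f x A s u (y s) i\<bar> \<le> C * (\<omega> u - \<omega> s) powr q"
    if "0 \<le> s \<and> s < u \<and> u \<le> t" for i s u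
    using order_trans[OF component_le_norm_cart[of "y u - y s - H s u (y s)" i] C(2)[of s u]] that by (simp add: H_def)
  moreover have "continuous_on {0..t} \<omega>" "mono_on {0..t} \<omega>"
    using \<omega> t by (auto intro: continuous_on_subset mono_on_subset)
  ultimately show ?thesis
    unfolding solution_on_def using y0 C(1)
    by (intro conjI exI[of _ \<omega>] exI[of _ "\<lambda>\<delta>. C * \<delta> powr q"]) auto
qed

lemma discrete_approx_traj: "traj ts 0 K (discrete_approx f x A y0 ts)"
  by (simp add: traj_def H_def)

end

theorem theorem3p3:
  fixes p \<gamma> T :: real
    and \<omega> :: "real \<Rightarrow> real"
    and x :: "real \<Rightarrow> real^'d::finite"
    and A :: "'d \<Rightarrow> 'd \<Rightarrow> real \<Rightarrow> real \<Rightarrow> real"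
    and f :: "'n::finite \<Rightarrow> 'd \<Rightarrow> real^'n \<Rightarrow> real"
    and y0 :: "real^'n"
  assumes "2 \<le> p" and "p < \<gamma>" and "\<gamma> \<le> 3"
    and "0 < T"
    and "continuous_on {0..T} x"
    and "finite_p_variation_by \<omega> p T x"
    and "area_data \<omega> p T x A"
    and "C_class \<gamma> f"
  shows "(\<exists>\<tau> y. maximal_solution f x A y0 T \<tau> y) \<and>
    (\<forall>\<tau> y. maximal_solution f x A y0 T \<tau> y \<longrightarrow>
      (\<forall>t y'. 0 \<le> t \<and> t < \<tau> \<and> solution_on f x A y0 t y' \<longrightarrow> (\<forall>s\<in>{0..t}. y' s = y s)) \<and>
      (\<forall>t \<epsilon>. 0 \<le> t \<and> t < \<tau> \<and> 0 < \<epsilon> \<longrightarrow>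
        (\<exists>\<delta>>0. \<forall>(K::nat) (ts::nat \<Rightarrow> real).
          ts 0 = 0 \<and> ts K = t \<and> (\<forall>k<K. ts k < ts (Suc k) \<and> ts (Suc k) - ts k < \<delta>) \<longrightarrow>
          (\<forall>k\<le>K. norm (discrete_approx f x A y0 ts k - y (ts k)) < \<epsilon>))))"
proof -
  obtain N \<alpha> where N: "0 < \<alpha>" "\<alpha> \<le> 1" "\<gamma> = real N + \<alpha>" "\<And>i j. holder_smooth N \<alpha> (f i j)"
    using assms(8) unfolding C_class_def by blast
  \<comment> \<open>From 2 \<le> p < \<gamma> \<le> 3 and 0 < \<alpha> \<le> 1 the integer part in
    the decomposition of \<gamma> is 2; \<gamma> = 3 falls under \<alpha> = 1.\<close>
  have "1 < real N" "real N < 3" using N assms(1-3) by linarith+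
  then have "N = 2" by linarith
  interpret rough_equation f x A \<omega> T p \<alpha>
    by unfold_locales (use N \<open>N = 2\<close> assms in auto)
  obtain \<tau> y where \<tau>: "0 < \<tau>" "\<tau> \<le> T" "y 0 = y0" "\<And>t. 0 \<le> t \<Longrightarrow> t < \<tau> \<Longrightarrow> rough_sol 0 t y"
    "\<tau> = T \<or> filterlim (\<lambda>t. norm (y t)) at_top (at_left \<tau>)"
    using maximal_rough_sol[of y0] by blast
  have "maximal_solution f x A y0 T \<tau> y"
    unfolding maximal_solution_def solution_before_def using \<tau> by (auto intro!: rough_sol_imp_solution_on)
  then have existence: "\<exists>\<tau> y. maximal_solution f x A y0 T \<tau> y" by blast
  have solves: "0 \<le> t" "t \<le> T" "solves t y" "y 0 = y0"
    if "maximal_solution f x A y0 T \<tau> y" "0 \<le> t" "t < \<tau>" for \<tau> y t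
  proof -
    have "solution_on f x A y0 t y" and t: "t \<le> T"
      using that by (auto simp: maximal_solution_def solution_before_def)
    then show "0 \<le> t" "t \<le> T" "solves t y" "y 0 = y0" using that solution_on_imp_solves by auto
  qed
  have uniqueness: "y' s = y s"
    if m: "maximal_solution f x A y0 T \<tau> y" and t: "0 \<le> t" "t < \<tau>" and y': "solution_on f x A y0 t y'"
      and s: "s \<in> {0..t}" for \<tau> y t y' s
    using solves_unique[of t y' y s] solves[OF m t] solution_on_imp_solves[OF y'] s by auto
  have convergence: "\<exists>\<delta>>0. \<forall>(K::nat) (ts::nat \<Rightarrow> real).
          ts 0 = 0 \<and> ts K = t \<and> (\<forall>k<K. ts k < ts (Suc k) \<and> ts (Suc k) - ts k < \<delta>) \<longrightarrow>
          (\<forall>k\<le>K. norm (discrete_approx f x A y0 ts k - y (ts k)) < \<epsilon>)"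
    if m: "maximal_solution f x A y0 T \<tau> y" and t: "0 \<le> t" "t < \<tau>" and \<epsilon>: "0 < \<epsilon>" for \<tau> y t \<epsilon>
  proof -
    note sol = solves[OF m t]
    obtain \<delta> where \<delta>: "0 < \<delta>" "\<And>K ts Y. ts 0 = 0 \<Longrightarrow> ts K = t \<Longrightarrow> (\<forall>k<K. ts k \<le> ts (Suc k) \<and> ts (Suc k) - ts k < \<delta>) \<Longrightarrow>
       Y 0 = y 0 \<Longrightarrow> traj ts 0 K Y \<Longrightarrow> \<forall>k\<le>K. norm (Y k - y (ts k)) < \<epsilon>"
      using scheme_converges[OF sol(1-3) \<epsilon>] by blast
    show ?thesis
    proof (rule exI[of _ \<delta>], intro conjI \<delta>(1), rule allI, rule allI, rule impI)
      fix K ts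
      assume "ts 0 = 0 \<and> ts K = t \<and> (\<forall>k<K. ts k < ts (Suc k) \<and> ts (Suc k) - ts k < \<delta>)"
      then show "\<forall>k\<le>K. norm (discrete_approx f x A y0 ts k - y (ts k)) < \<epsilon>"
        using sol(4) by (intro \<delta>(2) discrete_approx_traj) auto
    qed
  qed
  show ?thesis using existence uniqueness convergence by (intro conjI allI impI ballI) blast+
qed

end
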